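(* Let $n,k,m$ be integers with $0\le m\le k\le\lfloor n/2\rfloor$. Then, as subvarieties of $Y_{n-m}$, the (embedded) $\Delta$-Springer variety $\mathcal{B}^{\Delta}_{(n-k,k),m}$ is equal to the closed subvariety $\bigcup_{\mathbf a\in\mathbb{B}_{n-k,k,m}}K^{\mathrm e}_{\mathbf a}$ of the (embedded) exotic Springer fiber $\mathcal{B}^{\mathrm e}_{((n-m-k),(k))}$. In particular, there exists an isomorphism of algebraic varieties from the $\Delta$-Springer variety $\mathcal{B}^{\Delta}_{(n-k,k),m}$ to a closed subvariety of the exotic Springer fiber $\mathcal{B}^{\mathrm e}_{((n-m-k),(k))}$.
   Context: All varieties and vector spaces are over $\mathbb{C}$; flags have $F_0=\{0\}$. $\Delta$-Springer variety: for a nilpotent $x\in\mathfrak{gl}_n(\mathbb{C})$ of Jordan type $(n-k,k)$, $\mathcal{B}^{\Delta}_{(n-k,k),m}$ is the variety of flags $F_1\subseteq\dots\subseteq F_{n-m}\subseteq\mathbb{C}^n$ with $\dim F_i=i$, $xF_i\subseteq F_{i-1}$ for $1\le i\le n-m$, and $\mathrm{im}\,x^m\subseteq F_{n-m}$. Exotic Springer fiber: let $\mathbb{C}^{2q}$ carry a symplectic form $\omega$, let $x$ be a nilpotent endomorphism with $\omega(xv,w)=\omega(v,xw)$ for all $v,w$, and let $v\in\mathbb{C}^{2q}$. Then $\mathcal{B}^{\mathrm e}_{x,v}$ is the variety of flags $F_1\subseteq\dots\subseteq F_q\subseteq\mathbb{C}^{2q}$ with $\dim F_i=i$, $F_i$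 isotropic for $\omega$, $xF_i\subseteq F_{i-1}$, and $v\in F_q$. Up to isomorphism it depends only on the $\mathrm{Sp}(\mathbb{C}^{2q},\omega)$-orbit of $(x,v)$; these orbits are labeled by bipartitions of $q$, and for the one-row bipartition $((p),(q-p))$ the orbit consists of pairs with $x$ of Jordan type $(q,q)$ and $x^pv=0$, $x^{p-1}v\ne0$ (with $v=0$ if $p=0$). Embedded versions: fix $N>n$ and let $\mathbb{C}^{2N}$ have basis $e_1,\dots,e_N,f_1,\dots,f_N$ with nilpotent $z$: $ze_i=e_{i-1}$, $zf_i=f_{i-1}$, $e_0=f_0=0$. For $r\le N$, $Y_r$ is the variety of flags $F_1\subseteq\dots\subseteq F_r\subseteq\mathbb{C}^{2N}$ with $\dim F_i=i$, $zF_i\subseteq F_{i-1}$. Put $E_{n-k,k}=\mathrm{span}(e_1,\dots,e_{n-k},f_1,\dots,f_k)$. One identifies $$\mathcal{B}^{\Delta}_{(n-k,k),m}=\{F_\bullet\in Y_{n-m}\mid z^m(E_{n-k,k})\subseteq F_{n-m}\subseteq E_{n-k,k}\},\qquad \mathcal{B}^{\mathrm e}_{((p),(q-p))}=\{F_\bullet\in Y_q\mid e_p\in F_q\}$$ (the second identification, with the abstractly defined exotic Springer fiber, is known). Diagrams: $\mathbb{B}_{n-k,k,m}$ is the set of crossingless diagrams on vertices $1,\dots,n$ of a horizontal line, drawn below the line, in which every vertex is an endpoint of exactly one cup (arc joining two vertices) or attached to a vertical ray, with exactly $k$ cups, and such that each of the vertices $n-m+1,\dots,n$ is attached to a ray or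 is the right endpoint of a cup. Deleting everything to the right of a cut line between $n-m$ and $n-m+1$ turns each cup whose right endpoint is in $\{n-m+1,\dots,n\}$ into a half-cup attached to its left endpoint; this embeds $\mathbb{B}_{n-k,k,m}$ into the set $\mathbb{B}_{((n-m-k),(k))}$ of crossingless diagrams on $n-m$ points made of cups, half-cups and rays with a total of $k$ cups and half-cups, which indexes the irreducible components of $\mathcal{B}^{\mathrm e}_{((n-m-k),(k))}$. For $\mathbf a\in\mathbb{B}_{n-k,k,m}$, $K^{\mathrm e}_{\mathbf a}$ denotes the irreducible component of $\mathcal{B}^{\mathrm e}_{((n-m-k),(k))}$ indexed by the image of $\mathbf a$; it is the set of $F_\bullet\in Y_{n-m}$ with (i) $F_j=z^{-\frac12(j-i+1)}F_{i-1}$ (preimage under a power of $z$) if $i<j\le n-m$ are joined by a cup, and (ii) $F_i=F_{i-1}+\mathrm{span}(e_{\frac12(i+\rho(i))})$ if $i\le n-m$ is attached to a ray, $\rho(i)$ being the number of rays attached to vertices $\le i$; half-cups impose no condition. *)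

theory Defs
  imports
    "HOL-Analysis.Abstract_Topology"
    "Jordan_Normal_Form.Jordan_Normal_Form"
    "Jordan_Normal_Form.DL_Rank"
begin

section \<open>Subspaces and partial flags of \<open>\<complex>\<^sup>d\<close>\<close>

abbreviation cspace :: "nat \<Rightarrow> (complex, complex vec) module" where
  "cspace d \<equiv> module_vec TYPE(complex) d"

abbreviation cspan :: "nat \<Rightarrow> complex vec set \<Rightarrow> complex vec set" where
  "cspan d \<equiv> LinearCombinations.module.span class_ring (cspace d)"

definition subspace_of_dim :: "nat \<Rightarrow> nat \<Rightarrow> complex vec set \<Rightarrow> bool" where
  "subspace_of_dim d i W \<longleftrightarrow>
     subspace class_ring W (cspace d) \<and>
     vectorspace.fin_dim class_ring ((cspace d)\<lparr>carrier := W\<rparr>) \<and>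
     vectorspace.dim class_ring ((cspace d)\<lparr>carrier := W\<rparr>) = i"

text \<open>A flag \<open>F\<^sub>1 \<subseteq> \<dots> \<subseteq> F\<^sub>r\<close> is the list \<open>[F\<^sub>0, F\<^sub>1, \<dots>, F\<^sub>r]\<close> with \<open>F\<^sub>0 = {0}\<close>, so
  that \<open>F ! i\<close> is \<open>F\<^sub>i\<close>.\<close>

type_synonym flag = "complex vec set list"

definition flags :: "nat \<Rightarrow> nat \<Rightarrow> flag set" where
  "flags d r = {F. length F = Suc r \<and> F ! 0 = {0\<^sub>v d} \<and>
     (\<forall>i\<in>{1..r}. subspace_of_dim d i (F ! i)) \<and>
     (\<forall>i\<in>{1..r}. F ! (i - 1) \<subseteq> F ! i)}"

definition nilp_flags :: "nat \<Rightarrow> nat \<Rightarrow> complex mat \<Rightarrow> flag set" where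
  "nilp_flags d r x = {F \<in> flags d r. \<forall>i\<in>{1..r}. \<forall>w\<in>F ! i. x *\<^sub>v w \<in> F ! (i - 1)}"

section \<open>Delta-Springer varieties and exotic Springer fibers\<close>

text \<open>Parts equal to \<open>0\<close> are dropped because \<^const>\<open>jordan_nf\<close> forbids empty blocks.\<close>

definition nilp_jordan_type :: "complex mat \<Rightarrow> nat list \<Rightarrow> bool" where
  "nilp_jordan_type x ls \<longleftrightarrow> jordan_nf x (map (\<lambda>l. (l, 0)) (filter (\<lambda>l. l \<noteq> 0) ls))"

definition delta_springer :: "nat \<Rightarrow> nat \<Rightarrow> complex mat \<Rightarrow> flag set" where
  "delta_springer n m x =
     {F \<in> nilp_flags n (n - m) x. \<forall>w\<in>carrier_vec n. (x ^\<^sub>m m) *\<^sub>v w \<in> F ! (n - m)}"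

definition symplectic_form :: "nat \<Rightarrow> (complex vec \<Rightarrow> complex vec \<Rightarrow> complex) \<Rightarrow> bool" where
  "symplectic_form d \<omega> \<longleftrightarrow>
     (\<forall>u\<in>carrier_vec d. \<forall>v\<in>carrier_vec d. \<forall>w\<in>carrier_vec d. \<forall>c.
        \<omega> (u + v) w = \<omega> u w + \<omega> v w \<and> \<omega> (c \<cdot>\<^sub>v u) w = c * \<omega> u w \<and>
        \<omega> w (u + v) = \<omega> w u + \<omega> w v \<and> \<omega> w (c \<cdot>\<^sub>v u) = c * \<omega> w u) \<and>
     (\<forall>v\<in>carrier_vec d. \<omega> v v = 0) \<and>
     (\<forall>v\<in>carrier_vec d. (\<forall>w\<in>carrier_vec d. \<omega> v w = 0) \<longrightarrow> v = 0\<^sub>v d)"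

definition isotropic :: "(complex vec \<Rightarrow> complex vec \<Rightarrow> complex) \<Rightarrow> complex vec set \<Rightarrow> bool" where
  "isotropic \<omega> W \<longleftrightarrow> (\<forall>u\<in>W. \<forall>w\<in>W. \<omega> u w = 0)"

definition exotic_springer ::
    "nat \<Rightarrow> (complex vec \<Rightarrow> complex vec \<Rightarrow> complex) \<Rightarrow> complex mat \<Rightarrow> complex vec \<Rightarrow> flag set" where
  "exotic_springer q \<omega> x v =
     {F \<in> nilp_flags (2 * q) q x. (\<forall>i\<in>{1..q}. isotropic \<omega> (F ! i)) \<and> v \<in> F ! q}"

text \<open>The pairs \<open>(x, v)\<close> in the symplectic orbit labeled by the bipartition \<open>((p), (q - p))\<close>.
  For \<open>p = 0\<close> the condition \<open>x\<^sup>p v = 0\<close> says \<open>v = 0\<close>.\<close>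

definition one_row_exotic_pair ::
    "nat \<Rightarrow> nat \<Rightarrow> (complex vec \<Rightarrow> complex vec \<Rightarrow> complex) \<Rightarrow> complex mat \<Rightarrow> complex vec \<Rightarrow> bool" where
  "one_row_exotic_pair q p \<omega> x v \<longleftrightarrow>
     x \<in> carrier_mat (2 * q) (2 * q) \<and> v \<in> carrier_vec (2 * q) \<and>
     (\<forall>u\<in>carrier_vec (2 * q). \<forall>w\<in>carrier_vec (2 * q). \<omega> (x *\<^sub>v u) w = \<omega> u (x *\<^sub>v w)) \<and>
     nilp_jordan_type x [q, q] \<and>
     (x ^\<^sub>m p) *\<^sub>v v = 0\<^sub>v (2 * q) \<and>
     (p > 0 \<longrightarrow> (x ^\<^sub>m (p - 1)) *\<^sub>v v \<noteq> 0\<^sub>v (2 * q))"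

section \<open>Embedded versions in \<open>\<complex>\<^sup>2\<^sup>N\<close>\<close>

text \<open>The basis \<open>e\<^sub>1, \<dots>, e\<^sub>N, f\<^sub>1, \<dots>, f\<^sub>N\<close> is the standard basis in this order.\<close>

definition evec :: "nat \<Rightarrow> nat \<Rightarrow> complex vec" where
  "evec N i = (if i = 0 then 0\<^sub>v (2 * N) else unit_vec (2 * N) (i - 1))"

definition fvec :: "nat \<Rightarrow> nat \<Rightarrow> complex vec" where
  "fvec N i = (if i = 0 then 0\<^sub>v (2 * N) else unit_vec (2 * N) (N + i - 1))"

definition zmat :: "nat \<Rightarrow> complex mat" where
  "zmat N = mat (2 * N) (2 * N) (\<lambda>(i, j). if j = Suc i \<and> j \<noteq> N then 1 else 0)"

lemma zmat_carrier: "zmat N \<in> carrier_mat (2 * N) (2 * N)"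
  by (simp add: zmat_def)

lemma zmat_unit_vec:
  assumes "j < 2 * N"
  shows "zmat N *\<^sub>v unit_vec (2 * N) j =
           (if j = 0 \<or> j = N then 0\<^sub>v (2 * N) else unit_vec (2 * N) (j - 1))"
proof (rule eq_vecI)
  let ?w = "if j = 0 \<or> j = N then 0\<^sub>v (2 * N) else unit_vec (2 * N) (j - 1) :: complex vec"
  show "dim_vec (zmat N *\<^sub>v unit_vec (2 * N) j) = dim_vec ?w"
    by (simp add: zmat_def)
  fix l assume "l < dim_vec ?w"
  then have l: "l < 2 * N" by (simp split: if_splits)
  have "(zmat N *\<^sub>v unit_vec (2 * N) j) $ l = row (zmat N) l \<bullet> unit_vec (2 * N) j"
    using l by (intro index_mult_mat_vec) (simp add: zmat_def)
  also have "\<dots> = row (zmat N) l $ j"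
    using assms by (rule scalar_prod_right_unit)
  also have "\<dots> = zmat N $$ (l, j)"
    using assms l by (intro index_row) (simp_all add: zmat_def)
  also have "\<dots> = (if j = Suc l \<and> j \<noteq> N then 1 else 0)"
    using assms l unfolding zmat_def by (subst index_mat) simp_all
  also have "\<dots> = ?w $ l"
    using assms l by (cases j) (auto simp: unit_vec_def)
  finally show "(zmat N *\<^sub>v unit_vec (2 * N) j) $ l = ?w $ l" .
qed

lemma zmat_evec: "i \<in> {1..N} \<Longrightarrow> zmat N *\<^sub>v evec N i = evec N (i - 1)"
  using zmat_unit_vec[of "i - 1" N] by (auto simp: evec_def)

lemma zmat_fvec: "i \<in> {1..N} \<Longrightarrow> zmat N *\<^sub>v fvec N i = fvec N (i - 1)"
  using zmat_unit_vec[of "N + i - 1" N] by (auto simp: fvec_def)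

definition Yvar :: "nat \<Rightarrow> nat \<Rightarrow> flag set" where
  "Yvar N r = nilp_flags (2 * N) r (zmat N)"

definition Espace :: "nat \<Rightarrow> nat \<Rightarrow> nat \<Rightarrow> complex vec set" where
  "Espace N a b = cspan (2 * N) (evec N ` {1..a} \<union> fvec N ` {1..b})"

definition delta_springer_emb :: "nat \<Rightarrow> nat \<Rightarrow> nat \<Rightarrow> nat \<Rightarrow> flag set" where
  "delta_springer_emb N n k m =
     {F \<in> Yvar N (n - m).
        (\<lambda>w. (zmat N ^\<^sub>m m) *\<^sub>v w) ` Espace N (n - k) k \<subseteq> F ! (n - m) \<and>
        F ! (n - m) \<subseteq> Espace N (n - k) k}"

definition exotic_springer_emb :: "nat \<Rightarrow> nat \<Rightarrow> nat \<Rightarrow> flag set" where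
  "exotic_springer_emb N q p = {F \<in> Yvar N q. evec N p \<in> F ! q}"

section \<open>Cup diagrams\<close>

text \<open>A diagram on the vertices \<open>1, \<dots>, n\<close> is given by its set \<open>C\<close> of cups \<open>(i, j)\<close>, \<open>i < j\<close>;
  all vertices that are not endpoints of a cup carry a ray.  It is crossingless if no two cups
  cross and no ray starts below a cup.\<close>

definition endpoints :: "(nat \<times> nat) set \<Rightarrow> nat set" where
  "endpoints C = fst ` C \<union> snd ` C"

definition crossingless :: "nat \<Rightarrow> (nat \<times> nat) set \<Rightarrow> bool" where
  "crossingless n C \<longleftrightarrow>
     (\<forall>(i, j)\<in>C. 1 \<le> i \<and> i < j \<and> j \<le> n) \<and>
     (\<forall>c\<in>C. \<forall>c'\<in>C. c \<noteq> c' \<longrightarrow> {fst c, snd c} \<inter> {fst c', snd c'} = {}) \<and>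
     (\<forall>(i, j)\<in>C. \<forall>(i', j')\<in>C. \<not> (i < i' \<and> i' < j \<and> j < j')) \<and>
     (\<forall>(i, j)\<in>C. \<forall>v\<in>{1..n} - endpoints C. \<not> (i < v \<and> v < j))"

definition cup_diagrams :: "nat \<Rightarrow> nat \<Rightarrow> nat \<Rightarrow> (nat \<times> nat) set set" where
  "cup_diagrams n k m =
     {C. crossingless n C \<and> card C = k \<and> (\<forall>v\<in>{n - m + 1..n}. v \<notin> fst ` C)}"

text \<open>A diagram with half-cups on \<open>1, \<dots>, r\<close> is a pair \<open>(C, H)\<close> of the set of its cups and the
  set of vertices carrying a half-cup; the remaining vertices carry rays.\<close>

type_synonym half_diagram = "(nat \<times> nat) set \<times> nat set"

definition cut_diagram :: "nat \<Rightarrow> (nat \<times> nat) set \<Rightarrow> half_diagram" where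
  "cut_diagram r C = ({(i, j) \<in> C. j \<le> r}, {i. i \<le> r \<and> (\<exists>j>r. (i, j) \<in> C)})"

definition ray_vertices :: "nat \<Rightarrow> half_diagram \<Rightarrow> nat set" where
  "ray_vertices r D = {1..r} - (endpoints (fst D) \<union> snd D)"

definition exotic_component :: "nat \<Rightarrow> nat \<Rightarrow> half_diagram \<Rightarrow> flag set" where
  "exotic_component N r D =
     {F \<in> Yvar N r.
        (\<forall>(i, j)\<in>fst D.
           F ! j = {w \<in> carrier_vec (2 * N). (zmat N ^\<^sub>m ((j - i + 1) div 2)) *\<^sub>v w \<in> F ! (i - 1)}) \<and>
        (\<forall>i\<in>ray_vertices r D.
           F ! i = {u + c \<cdot>\<^sub>v evec N ((i + card {v \<in> ray_vertices r D. v \<le> i}) div 2) | u c.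
                      u \<in> F ! (i - 1)})}"

section \<open>Flag varieties as algebraic varieties\<close>

text \<open>The variety of flags \<open>F\<^sub>1 \<subseteq> \<dots> \<subseteq> F\<^sub>r\<close> in \<open>\<complex>\<^sup>d\<close> is the geometric quotient of the variety of
  frames, i.e. of \<open>d \<times> r\<close> matrices with independent columns, by the group of invertible upper
  triangular \<open>r \<times> r\<close> matrices: a frame is sent to the flag of the spans of its first columns.
  Its Zariski topology is the quotient topology.  The quotient map has polynomial sections over
  the members of an open cover, so for a locally closed \<open>X\<close> with its reduced structure a function
  on an open part of \<open>X\<close> is regular iff its pullback to frames is regular, i.e. locally a
  quotient of polynomials in the matrix entries.\<close>

inductive_set mat_polys :: "nat \<Rightarrow> nat \<Rightarrow> (complex mat \<Rightarrow> complex) set"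
  for d r :: nat where
  const: "(\<lambda>A. c) \<in> mat_polys d r"
| entry: "i < d \<Longrightarrow> j < r \<Longrightarrow> (\<lambda>A. A $$ (i, j)) \<in> mat_polys d r"
| add: "p \<in> mat_polys d r \<Longrightarrow> q \<in> mat_polys d r \<Longrightarrow> (\<lambda>A. p A + q A) \<in> mat_polys d r"
| mult: "p \<in> mat_polys d r \<Longrightarrow> q \<in> mat_polys d r \<Longrightarrow> (\<lambda>A. p A * q A) \<in> mat_polys d r"

definition frames :: "nat \<Rightarrow> nat \<Rightarrow> complex mat set" where
  "frames d r = {A \<in> carrier_mat d r. vec_space.rank d A = r}"

definition flag_of_frame :: "nat \<Rightarrow> complex mat \<Rightarrow> flag" where
  "flag_of_frame d A = map (\<lambda>i. cspan d (set (take i (cols A)))) [0..<Suc (dim_col A)]"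

definition zariski_frames :: "nat \<Rightarrow> nat \<Rightarrow> complex mat topology" where
  "zariski_frames d r = topology_generated_by {{A \<in> frames d r. p A \<noteq> 0} | p. p \<in> mat_polys d r}"

definition zariski_flags :: "nat \<Rightarrow> nat \<Rightarrow> flag topology" where
  "zariski_flags d r = topology (\<lambda>U. U \<subseteq> flags d r \<and>
     openin (zariski_frames d r) {A \<in> frames d r. flag_of_frame d A \<in> U})"

lemma topspace_zariski_frames: "topspace (zariski_frames d r) = frames d r"
proof (rule antisym)
  show "topspace (zariski_frames d r) \<subseteq> frames d r"
    unfolding zariski_frames_def topology_generated_by_topspace by (rule Union_least) blast
next
  show "frames d r \<subseteq> topspace (zariski_frames d r)"
  proof
    fix A assume A: "A \<in> frames d r"
    then have "A \<in> {A \<in> frames d r. (\<lambda>A. 1 :: complex) A \<noteq> 0}" by simp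
    moreover have "{A \<in> frames d r. (\<lambda>A. 1 :: complex) A \<noteq> 0}
        \<in> {{A \<in> frames d r. p A \<noteq> 0} | p. p \<in> mat_polys d r}"
      by (rule CollectI, rule exI, rule conjI[OF refl], rule mat_polys.const)
    ultimately show "A \<in> topspace (zariski_frames d r)"
      unfolding zariski_frames_def topology_generated_by_topspace by (rule UnionI[rotated])
  qed
qed

lemma openin_zariski_flags:
  "openin (zariski_flags d r) U \<longleftrightarrow> U \<subseteq> flags d r \<and>
     openin (zariski_frames d r) {A \<in> frames d r. flag_of_frame d A \<in> U}"
proof -
  let ?\<pi> = "\<lambda>U. {A \<in> frames d r. flag_of_frame d A \<in> U}"
  have inter: "?\<pi> (S \<inter> T) = ?\<pi> S \<inter> ?\<pi> T" for S T by auto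
  have union: "?\<pi> (\<Union>\<K>) = (\<Union>S\<in>\<K>. ?\<pi> S)" for \<K> by auto
  have "istopology (\<lambda>U. U \<subseteq> flags d r \<and> openin (zariski_frames d r) (?\<pi> U))"
    unfolding istopology_def inter union by (blast intro: openin_Union openin_Int)
  then show ?thesis
    unfolding zariski_flags_def by (simp add: topology_inverse')
qed

definition regular_on :: "nat \<Rightarrow> nat \<Rightarrow> flag set \<Rightarrow> (flag \<Rightarrow> complex) \<Rightarrow> bool" where
  "regular_on d r U f \<longleftrightarrow>
     (\<forall>A\<in>frames d r. flag_of_frame d A \<in> U \<longrightarrow>
        (\<exists>p\<in>mat_polys d r. \<exists>q\<in>mat_polys d r. q A \<noteq> 0 \<and>
           (\<forall>B\<in>frames d r. flag_of_frame d B \<in> U \<and> q B \<noteq> 0 \<longrightarrow> f (flag_of_frame d B) = p B / q B)))"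

definition variety_morphism ::
    "nat \<Rightarrow> nat \<Rightarrow> flag set \<Rightarrow> nat \<Rightarrow> nat \<Rightarrow> flag set \<Rightarrow> (flag \<Rightarrow> flag) \<Rightarrow> bool" where
  "variety_morphism d r X d' r' X' \<phi> \<longleftrightarrow>
     continuous_map (subtopology (zariski_flags d r) X) (subtopology (zariski_flags d' r') X') \<phi> \<and>
     (\<forall>V f. openin (subtopology (zariski_flags d' r') X') V \<and> regular_on d' r' V f \<longrightarrow>
        regular_on d r {F \<in> X. \<phi> F \<in> V} (f \<circ> \<phi>))"

definition variety_isomorphism ::
    "nat \<Rightarrow> nat \<Rightarrow> flag set \<Rightarrow> nat \<Rightarrow> nat \<Rightarrow> flag set \<Rightarrow> (flag \<Rightarrow> flag) \<Rightarrow> bool" where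
  "variety_isomorphism d r X d' r' X' \<phi> \<longleftrightarrow>
     bij_betw \<phi> X X' \<and> variety_morphism d r X d' r' X' \<phi> \<and>
     variety_morphism d' r' X' d r X (inv_into X \<phi>)"

end

theory Submission
  imports Defs
begin

text \<open>Write \<open>E\<^bsub>a,b\<^esub>\<close> for the span of \<open>e\<^sub>1, \<dots>, e\<^sub>a, f\<^sub>1, \<dots>, f\<^sub>b\<close>.  A \<open>z\<close>-stable subspace of
  codimension \<open>g\<close> in \<open>E\<^bsub>a,b\<^esub>\<close> contains \<open>z\<^sup>gE\<^bsub>a,b\<^esub>\<close>, because a vector \<open>w\<close> whose powers
  \<open>w, zw, \<dots>, z\<^bsup>g\<^esup>w\<close> all avoid the subspace would contribute \<open>g + 1\<close> dimensions.  Hence the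
  condition on the image of \<open>z\<^sup>m\<close> is automatic, and the embedded Delta-Springer variety consists of
  the flags with \<open>F\<^bsub>n-m\<^esub> \<subseteq> E\<^bsub>n-k,k\<^esub>\<close>.  A diagram on \<open>r\<close> vertices with \<open>c\<close> cups and \<open>h\<close>
  half-cups forces \<open>F\<^sub>r \<subseteq> E\<^bsub>r-c,c+h\<^esub>\<close>.  Conversely, if \<open>F\<^sub>r\<close> lies in such a block that is
  minimal in the first index, then removing the last vertex of the flag produces a diagram for
  it by induction; the half-cups are the cups whose right ends have been removed already.

  In the abstract setting, a generator over \<open>v\<close> and a second one independent of it give a linear
  embedding of \<open>\<complex>\<^sup>n\<close> into \<open>\<complex>\<^bsup>2(n-m)\<^esup>\<close> that intertwines the nilpotent maps.  Flags stable
  under a map of type \<open>(q,q)\<close> are isotropic, so the embedding carries the Delta-Springer variety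
  onto the exotic flags contained in its image.  This is a linear, hence closed, condition, and
  linear maps of frames induce morphisms.\<close>

section \<open>Frames, dimensions and lines\<close>

text \<open>The number h of half-cups is the codimension of the last flag member in its block: this
  is the equation \<open>a + b = r + h\<close>. Appending a vertex changes (a, b, h) by (1, 1, 1)
  for a half-cup, by (1, 0, 0) for a ray and by (0, 0, -1) for a cup, so the type of a vertex is
  read off from the smaller block that already holds the previous member. The obstacle is that a
  flag lies in many blocks, and too large a block would classify the step wrongly; minimality of the
  first index removes the ambiguity and must be carried through the induction. The minimal first
  index may be smaller than n - k: then there are fewer than m half-cups, and the spare vertices
  beyond the cut become rays. In the abstract setting the numbers match because a vector v killed by
  exactly the power p = n - m - k is the m-th power applied to a vector of height p + m = n - k, the
  length of the longer Jordan string of x. The inverse isomorphism is induced by a left inverse of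
  the embedding, which may collapse other flags, so hypotheses on linear maps are made only on the
  flags concerned.\<close>

definition inj_mat :: "nat \<Rightarrow> nat \<Rightarrow> complex mat \<Rightarrow> bool" where
  "inj_mat d r A \<longleftrightarrow> A \<in> carrier_mat d r \<and>
     (\<forall>c\<in>carrier_vec r. A *\<^sub>v c = 0\<^sub>v d \<longrightarrow> c = 0\<^sub>v r)"

definition mat_range :: "complex mat \<Rightarrow> complex vec set" where
  "mat_range A = {A *\<^sub>v c | c. c \<in> carrier_vec (dim_col A)}"

lemma cspan_cols:
  assumes "A \<in> carrier_mat d r"
  shows "cspan d (set (cols A)) = mat_range A"
proof -
  interpret vec_space "TYPE(complex)" d .
  show ?thesis
    using col_space_eq[OF assms] assms unfolding col_space_def mat_range_def by auto
qed

lemma inj_mat_carrier: "inj_mat d r A \<Longrightarrow> A \<in> carrier_mat d r"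
  by (simp add: inj_mat_def)

lemma mult_mat_unit_vec:
  fixes A :: "complex mat"
  assumes "A \<in> carrier_mat d r" "j < r"
  shows "A *\<^sub>v unit_vec r j = col A j"
proof (rule eq_vecI)
  fix i assume "i < dim_vec (col A j)"
  then have i: "i < d" using assms by auto
  have "row A i \<bullet> unit_vec r j = row A i $ j"
    using assms(2) by (rule scalar_prod_right_unit)
  then show "(A *\<^sub>v unit_vec r j) $ i = col A j $ i" using i assms by auto
qed (use assms in auto)

text \<open>Independence is a property of the set of columns, so repetitions must be excluded first.
  Two equal columns put a difference of unit vectors into the kernel.\<close>

lemma inj_mat_distinct:
  assumes "inj_mat d r A"
  shows "distinct (cols A)"
proof (rule ccontr)
  have A: "A \<in> carrier_mat d r" using assms by (simp add: inj_mat_def)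
  assume "\<not> distinct (cols A)"
  then obtain i j where ij: "i < r" "j < r" "i \<noteq> j" "col A i = col A j"
    using A by (auto simp: distinct_conv_nth)
  let ?c = "unit_vec r i - unit_vec r j :: complex vec"
  have "A *\<^sub>v ?c = A *\<^sub>v unit_vec r i - A *\<^sub>v unit_vec r j"
    using A by (intro mult_minus_distrib_mat_vec) auto
  also have "\<dots> = col A i - col A j"
    using ij mult_mat_unit_vec[OF A] by auto
  also have "\<dots> = 0\<^sub>v d" using ij A by auto
  finally have "?c = 0\<^sub>v r" using assms unfolding inj_mat_def by auto
  then have "?c $ i = 0" using ij by simp
  then show False using ij by (simp add: unit_vec_def)
qed

lemma inj_mat_lin_indpt:
  assumes "A \<in> carrier_mat d r" "distinct (cols A)"
  shows "inj_mat d r A \<longleftrightarrow>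
    \<not> LinearCombinations.module.lin_dep class_ring (cspace d) (set (cols A))"
proof -
  interpret vec_space "TYPE(complex)" d .
  show ?thesis
    using lin_depI[OF assms(1) _ _ _ assms(2)] lin_depE[OF assms(1) _ assms(2)] assms(1)
    unfolding inj_mat_def by metis
qed

text \<open>Full rank gives a maximal independent subset with \<open>r\<close> elements, which
  forces the \<open>r\<close> columns to be distinct; after that, rank and independence of the
  column set determine each other.\<close>

lemma frames_iff: "A \<in> frames d r \<longleftrightarrow> inj_mat d r A"
proof -
  interpret vec_space "TYPE(complex)" d .
  show ?thesis
  proof
    assume "A \<in> frames d r"
    then have A: "A \<in> carrier_mat d r" and r: "rank A = r" unfolding frames_def by auto
    have "maximal S (\<lambda>T. T \<subseteq> set (cols A) \<and> lin_indpt T) \<Longrightarrow> card S \<le> card (set (cols A))" for S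
      by (simp add: card_mono maximal_def)
    moreover obtain S where "maximal S (\<lambda>T. T \<subseteq> set (cols A) \<and> lin_indpt T)"
      using maximal_exists[of "(\<lambda>T. T \<subseteq> set (cols A) \<and> lin_indpt T)" "card (set (cols A))" "{}"]
      by (meson List.finite_set card_mono empty_iff empty_subsetI finite_lin_indpt2 rev_finite_subset)
    ultimately have "r \<le> card (set (cols A))" using rank_card_indpt[OF A] r by metis
    then have dist: "distinct (cols A)"
      using A card_length[of "cols A"] by (intro card_distinct) auto
    show "inj_mat d r A"
      using full_rank_lin_indpt[OF A r dist] inj_mat_lin_indpt[OF A dist] by simp
  next
    assume inj: "inj_mat d r A"
    have A: "A \<in> carrier_mat d r" using inj by (simp add: inj_mat_def)
    show "A \<in> frames d r"
      using lin_indpt_full_rank[OF A inj_mat_distinct[OF inj]] inj A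
        inj_mat_lin_indpt[OF A inj_mat_distinct[OF inj]] unfolding frames_def by auto
  qed
qed

text \<open>The bridge from module-theoretic dimension to matrices: the columns of \<open>A\<close>
  form a basis of \<open>W\<close>. Later dimension arguments only handle injective
  matrices.\<close>

lemma subspace_of_dim_iff:
  "subspace_of_dim d i W \<longleftrightarrow> (\<exists>A. inj_mat d i A \<and> W = mat_range A)"
proof -
  interpret vec_space "TYPE(complex)" d .
  show ?thesis
  proof
    assume "subspace_of_dim d i W"
    then have W: "subspace class_ring W V" and fd: "vectorspace.fin_dim class_ring (vs W)"
      and dim: "vectorspace.dim class_ring (vs W) = i" unfolding subspace_of_dim_def by auto
    have vsW: "vectorspace class_ring (vs W)" using subspace_is_vs[OF W] .
    have sm: "submodule class_ring W V" using W by (simp add: subspace_def)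
    have WV: "W \<subseteq> carrier_vec d" using submodule.subset[OF sm] by simp
    obtain b where b: "finite b" "vectorspace.basis class_ring (vs W) b"
      using vectorspace.finite_basis_exists[OF vsW fd] by auto
    have bW: "b \<subseteq> W" using b(2) vectorspace.basis_def[OF vsW] by auto
    have cb: "card b = i" using vectorspace.dim_basis[OF vsW b] dim by simp
    have li: "lin_indpt b"
      using b(2) vectorspace.basis_def[OF vsW] span_li_not_depend(2)[OF bW sm] by auto
    have sp: "span b = W"
      using b(2) vectorspace.basis_def[OF vsW] span_li_not_depend(1)[OF bW sm] by auto
    obtain bs where bs: "set bs = b" "distinct bs" using finite_distinct_list[OF b(1)] by auto
    define A where "A = mat_of_cols d bs"
    have len: "length bs = i" using bs cb distinct_card by fastforce
    have A: "A \<in> carrier_mat d i" unfolding A_def using len by auto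
    have cols: "cols A = bs" unfolding A_def using bs bW WV by (intro cols_mat_of_cols) auto
    have "inj_mat d i A" using inj_mat_lin_indpt[OF A] li bs cols by auto
    moreover have "W = mat_range A" using cspan_cols[OF A] sp bs cols by auto
    ultimately show "\<exists>A. inj_mat d i A \<and> W = mat_range A" by blast
  next
    assume "\<exists>A. inj_mat d i A \<and> W = mat_range A"
    then obtain A where inj: "inj_mat d i A" and W: "W = mat_range A" by auto
    have A: "A \<in> carrier_mat d i" using inj by (simp add: inj_mat_def)
    have cV: "set (cols A) \<subseteq> carrier_vec d" using A cols_dim[of A] by auto
    have sp: "W = span (set (cols A))" using cspan_cols[OF A] W by simp
    have "rank A = i" using inj frames_iff unfolding frames_def by auto
    then show "subspace_of_dim d i W"
      unfolding subspace_of_dim_def sp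
      using span_is_subspace[OF cV] fin_dim_span_cols[OF A] unfolding rank_def by auto
  qed
qed

section \<open>Linear subspaces and their enlargement by a line\<close>

definition lin_subspace :: "nat \<Rightarrow> complex vec set \<Rightarrow> bool" where
  "lin_subspace d W \<longleftrightarrow> W \<subseteq> carrier_vec d \<and> 0\<^sub>v d \<in> W \<and>
     (\<forall>u\<in>W. \<forall>v\<in>W. u + v \<in> W) \<and> (\<forall>c. \<forall>u\<in>W. c \<cdot>\<^sub>v u \<in> W)"

lemma lin_subspaceD:
  assumes "lin_subspace d W"
  shows "W \<subseteq> carrier_vec d" "0\<^sub>v d \<in> W" "u \<in> W \<Longrightarrow> v \<in> W \<Longrightarrow> u + v \<in> W"
    "u \<in> W \<Longrightarrow> c \<cdot>\<^sub>v u \<in> W" "u \<in> W \<Longrightarrow> v \<in> W \<Longrightarrow> u - v \<in> W" "u \<in> W \<Longrightarrow> u \<in> carrier_vec d"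
proof -
  show "W \<subseteq> carrier_vec d" "0\<^sub>v d \<in> W" "u \<in> W \<Longrightarrow> v \<in> W \<Longrightarrow> u + v \<in> W"
    "u \<in> W \<Longrightarrow> c \<cdot>\<^sub>v u \<in> W" "u \<in> W \<Longrightarrow> u \<in> carrier_vec d"
    using assms unfolding lin_subspace_def by auto
  assume uv: "u \<in> W" "v \<in> W"
  then have "u - v = u + (-1) \<cdot>\<^sub>v v" using assms unfolding lin_subspace_def by (intro eq_vecI) auto
  then show "u - v \<in> W" using uv assms unfolding lin_subspace_def by auto
qed

lemma lin_subspace_range:
  assumes "A \<in> carrier_mat d r"
  shows "lin_subspace d (mat_range A)"
proof -
  have 1: "A *\<^sub>v 0\<^sub>v r = 0\<^sub>v d" using assms by auto
  have 2: "A *\<^sub>v u + A *\<^sub>v v = A *\<^sub>v (u + v)" if "u \<in> carrier_vec r" "v \<in> carrier_vec r" for u v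
    using mult_add_distrib_mat_vec[OF assms that] by simp
  have 3: "c \<cdot>\<^sub>v (A *\<^sub>v u) = A *\<^sub>v (c \<cdot>\<^sub>v u)" if "u \<in> carrier_vec r" for u c
    using mult_mat_vec[OF assms that] by simp
  show ?thesis
    unfolding lin_subspace_def mat_range_def using assms
    apply (safe)
    subgoal by auto
    subgoal using 1 by (intro exI[of _ "0\<^sub>v r"]) auto
    subgoal for _ _ u v using 2 by (intro exI[of _ "u + v"]) auto
    subgoal for c _ u using 3 by (intro exI[of _ "c \<cdot>\<^sub>v u"]) auto
    done
qed

lemma subspace_of_dim_lin_subspace: "subspace_of_dim d i W \<Longrightarrow> lin_subspace d W"
  using subspace_of_dim_iff lin_subspace_range by (auto simp: inj_mat_def)

text \<open>Steinitz exchange, applied to the columns of two injective matrices with these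
  ranges.\<close>

lemma subspace_of_dim_mono:
  assumes "subspace_of_dim d i W" "subspace_of_dim d j W'" "W \<subseteq> W'"
  shows "i \<le> j"
proof -
  interpret vec_space "TYPE(complex)" d .
  obtain A B where A: "inj_mat d i A" "W = mat_range A" and B: "inj_mat d j B" "W' = mat_range B"
    using assms subspace_of_dim_iff by metis
  have cA: "A \<in> carrier_mat d i" and cB: "B \<in> carrier_mat d j" using A B by (auto simp: inj_mat_def)
  have "card (set (cols A)) = i" "card (set (cols B)) = j"
    using inj_mat_distinct[OF A(1)] inj_mat_distinct[OF B(1)] cA cB by (auto simp: distinct_card)
  moreover have "set (cols A) \<subseteq> span (set (cols A))" using cA cols_dim[of A] by (intro in_own_span) auto
  then have "set (cols A) \<subseteq> span (set (cols B))"
    using assms(3) A(2) B(2) cspan_cols[OF cA] cspan_cols[OF cB] by auto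
  moreover have "set (cols B) \<subseteq> carrier V" using cB cols_dim[of B] by auto
  moreover have "lin_indpt (set (cols A))"
    using A(1) inj_mat_lin_indpt[OF cA inj_mat_distinct[OF A(1)]] by simp
  ultimately show ?thesis
    using replacement[of "set (cols A)" "set (cols B)"] by fastforce
qed

text \<open>The set has the shape of the ray condition in \<open>exotic_component\<close>, which can
  therefore be restated with it.\<close>

definition add_line :: "complex vec set \<Rightarrow> complex vec \<Rightarrow> complex vec set" where
  "add_line W w = {u + c \<cdot>\<^sub>v w | u c. u \<in> W}"

lemma add_lineI: "u \<in> W \<Longrightarrow> u + c \<cdot>\<^sub>v w \<in> add_line W w"
  unfolding add_line_def by auto

lemma add_line_mem:
  assumes "lin_subspace d W" "w \<in> carrier_vec d"
  shows "w \<in> add_line W w" "W \<subseteq> add_line W w"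
proof -
  have "w = 0\<^sub>v d + 1 \<cdot>\<^sub>v w" using assms by auto
  then show "w \<in> add_line W w" using add_lineI[of "0\<^sub>v d" W 1 w] assms lin_subspaceD(2) by auto
  show "W \<subseteq> add_line W w"
  proof
    fix u assume u: "u \<in> W"
    then have "u = u + 0 \<cdot>\<^sub>v w" using assms lin_subspaceD(6)[OF assms(1) u] by auto
    then show "u \<in> add_line W w" using add_lineI[OF u] by metis
  qed
qed

lemma add_line_subset:
  assumes "lin_subspace d W'" "W \<subseteq> W'" "w \<in> W'"
  shows "add_line W w \<subseteq> W'"
  using assms lin_subspaceD[OF assms(1)] unfolding add_line_def by auto

lemma mult_append_col:
  fixes A :: "complex mat"
  assumes "A \<in> carrier_mat d r" "w \<in> carrier_vec d" "c \<in> carrier_vec r"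
  shows "mat_of_cols d (cols A @ [w]) *\<^sub>v (c @\<^sub>v vec 1 (\<lambda>_. t)) = A *\<^sub>v c + t \<cdot>\<^sub>v w"
proof (rule eq_vecI)
  let ?B = "mat_of_cols d (cols A @ [w])"
  fix i assume "i < dim_vec (A *\<^sub>v c + t \<cdot>\<^sub>v w)"
  then have i: "i < d" using assms by auto
  have "(?B *\<^sub>v (c @\<^sub>v vec 1 (\<lambda>_. t))) $ i
      = (\<Sum>j<Suc r. ?B $$ (i,j) * (c @\<^sub>v vec 1 (\<lambda>_. t)) $ j)"
    using i assms by (auto simp: scalar_prod_def lessThan_atLeast0 intro!: sum.cong)
  also have "\<dots> = (\<Sum>j<r. A $$ (i,j) * c $ j) + w $ i * t"
    using i assms by (auto simp: mat_of_cols_def nth_append col_def mult.commute intro!: sum.cong)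
  also have "\<dots> = (A *\<^sub>v c + t \<cdot>\<^sub>v w) $ i"
    using i assms by (auto simp: scalar_prod_def lessThan_atLeast0 mult.commute[of t] intro!: sum.cong)
  finally show "(?B *\<^sub>v (c @\<^sub>v vec 1 (\<lambda>_. t))) $ i = (A *\<^sub>v c + t \<cdot>\<^sub>v w) $ i" .
qed (use assms in auto)

lemma vec_Suc_decomp:
  assumes "e \<in> carrier_vec (Suc r)"
  shows "e = vec r (\<lambda>i. e $ i) @\<^sub>v vec 1 (\<lambda>_. e $ r)"
  using assms by (intro eq_vecI) (auto simp: less_Suc_eq)

text \<open>In a relation \<open>A c + t w = 0\<close> a nonzero \<open>t\<close> would put
  \<open>w\<close> into the range of \<open>A\<close>; so \<open>t = 0\<close>, and injectivity of
  \<open>A\<close> finishes.\<close>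

lemma inj_mat_append_col:
  assumes A: "inj_mat d r A" and w: "w \<in> carrier_vec d" "w \<notin> mat_range A"
  shows "inj_mat d (Suc r) (mat_of_cols d (cols A @ [w]))"
    "mat_range (mat_of_cols d (cols A @ [w])) = add_line (mat_range A) w"
proof -
  let ?B = "mat_of_cols d (cols A @ [w])"
  have cA: "A \<in> carrier_mat d r" using A by (simp add: inj_mat_def)
  have cB: "?B \<in> carrier_mat d (Suc r)" using cA mat_of_cols_carrier(1)[of d "cols A @ [w]"] by simp
  have *: "?B *\<^sub>v e = A *\<^sub>v vec r (\<lambda>i. e $ i) + e $ r \<cdot>\<^sub>v w" if "e \<in> carrier_vec (Suc r)" for e
    by (subst vec_Suc_decomp[OF that], rule mult_append_col[OF cA w(1)]) auto
  show "inj_mat d (Suc r) ?B"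
    unfolding inj_mat_def
  proof (intro conjI ballI impI cB)
    fix e assume e: "e \<in> carrier_vec (Suc r)" and z: "?B *\<^sub>v e = 0\<^sub>v d"
    let ?c = "vec r (\<lambda>i. e $ i)"
    have z: "A *\<^sub>v ?c + e $ r \<cdot>\<^sub>v w = 0\<^sub>v d" using *[OF e] z by simp
    have 0: "e $ r = 0"
    proof (rule ccontr)
      assume nz: "e $ r \<noteq> 0"
      \<comment> \<open>The relation solved for \<open>w\<close>, with the scalar moved inside the
        product to exhibit a preimage.\<close>
      have "w = A *\<^sub>v ((- inverse (e $ r)) \<cdot>\<^sub>v ?c)"
      proof -
        have "A *\<^sub>v ((- inverse (e $ r)) \<cdot>\<^sub>v ?c) = (- inverse (e $ r)) \<cdot>\<^sub>v (A *\<^sub>v ?c)"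
          using cA by (intro mult_mat_vec) auto
        moreover have "(A *\<^sub>v ?c) $ i = - (e $ r) * w $ i" if "i < d" for i
          using arg_cong[OF z, of "\<lambda>v. v $ i"] that w cA by (simp add: eq_neg_iff_add_eq_0)
        ultimately show ?thesis using w cA nz by (intro eq_vecI) auto
      qed
      then have "w \<in> mat_range A" unfolding mat_range_def using cA
        by (intro CollectI exI[of _ "(- inverse (e $ r)) \<cdot>\<^sub>v ?c"]) auto
      then show False using w by simp
    qed
    have "A *\<^sub>v ?c = 0\<^sub>v d" using z 0 w cA by (auto simp: vec_eq_iff)
    then have "?c = 0\<^sub>v r" using A unfolding inj_mat_def by auto
    then show "e = 0\<^sub>v (Suc r)" using 0 e by (auto simp: vec_eq_iff less_Suc_eq)
  qed
  show "mat_range ?B = add_line (mat_range A) w"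
  proof (intro equalityI subsetI)
    fix x assume "x \<in> mat_range ?B"
    then obtain e where e: "e \<in> carrier_vec (Suc r)" "x = ?B *\<^sub>v e" using cB unfolding mat_range_def by auto
    show "x \<in> add_line (mat_range A) w"
      unfolding e(2) *[OF e(1)] by (rule add_lineI) (use cA in \<open>auto simp: mat_range_def\<close>)
  next
    fix x assume "x \<in> add_line (mat_range A) w"
    then obtain c t where c: "c \<in> carrier_vec r" "x = A *\<^sub>v c + t \<cdot>\<^sub>v w"
      using cA unfolding add_line_def mat_range_def by auto
    then have "x = ?B *\<^sub>v (c @\<^sub>v vec 1 (\<lambda>_. t))" using mult_append_col[OF cA w(1) c(1)] by simp
    moreover have "c @\<^sub>v vec 1 (\<lambda>_. t) \<in> carrier_vec (dim_col ?B)"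
      using c cB cA by (auto intro!: carrier_vecI)
    ultimately show "x \<in> mat_range ?B" unfolding mat_range_def by blast
  qed
qed

lemma subspace_of_dim_add_line:
  assumes "subspace_of_dim d i W" "w \<in> carrier_vec d" "w \<notin> W"
  shows "subspace_of_dim d (Suc i) (add_line W w)"
  using assms inj_mat_append_col unfolding subspace_of_dim_iff by metis

text \<open>A vector of \<open>W'\<close> outside \<open>W\<close> would produce a subspace of
  dimension \<open>Suc i\<close> inside \<open>W'\<close>.\<close>

lemma subspace_of_dim_eqI:
  assumes "subspace_of_dim d i W" "subspace_of_dim d i W'" "W \<subseteq> W'"
  shows "W = W'"
proof (rule ccontr)
  assume "W \<noteq> W'"
  then obtain w where w: "w \<in> W'" "w \<notin> W" using assms(3) by auto
  note l = subspace_of_dim_lin_subspace[OF assms(2)]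
  have "subspace_of_dim d (Suc i) (add_line W w)"
    using subspace_of_dim_add_line[OF assms(1) _ w(2)] w(1) lin_subspaceD(1)[OF l] by auto
  then have "Suc i \<le> i"
    using subspace_of_dim_mono assms(2) add_line_subset[OF l assms(3) w(1)] by metis
  then show False by simp
qed

lemma subspace_of_dim_step:
  assumes "subspace_of_dim d i W" "subspace_of_dim d (Suc i) W'" "W \<subseteq> W'" "w \<in> W'" "w \<notin> W"
  shows "W' = add_line W w"
proof -
  note l = subspace_of_dim_lin_subspace[OF assms(2)]
  have "subspace_of_dim d (Suc i) (add_line W w)"
    using subspace_of_dim_add_line[OF assms(1) _ assms(5)] assms(4) lin_subspaceD(1)[OF l] by auto
  then show ?thesis
    using subspace_of_dim_eqI[OF _ assms(2)] add_line_subset[OF l assms(3,4)] by auto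
qed

lemma subspace_of_dim_ex_step:
  assumes "subspace_of_dim d i W" "subspace_of_dim d (Suc i) W'" "W \<subseteq> W'"
  obtains w where "w \<in> W'" "w \<notin> W" "W' = add_line W w"
proof -
  have "W \<noteq> W'" using subspace_of_dim_mono[OF assms(2,1)] by auto
  then obtain w where "w \<in> W'" "w \<notin> W" using assms(3) by auto
  then show thesis using that subspace_of_dim_step[OF assms] by blast
qed

lemma subspace_of_dim_0: "subspace_of_dim d 0 {0\<^sub>v d}"
proof -
  have "inj_mat d 0 (0\<^sub>m d 0)" unfolding inj_mat_def
    by (auto simp: vec_eq_iff)
  moreover have "0\<^sub>m d 0 *\<^sub>v c = 0\<^sub>v d" if "c \<in> carrier_vec 0" for c :: "complex vec"
    using that by (intro eq_vecI) (auto simp: scalar_prod_def)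
  then have "mat_range (0\<^sub>m d 0) = {0\<^sub>v d}"
    unfolding mat_range_def by (auto intro!: exI[of _ "0\<^sub>v 0"])
  ultimately show ?thesis unfolding subspace_of_dim_iff by metis
qed

text \<open>With \<open>H\<close> the conjugate transpose of \<open>A\<close>, the Gram matrix
  \<open>H * A\<close> is invertible, because \<open>H A v = 0\<close> makes the norm of
  \<open>A v\<close> vanish. The left inverse is the inverse Gram matrix times
  \<open>H\<close>.\<close>

lemma inj_mat_left_inverse:
  assumes "inj_mat d r A"
  obtains L where "L \<in> carrier_mat r d" "L * A = 1\<^sub>m r"
proof -
  have A: "A \<in> carrier_mat d r" using assms by (simp add: inj_mat_def)
  define H where "H = mat r d (\<lambda>(i, j). cnj (A $$ (j, i)))"
  have H: "H \<in> carrier_mat r d" unfolding H_def by auto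
  have HA: "H * A \<in> carrier_mat r r" using H A by auto
  have "det (H * A) \<noteq> 0"
  proof
    assume "det (H * A) = 0"
    then obtain v where v: "v \<in> carrier_vec r" "v \<noteq> 0\<^sub>v r" "(H * A) *\<^sub>v v = 0\<^sub>v r"
      using det_0_iff_vec_prod_zero_field[OF HA] by auto
    define w where "w = A *\<^sub>v v"
    have w: "w \<in> carrier_vec d" unfolding w_def using A v by auto
    have Hw: "H *\<^sub>v w = 0\<^sub>v r" unfolding w_def using v A H by (metis assoc_mult_mat_vec)
    have wi: "w $ i = (\<Sum>j<r. A $$ (i,j) * v $ j)" if "i < d" for i
      unfolding w_def using that A v by (auto simp: scalar_prod_def lessThan_atLeast0 intro!: sum.cong)
    have Hwj: "(\<Sum>i<d. cnj (A $$ (i,j)) * w $ i) = 0" if "j < r" for j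
      using arg_cong[OF Hw, of "\<lambda>v. v $ j"] that w H
      by (auto simp: scalar_prod_def lessThan_atLeast0 H_def)
    \<comment> \<open>The squared norm of \<open>w = A v\<close>, rewritten as the pairing of
      \<open>v\<close> with \<open>H w\<close>, which is zero.\<close>
    have "(\<Sum>i<d. w $ i * cnj (w $ i)) = (\<Sum>i<d. \<Sum>j<r. w $ i * (cnj (A $$ (i,j)) * cnj (v $ j)))"
      by (intro sum.cong refl) (simp add: wi sum_distrib_left)
    also have "\<dots> = (\<Sum>j<r. cnj (v $ j) * (\<Sum>i<d. cnj (A $$ (i,j)) * w $ i))"
      by (subst sum.swap) (simp add: sum_distrib_left mult_ac)
    also have "\<dots> = 0" using Hwj by simp
    finally have "complex_of_real (\<Sum>i<d. (cmod (w $ i))\<^sup>2) = 0"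
      by (simp add: complex_mult_cnj cmod_power2)
    then have "(\<Sum>i<d. (cmod (w $ i))\<^sup>2) = 0" using of_real_eq_0_iff by blast
    then have "w $ i = 0" if "i < d" for i
      using that by (subst (asm) sum_nonneg_eq_0_iff) auto
    then have "w = 0\<^sub>v d" using w by auto
    then show False using assms v unfolding inj_mat_def w_def by auto
  qed
  then obtain B where B: "B \<in> carrier_mat r r" "B * (H * A) = 1\<^sub>m r"
    using det_non_zero_imp_unit[OF HA, of "()"] by (auto simp: Units_def ring_mat_def)
  have "(B * H) * A = 1\<^sub>m r" using B assoc_mult_mat[OF B(1) H A] by simp
  then show thesis using that[of "B * H"] B H by auto
qed

section \<open>Two-block nilpotent matrices\<close>

lemma pow_mult_vec:
  fixes x :: "complex mat"
  assumes x: "x \<in> carrier_mat d d" and w: "w \<in> carrier_vec d"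
  shows "(x ^\<^sub>m s) *\<^sub>v w \<in> carrier_vec d"
    and "(x ^\<^sub>m 0) *\<^sub>v w = w"
    and "(x ^\<^sub>m Suc s) *\<^sub>v w = (x ^\<^sub>m s) *\<^sub>v (x *\<^sub>v w)"
    and "(x ^\<^sub>m Suc s) *\<^sub>v w = x *\<^sub>v ((x ^\<^sub>m s) *\<^sub>v w)"
    and "(x ^\<^sub>m (s + t)) *\<^sub>v w = (x ^\<^sub>m s) *\<^sub>v ((x ^\<^sub>m t) *\<^sub>v w)"
proof -
  have pw: "x ^\<^sub>m s \<in> carrier_mat d d" for s using x by (rule pow_carrier_mat)
  show "(x ^\<^sub>m s) *\<^sub>v w \<in> carrier_vec d" using pw[of s] w by auto
  show "(x ^\<^sub>m 0) *\<^sub>v w = w" using x w by simp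
  have 1: "(x ^\<^sub>m Suc s) *\<^sub>v w = (x ^\<^sub>m s) *\<^sub>v (x *\<^sub>v w)" if "w \<in> carrier_vec d" for s w
    using assoc_mult_mat_vec[OF pw x that] by simp
  show "(x ^\<^sub>m Suc s) *\<^sub>v w = (x ^\<^sub>m s) *\<^sub>v (x *\<^sub>v w)" using 1[OF w] .
  have add: "(x ^\<^sub>m (s + t)) *\<^sub>v w = (x ^\<^sub>m s) *\<^sub>v ((x ^\<^sub>m t) *\<^sub>v w)" if "w \<in> carrier_vec d" for s t w
    using that
  proof (induction t arbitrary: w)
    case 0
    then show ?case using x by simp
  next
    case (Suc t)
    have "x *\<^sub>v w \<in> carrier_vec d" using x Suc.prems by auto
    then show ?case using 1[OF Suc.prems] Suc.IH by simp
  qed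
  show "(x ^\<^sub>m (s + t)) *\<^sub>v w = (x ^\<^sub>m s) *\<^sub>v ((x ^\<^sub>m t) *\<^sub>v w)" using add[OF w] .
  show "(x ^\<^sub>m Suc s) *\<^sub>v w = x *\<^sub>v ((x ^\<^sub>m s) *\<^sub>v w)" using add[OF w, of 1 s] x by simp
qed

text \<open>Two nilpotent Jordan blocks of sizes \<open>a\<close> and \<open>b\<close>; the excluded
  column \<open>a\<close> starts the second string. The model for every matrix of Jordan type with
  two parts, with \<open>zmat N\<close> as the case of equal parts.\<close>

definition nmat :: "nat \<Rightarrow> nat \<Rightarrow> complex mat" where
  "nmat a b = mat (a + b) (a + b) (\<lambda>(i, j). if j = Suc i \<and> j \<noteq> a then 1 else 0)"

lemma nmat_carrier[simp]: "nmat a b \<in> carrier_mat (a + b) (a + b)"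
  by (simp add: nmat_def)

lemma zmat_eq_nmat: "zmat N = nmat N N"
  by (simp add: zmat_def nmat_def mult_2)

lemma nmat_index:
  assumes "w \<in> carrier_vec (a + b)" "i < a + b"
  shows "(nmat a b *\<^sub>v w) $ i = (if Suc i \<noteq> a \<and> Suc i < a + b then w $ Suc i else 0)"
proof -
  have "(nmat a b *\<^sub>v w) $ i = (\<Sum>j<a + b. (if j = Suc i \<and> j \<noteq> a then 1 else 0) * w $ j)"
    using assms by (auto simp: nmat_def scalar_prod_def lessThan_atLeast0 intro!: sum.cong)
  also have "\<dots> = (\<Sum>j<a + b. if j = Suc i then (if Suc i \<noteq> a then w $ Suc i else 0) else 0)"
    by (intro sum.cong) auto
  also have "\<dots> = (if Suc i \<noteq> a \<and> Suc i < a + b then w $ Suc i else 0)"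
    by (subst sum.delta) auto
  finally show ?thesis .
qed

lemma nmat_pow_index:
  assumes "w \<in> carrier_vec (a + b)" "i < a + b"
  shows "((nmat a b ^\<^sub>m s) *\<^sub>v w) $ i =
    (if i + s < a \<or> a \<le> i \<and> i + s < a + b then w $ (i + s) else 0)"
  using assms
proof (induction s arbitrary: i)
  case 0
  then show ?case using pow_mult_vec(2)[OF nmat_carrier] by auto
next
  case (Suc s)
  note p = pow_mult_vec[OF nmat_carrier Suc.prems(1)]
  have "((nmat a b ^\<^sub>m Suc s) *\<^sub>v w) $ i =
      (if Suc i \<noteq> a \<and> Suc i < a + b then ((nmat a b ^\<^sub>m s) *\<^sub>v w) $ Suc i else 0)"
    unfolding p(4) using nmat_index[OF p(1) Suc.prems(2)] .
  also have "\<dots> = (if i + Suc s < a \<or> a \<le> i \<and> i + Suc s < a + b then w $ (i + Suc s) else 0)"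
    using Suc.IH[OF Suc.prems(1), of "Suc i"] by auto
  finally show ?case .
qed

lemma zmat_pow_index:
  assumes "w \<in> carrier_vec (2 * N)" "i < 2 * N"
  shows "((zmat N ^\<^sub>m s) *\<^sub>v w) $ i =
    (if i + s < N \<or> N \<le> i \<and> i + s < 2 * N then w $ (i + s) else 0)"
  using nmat_pow_index[of w N N i s] assms by (simp add: zmat_eq_nmat mult_2)

lemmas zpow = pow_mult_vec[OF zmat_carrier]

lemma pow_mult_linear:
  fixes x :: "complex mat"
  assumes x: "x \<in> carrier_mat d d" and u: "u \<in> carrier_vec d" and v: "v \<in> carrier_vec d"
  shows "(x ^\<^sub>m s) *\<^sub>v (u + v) = (x ^\<^sub>m s) *\<^sub>v u + (x ^\<^sub>m s) *\<^sub>v v"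
    and "(x ^\<^sub>m s) *\<^sub>v (c \<cdot>\<^sub>v u) = c \<cdot>\<^sub>v ((x ^\<^sub>m s) *\<^sub>v u)"
    and "(x ^\<^sub>m s) *\<^sub>v (u - v) = (x ^\<^sub>m s) *\<^sub>v u - (x ^\<^sub>m s) *\<^sub>v v"
    and "(x ^\<^sub>m s) *\<^sub>v 0\<^sub>v d = 0\<^sub>v d"
proof -
  have pw: "x ^\<^sub>m s \<in> carrier_mat d d" using x by (rule pow_carrier_mat)
  show "(x ^\<^sub>m s) *\<^sub>v (u + v) = (x ^\<^sub>m s) *\<^sub>v u + (x ^\<^sub>m s) *\<^sub>v v"
    using mult_add_distrib_mat_vec[OF pw u v] .
  show "(x ^\<^sub>m s) *\<^sub>v (c \<cdot>\<^sub>v u) = c \<cdot>\<^sub>v ((x ^\<^sub>m s) *\<^sub>v u)" using mult_mat_vec[OF pw u] .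
  show "(x ^\<^sub>m s) *\<^sub>v (u - v) = (x ^\<^sub>m s) *\<^sub>v u - (x ^\<^sub>m s) *\<^sub>v v"
    using mult_minus_distrib_mat_vec[OF pw u v] .
  show "(x ^\<^sub>m s) *\<^sub>v 0\<^sub>v d = 0\<^sub>v d"
    using pw by (intro eq_vecI) (auto simp: scalar_prod_def)
qed

lemma mult_mat_vec_linear:
  fixes x :: "complex mat"
  assumes x: "x \<in> carrier_mat d d" and u: "u \<in> carrier_vec d" and v: "v \<in> carrier_vec d"
  shows "x *\<^sub>v (u + c \<cdot>\<^sub>v v) = x *\<^sub>v u + c \<cdot>\<^sub>v (x *\<^sub>v v)"
  using mult_add_distrib_mat_vec[OF x u] mult_mat_vec[OF x v] v by simp

definition mat_invariant :: "complex mat \<Rightarrow> complex vec set \<Rightarrow> bool" where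
  "mat_invariant x W \<longleftrightarrow> (\<forall>w\<in>W. x *\<^sub>v w \<in> W)"

lemma mat_invariant_pow:
  assumes "x \<in> carrier_mat d d" "lin_subspace d W" "mat_invariant x W" "w \<in> W"
  shows "(x ^\<^sub>m s) *\<^sub>v w \<in> W"
proof (induction s)
  case 0
  then show ?case using assms(4) pow_mult_vec(2)[OF assms(1)] lin_subspaceD(6)[OF assms(2)] by metis
next
  case (Suc s)
  then show ?case
    using pow_mult_vec(4)[OF assms(1)] lin_subspaceD(6)[OF assms(2,4)] assms(3)
    unfolding mat_invariant_def by metis
qed

text \<open>The vectors \<open>x^(l-1) w\<close>, ..., \<open>x w\<close>, \<open>w\<close> are
  adjoined to \<open>U\<close> in this order. Each is new, because \<open>x\<close> carries the
  space built so far into the previous one, but carries the next vector to the one just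
  added.\<close>

lemma dim_cyclic_extension:
  assumes x: "x \<in> carrier_mat d d"
    and W: "subspace_of_dim d i W" "mat_invariant x W" and w: "w \<in> W"
    and U: "subspace_of_dim d j U" "mat_invariant x U" "U \<subseteq> W"
    and l: "(x ^\<^sub>m l) *\<^sub>v w \<in> U" "l > 0 \<Longrightarrow> (x ^\<^sub>m (l - 1)) *\<^sub>v w \<notin> U"
  shows "j + l \<le> i"
  using U l
proof (induction l arbitrary: U j)
  case 0
  then show ?case using subspace_of_dim_mono W(1) by auto
next
  case (Suc l)
  note lW = subspace_of_dim_lin_subspace[OF W(1)]
  note lU = subspace_of_dim_lin_subspace[OF Suc.prems(1)]
  have wc: "w \<in> carrier_vec d" using lin_subspaceD(6)[OF lW w] .
  note p = pow_mult_vec[OF x wc]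
  let ?v = "(x ^\<^sub>m l) *\<^sub>v w"
  have v: "?v \<notin> U" "?v \<in> carrier_vec d" using Suc.prems(5) p(1) by auto
  have xv: "x *\<^sub>v ?v \<in> U" using Suc.prems(4) p(4) by simp
  note m = add_line_mem[OF lU v(2)]
  \<comment> \<open>Stronger than invariance: the enlarged space is sent back into \<open>U\<close>
    itself, which is what keeps the next vector outside.\<close>
  have img: "x *\<^sub>v y \<in> U" if y: "y \<in> add_line U ?v" for y
  proof -
    obtain u c where uc: "u \<in> U" "y = u + c \<cdot>\<^sub>v ?v" using y unfolding add_line_def by auto
    have "x *\<^sub>v y = x *\<^sub>v u + c \<cdot>\<^sub>v (x *\<^sub>v ?v)"
      unfolding uc(2) using mult_mat_vec_linear[OF x _ v(2)] lin_subspaceD(6)[OF lU uc(1)] by simp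
    then show ?thesis
      using uc(1) xv Suc.prems(2) lin_subspaceD(3,4)[OF lU] unfolding mat_invariant_def by auto
  qed
  have "Suc j + l \<le> i"
  proof (rule Suc.IH)
    show "subspace_of_dim d (Suc j) (add_line U ?v)"
      using subspace_of_dim_add_line[OF Suc.prems(1) v(2,1)] .
    show "mat_invariant x (add_line U ?v)" using img m(2) unfolding mat_invariant_def by auto
    show "add_line U ?v \<subseteq> W"
      using add_line_subset[OF lW Suc.prems(3)] mat_invariant_pow[OF x lW W(2) w] by auto
    show "?v \<in> add_line U ?v" using m(1) .
    assume l: "l > 0"
    then have "x *\<^sub>v ((x ^\<^sub>m (l - 1)) *\<^sub>v w) = ?v" using p(4)[of "l - 1"] by simp
    then show "(x ^\<^sub>m (l - 1)) *\<^sub>v w \<notin> add_line U ?v" using img v(1) by metis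
  qed
  then show ?case by simp
qed

section \<open>Coordinate blocks and the action of the shift on them\<close>

definition block :: "nat \<Rightarrow> nat \<Rightarrow> nat \<Rightarrow> complex vec set" where
  "block N a b = {w \<in> carrier_vec (2 * N). \<forall>i<2 * N. w $ i \<noteq> 0 \<longrightarrow> i < a \<or> N \<le> i \<and> i < N + b}"

lemma blockI:
  "w \<in> carrier_vec (2 * N) \<Longrightarrow> (\<And>i. i < 2 * N \<Longrightarrow> w $ i \<noteq> 0 \<Longrightarrow> i < a \<or> N \<le> i \<and> i < N + b)
   \<Longrightarrow> w \<in> block N a b"
  unfolding block_def by auto

lemma lin_subspace_block: "lin_subspace (2 * N) (block N a b)"
proof -
  have "u + v \<in> block N a b" if "u \<in> block N a b" "v \<in> block N a b" for u v
  proof (rule blockI)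
    fix i assume i: "i < 2 * N" "(u + v) $ i \<noteq> 0"
    then have "u $ i \<noteq> 0 \<or> v $ i \<noteq> 0" using that unfolding block_def by auto
    then show "i < a \<or> N \<le> i \<and> i < N + b" using that i(1) unfolding block_def by blast
  qed (use that in \<open>auto simp: block_def\<close>)
  moreover have "block N a b \<subseteq> carrier_vec (2 * N)" "0\<^sub>v (2 * N) \<in> block N a b"
    "\<And>c u. u \<in> block N a b \<Longrightarrow> c \<cdot>\<^sub>v u \<in> block N a b"
    unfolding block_def by auto
  ultimately show ?thesis unfolding lin_subspace_def by blast
qed

lemma block_carrier: "w \<in> block N a b \<Longrightarrow> w \<in> carrier_vec (2 * N)"
  unfolding block_def by auto

lemma block_mono: "a \<le> a' \<Longrightarrow> b \<le> b' \<Longrightarrow> block N a b \<subseteq> block N a' b'"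
  unfolding block_def by fastforce

text \<open>The bounds by \<open>N\<close> keep the condition \<open>i < a\<close> from reaching the
  indices of the \<open>f\<close> vectors.\<close>

lemma block_Int:
  assumes "a \<le> N" "a' \<le> N"
  shows "block N a b \<inter> block N a' b' \<subseteq> block N (min a a') (min b b')"
proof
  fix w assume w: "w \<in> block N a b \<inter> block N a' b'"
  show "w \<in> block N (min a a') (min b b')"
  proof (rule blockI)
    fix i assume "i < 2 * N" "w $ i \<noteq> 0"
    then have "i < a \<or> N \<le> i \<and> i < N + b" "i < a' \<or> N \<le> i \<and> i < N + b'"
      using w unfolding block_def by blast+
    then show "i < min a a' \<or> N \<le> i \<and> i < N + min b b'" using assms by linarith
  qed (use w in \<open>auto simp: block_def\<close>)
qed

lemma block_NN: "block N N N = carrier_vec (2 * N)"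
  unfolding block_def by auto

lemma block_00: "block N 0 0 = {0\<^sub>v (2 * N)}"
  unfolding block_def by (auto intro!: eq_vecI)

lemma evec_carrier[simp]: "evec N i \<in> carrier_vec (2 * N)"
  and fvec_carrier[simp]: "fvec N i \<in> carrier_vec (2 * N)"
  unfolding evec_def fvec_def by auto

lemma evec_index: "i \<in> {1..N} \<Longrightarrow> j < 2 * N \<Longrightarrow> evec N i $ j = (if Suc j = i then 1 else 0)"
  and fvec_index: "i \<in> {1..N} \<Longrightarrow> j < 2 * N \<Longrightarrow> fvec N i $ j = (if Suc j = N + i then 1 else 0)"
  unfolding evec_def fvec_def unit_vec_def by auto

lemma evec_block: "i \<le> a \<Longrightarrow> a \<le> N \<Longrightarrow> evec N i \<in> block N a b"
  and fvec_block: "i \<le> b \<Longrightarrow> b \<le> N \<Longrightarrow> fvec N i \<in> block N a b"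
  unfolding evec_def fvec_def block_def by (auto split: if_splits)

lemma block_add_evec:
  assumes "a < N"
  shows "block N (Suc a) b = add_line (block N a b) (evec N (Suc a))"
proof (intro equalityI subsetI)
  fix w assume w: "w \<in> block N (Suc a) b"
  let ?u = "vec (2 * N) (\<lambda>i. if i = a then 0 else w $ i)"
  have "w = ?u + w $ a \<cdot>\<^sub>v evec N (Suc a)"
    using assms block_carrier[OF w] by (intro eq_vecI) (auto simp: evec_index evec_def)
  moreover have "?u \<in> block N a b"
  proof (rule blockI)
    fix i assume i: "i < 2 * N" "?u $ i \<noteq> 0"
    then have "i \<noteq> a" "w $ i \<noteq> 0" by (auto split: if_splits)
    then show "i < a \<or> N \<le> i \<and> i < N + b" using w i(1) unfolding block_def by force
  qed auto
  ultimately show "w \<in> add_line (block N a b) (evec N (Suc a))" using add_lineI by metis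
next
  show "\<And>w. w \<in> add_line (block N a b) (evec N (Suc a)) \<Longrightarrow> w \<in> block N (Suc a) b"
    using add_line_subset[OF lin_subspace_block[of N "Suc a" b] block_mono[of a "Suc a" b b]
        evec_block[of "Suc a" "Suc a"]] assms by auto
qed

lemma block_add_fvec:
  assumes "b < N"
  shows "block N a (Suc b) = add_line (block N a b) (fvec N (Suc b))"
proof (intro equalityI subsetI)
  fix w assume w: "w \<in> block N a (Suc b)"
  let ?u = "vec (2 * N) (\<lambda>i. if i = N + b then 0 else w $ i)"
  have "w = ?u + w $ (N + b) \<cdot>\<^sub>v fvec N (Suc b)"
    using assms block_carrier[OF w] by (intro eq_vecI) (auto simp: fvec_index fvec_def)
  moreover have "?u \<in> block N a b"
  proof (rule blockI)
    fix i assume i: "i < 2 * N" "?u $ i \<noteq> 0"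
    then have "i \<noteq> N + b" "w $ i \<noteq> 0" by (auto split: if_splits)
    then show "i < a \<or> N \<le> i \<and> i < N + b" using w i(1) unfolding block_def by force
  qed auto
  ultimately show "w \<in> add_line (block N a b) (fvec N (Suc b))" using add_lineI by metis
next
  show "\<And>w. w \<in> add_line (block N a b) (fvec N (Suc b)) \<Longrightarrow> w \<in> block N a (Suc b)"
    using add_line_subset[OF lin_subspace_block[of N a "Suc b"] block_mono[of a a b "Suc b"]
        fvec_block[of "Suc b" "Suc b"]] assms by auto
qed

lemma subspace_of_dim_block:
  assumes "a \<le> N" "b \<le> N"
  shows "subspace_of_dim (2 * N) (a + b) (block N a b)"
  using assms
proof (induction a)
  case 0
  then show ?case
  proof (induction b)
    case 0
    then show ?case using subspace_of_dim_0 by (simp add: block_00)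
  next
    case (Suc b)
    have "fvec N (Suc b) \<notin> block N 0 b"
      using Suc.prems unfolding block_def fvec_def by auto
    then show ?case
      using subspace_of_dim_add_line[of "2 * N" b "block N 0 b" "fvec N (Suc b)"] Suc
      by (simp add: block_add_fvec)
  qed
next
  case (Suc a)
  have "evec N (Suc a) \<notin> block N a b"
    using Suc.prems unfolding block_def evec_def by auto
  then show ?case
    using subspace_of_dim_add_line[of "2 * N" "a + b" "block N a b" "evec N (Suc a)"] Suc
    by (simp add: block_add_evec)
qed

text \<open>The universal property of the span; it replaces all work with explicit linear
  combinations below.\<close>

lemma cspan_hull:
  assumes "S \<subseteq> carrier_vec d"
  shows "lin_subspace d (cspan d S)" "S \<subseteq> cspan d S"
    and "lin_subspace d W \<Longrightarrow> S \<subseteq> W \<Longrightarrow> cspan d S \<subseteq> W"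
proof -
  interpret vec_space "TYPE(complex)" d .
  have S: "S \<subseteq> carrier V" using assms by simp
  note sub = span_is_submodule[OF assms]
  show "lin_subspace d (span S)"
    using submodule.subset[OF sub] submodule.m_closed[OF sub] submodule.zero_closed[OF sub]
      submodule.smult_closed[OF sub] unfolding lin_subspace_def by auto
  show "S \<subseteq> span S" using in_own_span[OF assms] .
  assume W: "lin_subspace d W" "S \<subseteq> W"
  have "submodule class_ring W V"
    using vec_module[of d] lin_subspaceD[OF W(1)] by (intro submodule.intro) auto
  then show "span S \<subseteq> W" using span_is_subset[OF W(2)] by simp
qed

lemma block_subset:
  assumes W: "lin_subspace (2 * N) W" and ab: "a \<le> N" "b \<le> N"
    and e: "\<And>i. i \<in> {1..a} \<Longrightarrow> evec N i \<in> W" and f: "\<And>i. i \<in> {1..b} \<Longrightarrow> fvec N i \<in> W"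
  shows "block N a b \<subseteq> W"
  using ab(1) e
proof (induction a)
  case 0
  show ?case using ab(2) f
  proof (induction b)
    case 0
    then show ?case using lin_subspaceD(2)[OF W] by (simp add: block_00)
  next
    case (Suc b)
    then show ?case using add_line_subset[OF W] by (simp add: block_add_fvec)
  qed
next
  case (Suc a)
  then show ?case using add_line_subset[OF W] by (simp add: block_add_evec)
qed

text \<open>Trades the span for vanishing of coordinates, after which membership is index
  arithmetic: \<open>evec N i\<close> sits at index \<open>i - 1\<close> and \<open>fvec N i\<close>
  at \<open>N + i - 1\<close>.\<close>

lemma Espace_eq_block:
  assumes "a \<le> N" "b \<le> N"
  shows "Espace N a b = block N a b"
proof
  have S: "evec N ` {1..a} \<union> fvec N ` {1..b} \<subseteq> carrier_vec (2 * N)" by auto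
  note h = cspan_hull[OF S]
  show "Espace N a b \<subseteq> block N a b"
    unfolding Espace_def using assms by (intro h(3) lin_subspace_block) (auto intro: evec_block fvec_block)
  show "block N a b \<subseteq> Espace N a b"
    unfolding Espace_def using h(1,2) assms by (intro block_subset) auto
qed

text \<open>Truncated subtraction is the right convention: a string with at most \<open>s\<close>
  vectors is killed entirely.\<close>

lemma zpow_block:
  assumes "w \<in> block N a b" "a \<le> N" "b \<le> N"
  shows "(zmat N ^\<^sub>m s) *\<^sub>v w \<in> block N (a - s) (b - s)"
proof (rule blockI)
  show "(zmat N ^\<^sub>m s) *\<^sub>v w \<in> carrier_vec (2 * N)" using zpow(1) block_carrier[OF assms(1)] .
  fix i assume i: "i < 2 * N" "((zmat N ^\<^sub>m s) *\<^sub>v w) $ i \<noteq> 0"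
  then have *: "i + s < N \<or> N \<le> i \<and> i + s < 2 * N" "w $ (i + s) \<noteq> 0"
    using zmat_pow_index[OF block_carrier[OF assms(1)] i(1), of s] by (auto split: if_splits)
  then have "i + s < 2 * N" by auto
  then have "i + s < a \<or> N \<le> i + s \<and> i + s < N + b"
    using assms(1) *(2) unfolding block_def by blast
  then show "i < a - s \<or> N \<le> i \<and> i < N + (b - s)" using assms(2) *(1) by auto
qed

lemma zmat_block:
  assumes "w \<in> block N a b" "a \<le> N" "b \<le> N"
  shows "zmat N *\<^sub>v w \<in> block N (a - 1) (b - 1)"
  using zpow_block[OF assms, of 1] zmat_carrier by simp

lemma mat_invariant_block: "a \<le> N \<Longrightarrow> b \<le> N \<Longrightarrow> mat_invariant (zmat N) (block N a b)"
  unfolding mat_invariant_def using zmat_block block_mono[of "a - 1" a "b - 1" b] by fastforce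

text \<open>A nonzero coordinate at distance at least \<open>s\<close> from the start of its string
  survives, \<open>s\<close> places lower, and is thus seen by the hypothesis.\<close>

lemma zpow_in_block:
  assumes "w \<in> carrier_vec (2 * N)" "(zmat N ^\<^sub>m s) *\<^sub>v w \<in> block N a b" "a + s \<le> N" "b + s \<le> N"
  shows "w \<in> block N (a + s) (b + s)"
proof (rule blockI[OF assms(1)])
  fix i assume i: "i < 2 * N" "w $ i \<noteq> 0"
  show "i < a + s \<or> N \<le> i \<and> i < N + (b + s)"
  \<comment> \<open>The first \<open>s\<close> coordinates of each string are lost under the power,
    but the enlarged block allows them anyway.\<close>
  proof (cases "i < s \<or> N \<le> i \<and> i < N + s")
    case False
    then have j: "i - s < 2 * N" "i - s + s = i" "N \<le> i - s \<longleftrightarrow> N \<le> i" using i by auto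
    then have "((zmat N ^\<^sub>m s) *\<^sub>v w) $ (i - s) \<noteq> 0"
      using zmat_pow_index[OF assms(1) j(1), of s] i by auto
    then show ?thesis using assms(2) j unfolding block_def by force
  qed auto
qed

lemma block_zpow_surj:
  assumes v: "v \<in> block N (a - s) (b - s)" and ab: "a \<le> N" "b \<le> N"
  obtains w where "w \<in> block N a b" "(zmat N ^\<^sub>m s) *\<^sub>v w = v"
proof -
  \<comment> \<open>The preimage: \<open>v\<close> shifted up by \<open>s\<close> places within each
    string.\<close>
  let ?w = "vec (2 * N) (\<lambda>i. if s \<le> i \<and> i < N \<or> N + s \<le> i then v $ (i - s) else 0)"
  note vc = block_carrier[OF v]
  have wi: "?w $ (i + s) = v $ i" if "i < N \<and> i + s < N \<or> N \<le> i \<and> i + s < 2 * N" for i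
    using that by auto
  have "?w \<in> block N a b"
  proof (rule blockI)
    fix i assume i: "i < 2 * N" "?w $ i \<noteq> 0"
    then have c: "s \<le> i \<and> i < N \<or> N + s \<le> i" "v $ (i - s) \<noteq> 0" "i - s < 2 * N"
      by (auto split: if_splits)
    then have "i - s < a - s \<or> N \<le> i - s \<and> i - s < N + (b - s)" using v unfolding block_def by blast
    then show "i < a \<or> N \<le> i \<and> i < N + b" using c(1) i(1) by auto
  qed simp
  moreover have "(zmat N ^\<^sub>m s) *\<^sub>v ?w = v"
  proof (rule eq_vecI)
    fix i assume "i < dim_vec v"
    then have i: "i < 2 * N" using vc by simp
    \<comment> \<open>Coordinates that the shift would push beyond the end of a string vanish,
      because the strings of the block have length at most \<open>N\<close>.\<close>
    have "v $ i = 0" if "\<not> (i + s < N \<or> N \<le> i \<and> i + s < 2 * N)"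
    proof (rule ccontr)
      assume "v $ i \<noteq> 0"
      then have "i < a - s \<or> N \<le> i \<and> i < N + (b - s)" using v i unfolding block_def by blast
      then show False using that ab by auto
    qed
    then show "((zmat N ^\<^sub>m s) *\<^sub>v ?w) $ i = v $ i"
      using zmat_pow_index[of ?w N i s] i wi[of i] by (cases "i < N") auto
  qed (use vc carrier_vecD[OF zpow(1)[of ?w N s]] in auto)
  ultimately show thesis using that by blast
qed

section \<open>Preimages of subspaces under powers of the shift\<close>

definition zpreim :: "nat \<Rightarrow> nat \<Rightarrow> complex vec set \<Rightarrow> complex vec set" where
  "zpreim N s W = {w \<in> carrier_vec (2 * N). (zmat N ^\<^sub>m s) *\<^sub>v w \<in> W}"

lemma zpreim_block:
  assumes "a + s \<le> N" "b + s \<le> N"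
  shows "zpreim N s (block N a b) = block N (a + s) (b + s)"
  unfolding zpreim_def using zpow_in_block[OF _ _ assms] zpow_block[of _ N "a + s" "b + s" s] assms
  by (auto simp: block_carrier)

text \<open>The last column of an injective matrix with range \<open>W\<close> is split off; this
  allows induction on the dimension.\<close>

lemma subspace_of_dim_Suc_cases:
  assumes "subspace_of_dim d (Suc i) W"
  obtains W' w where "subspace_of_dim d i W'" "w \<in> carrier_vec d" "w \<notin> W'" "W = add_line W' w"
proof -
  obtain A where A: "inj_mat d (Suc i) A" "W = mat_range A" using assms subspace_of_dim_iff by metis
  have cA: "A \<in> carrier_mat d (Suc i)" using A by (simp add: inj_mat_def)
  define w where "w = last (cols A)"
  define B where "B = mat_of_cols d (butlast (cols A))"
  have ne: "cols A \<noteq> []" using cA by (metis cols_length carrier_matD(2) length_0_conv nat.distinct(1))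
  have cs: "set (cols A) \<subseteq> carrier_vec d" using cA cols_dim[of A] by auto
  have w: "w \<in> carrier_vec d" unfolding w_def using cs ne by auto
  have cB: "B \<in> carrier_mat d i" unfolding B_def using cA by auto
  have "cols B = butlast (cols A)"
    unfolding B_def using cs in_set_butlastD by (intro cols_mat_of_cols) fastforce
  then have AB: "A = mat_of_cols d (cols B @ [w])"
    unfolding w_def using ne mat_of_cols_cols[of A] cA by simp
  have inj: "c = 0\<^sub>v i \<and> t = 0" if "c \<in> carrier_vec i" "B *\<^sub>v c + t \<cdot>\<^sub>v w = 0\<^sub>v d" for c t
  proof -
    have "A *\<^sub>v (c @\<^sub>v vec 1 (\<lambda>_. t)) = 0\<^sub>v d"
      unfolding AB using mult_append_col[OF cB w that(1)] that(2) by simp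
    moreover have "c @\<^sub>v vec 1 (\<lambda>_. t) \<in> carrier_vec (Suc i)" using that(1) by (auto intro!: carrier_vecI)
    ultimately have z: "c @\<^sub>v vec 1 (\<lambda>_. t) = 0\<^sub>v (Suc i)" using A(1) unfolding inj_mat_def by blast
    have "c $ j = 0" if "j < i" for j
      using arg_cong[OF z, of "\<lambda>v. v $ j"] that \<open>c \<in> carrier_vec i\<close> by auto
    moreover have "t = 0" using arg_cong[OF z, of "\<lambda>v. v $ i"] that(1) by auto
    ultimately show ?thesis using that(1) by auto
  qed
  have B: "inj_mat d i B"
    unfolding inj_mat_def
  proof (intro conjI ballI impI cB)
    fix c assume c: "c \<in> carrier_vec i" "B *\<^sub>v c = 0\<^sub>v d"
    have "0\<^sub>v d + 0 \<cdot>\<^sub>v w = 0\<^sub>v d" using w by (intro eq_vecI) auto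
    then have "B *\<^sub>v c + 0 \<cdot>\<^sub>v w = 0\<^sub>v d" using c(2) by simp
    then show "c = 0\<^sub>v i" using inj c by blast
  qed
  have "w \<notin> mat_range B"
  proof
    assume "w \<in> mat_range B"
    then obtain c where c: "c \<in> carrier_vec i" "w = B *\<^sub>v c" using cB unfolding mat_range_def by auto
    have "w + (-1) \<cdot>\<^sub>v w = 0\<^sub>v d" using w by (intro eq_vecI) auto
    then have "B *\<^sub>v c + (-1) \<cdot>\<^sub>v w = 0\<^sub>v d" using c(2) by simp
    then show False using inj[OF c(1)] by fastforce
  qed
  then show thesis
    using that[of "mat_range B" w] B w inj_mat_append_col(2)[OF B w] A(2) AB subspace_of_dim_iff by metis
qed

text \<open>The kernel of \<open>z\<close> is the plane spanned by \<open>e_1\<close> and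
  \<open>f_1\<close>, and its image is the block with both indices \<open>N - 1\<close>. Inside the
  image every basis vector lifts, so a preimage gains exactly two dimensions.\<close>

lemma subspace_of_dim_zpreim_1:
  assumes "subspace_of_dim (2 * N) i W" "W \<subseteq> block N (N - 1) (N - 1)" "N > 0"
  shows "subspace_of_dim (2 * N) (i + 2) (zpreim N 1 W)"
  using assms
proof (induction i arbitrary: W)
  case 0
  have "W = {0\<^sub>v (2 * N)}"
    using subspace_of_dim_eqI[OF subspace_of_dim_0 0(1)]
      lin_subspaceD(2)[OF subspace_of_dim_lin_subspace[OF 0(1)]] by auto
  then have "zpreim N 1 W = block N 1 1" using zpreim_block[of 0 1 N 0] 0 by (simp add: block_00)
  then show ?case using subspace_of_dim_block[of 1 N 1] 0 by (simp add: numeral_2_eq_2)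
next
  case (Suc i)
  obtain W' w where W': "subspace_of_dim (2 * N) i W'" "w \<in> carrier_vec (2 * N)" "w \<notin> W'"
    "W = add_line W' w" using subspace_of_dim_Suc_cases[OF Suc.prems(1)] by blast
  note l = subspace_of_dim_lin_subspace[OF W'(1)]
  note m = add_line_mem[OF l W'(2)]
  have dim: "subspace_of_dim (2 * N) (i + 2) (zpreim N 1 W')"
    using Suc.IH[OF W'(1)] m(2) W'(4) Suc.prems by blast
  have "w \<in> block N (N - 1) (N - 1)" using m(1) W'(4) Suc.prems by auto
  \<comment> \<open>A lift of \<open>w\<close>; adjoining it to the preimage of \<open>W'\<close>
    gives the preimage of \<open>W\<close>.\<close>
  then obtain u where u: "u \<in> block N N N" "(zmat N ^\<^sub>m 1) *\<^sub>v u = w"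
    by (rule block_zpow_surj) auto
  have uc: "u \<in> carrier_vec (2 * N)" using block_carrier[OF u(1)] .
  have un: "u \<notin> zpreim N 1 W'" unfolding zpreim_def using u W'(3) by auto
  have "zpreim N 1 W = add_line (zpreim N 1 W') u"
  proof (intro equalityI subsetI)
    fix v assume "v \<in> zpreim N 1 W"
    then obtain y c where v: "v \<in> carrier_vec (2 * N)" "y \<in> W'" "(zmat N ^\<^sub>m 1) *\<^sub>v v = y + c \<cdot>\<^sub>v w"
      unfolding zpreim_def W'(4) add_line_def by auto
    have yc: "y \<in> carrier_vec (2 * N)" using lin_subspaceD(6)[OF l v(2)] .
    have "(zmat N ^\<^sub>m 1) *\<^sub>v (v - c \<cdot>\<^sub>v u) = (y + c \<cdot>\<^sub>v w) - c \<cdot>\<^sub>v w"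
      using pow_mult_linear(3)[OF zmat_carrier v(1), of "c \<cdot>\<^sub>v u" 1]
        pow_mult_linear(2)[OF zmat_carrier uc uc, of 1 c] uc u(2) v(3) by simp
    also have "\<dots> = y" using yc W'(2) by (intro eq_vecI) auto
    finally have "v - c \<cdot>\<^sub>v u \<in> zpreim N 1 W'" unfolding zpreim_def using v uc by auto
    moreover have "v = (v - c \<cdot>\<^sub>v u) + c \<cdot>\<^sub>v u" using v(1) uc by (intro eq_vecI) auto
    ultimately show "v \<in> add_line (zpreim N 1 W') u" using add_lineI by metis
  next
    fix v assume "v \<in> add_line (zpreim N 1 W') u"
    then obtain y c where y: "y \<in> carrier_vec (2 * N)" "(zmat N ^\<^sub>m 1) *\<^sub>v y \<in> W'" "v = y + c \<cdot>\<^sub>v u"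
      unfolding zpreim_def add_line_def by auto
    have "(zmat N ^\<^sub>m 1) *\<^sub>v v = (zmat N ^\<^sub>m 1) *\<^sub>v y + c \<cdot>\<^sub>v w"
      unfolding y(3) using pow_mult_linear(1)[OF zmat_carrier y(1), of "c \<cdot>\<^sub>v u" 1]
        pow_mult_linear(2)[OF zmat_carrier uc uc, of 1 c] uc u(2) by simp
    then show "v \<in> zpreim N 1 W"
      unfolding zpreim_def W'(4) using y uc add_lineI[OF y(2)] by auto
  qed
  then show ?case using subspace_of_dim_add_line[OF dim uc un] by simp
qed

lemma zpreim_Suc: "zpreim N (Suc s) W = zpreim N 1 (zpreim N s W)"
  unfolding zpreim_def using zpow(1)[of _ N 1] zpow(3)[of _ N s] zmat_carrier by auto

text \<open>The bound \<open>a + s \<le> N\<close> keeps every intermediate preimage inside the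
  image of \<open>z\<close>, so that each of the \<open>s\<close> steps gains two
  dimensions.\<close>

lemma subspace_of_dim_zpreim:
  assumes "subspace_of_dim (2 * N) i W" "W \<subseteq> block N a a" "a + s \<le> N"
  shows "subspace_of_dim (2 * N) (i + 2 * s) (zpreim N s W)"
  using assms(3)
proof (induction s)
  case 0
  have "zpreim N 0 W = W" unfolding zpreim_def
    using zpow(2) lin_subspaceD(6)[OF subspace_of_dim_lin_subspace[OF assms(1)]] by auto
  then show ?case using assms by simp
next
  case (Suc s)
  have "zpreim N s W \<subseteq> zpreim N s (block N a a)" unfolding zpreim_def using assms(2) by auto
  also have "\<dots> = block N (a + s) (a + s)" using zpreim_block Suc.prems by auto
  also have "\<dots> \<subseteq> block N (N - 1) (N - 1)" using Suc.prems by (intro block_mono) auto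
  finally show ?case
    unfolding zpreim_Suc[of N s] using subspace_of_dim_zpreim_1[of N "i + 2 * s" "zpreim N s W"] Suc
    by (simp del: One_nat_def)
qed

section \<open>Nilpotent flags\<close>

text \<open>The members are given by a function instead of a list, so that cutting a flag short only
  changes \<open>r\<close>.\<close>

definition nflag :: "nat \<Rightarrow> complex mat \<Rightarrow> nat \<Rightarrow> (nat \<Rightarrow> complex vec set) \<Rightarrow> bool" where
  "nflag d x r G \<longleftrightarrow> G 0 = {0\<^sub>v d} \<and>
     (\<forall>i\<in>{1..r}. subspace_of_dim d i (G i) \<and> G (i - 1) \<subseteq> G i \<and> (\<forall>w\<in>G i. x *\<^sub>v w \<in> G (i - 1)))"

lemma nilp_flags_iff: "F \<in> nilp_flags d r x \<longleftrightarrow> length F = Suc r \<and> nflag d x r ((!) F)"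
  unfolding nilp_flags_def flags_def nflag_def by auto

lemma nflag_le: "nflag d x r G \<Longrightarrow> s \<le> r \<Longrightarrow> nflag d x s G"
  unfolding nflag_def by auto

lemma nflag_dim: "nflag d x r G \<Longrightarrow> i \<le> r \<Longrightarrow> subspace_of_dim d i (G i)"
  unfolding nflag_def using subspace_of_dim_0 by (cases "i = 0") auto

lemma nflag_lin_subspace: "nflag d x r G \<Longrightarrow> i \<le> r \<Longrightarrow> lin_subspace d (G i)"
  using nflag_dim subspace_of_dim_lin_subspace by blast

lemma nflag_mono:
  assumes "nflag d x r G" "i \<le> j" "j \<le> r"
  shows "G i \<subseteq> G j"
  using assms(2,3)
proof (induction j rule: dec_induct)
  case (step j)
  moreover have "G j \<subseteq> G (Suc j)" using assms(1) step.prems unfolding nflag_def by force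
  ultimately show ?case by auto
qed simp

text \<open>Truncated subtraction fits here: once the index is 0 the member is the zero space, and
  further powers stay there.\<close>

lemma nflag_pow:
  assumes "nflag d x r G" "x \<in> carrier_mat d d" "i \<le> r" "w \<in> G i"
  shows "(x ^\<^sub>m s) *\<^sub>v w \<in> G (i - s)"
proof (induction s)
  case 0
  then show ?case
    using assms(4) pow_mult_vec(2)[OF assms(2)] lin_subspaceD(6)[OF nflag_lin_subspace[OF assms(1,3)]]
    by simp
next
  case (Suc s)
  have wc: "w \<in> carrier_vec d" using assms(4) lin_subspaceD(6)[OF nflag_lin_subspace[OF assms(1,3)]] by simp
  note p = pow_mult_vec[OF assms(2) wc]
  show ?case
  proof (cases "i - s = 0")
    case True
    then have "(x ^\<^sub>m s) *\<^sub>v w = 0\<^sub>v d" using Suc assms(1) unfolding nflag_def by auto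
    then have "(x ^\<^sub>m Suc s) *\<^sub>v w = 0\<^sub>v d"
      unfolding p(4) using assms(2) by (intro eq_vecI) (auto simp: scalar_prod_def)
    moreover have "i - Suc s = 0" using True by simp
    ultimately show ?thesis using assms(1) unfolding nflag_def by simp
  next
    case False
    then have "i - s \<in> {1..r}" using assms(3) by auto
    then show ?thesis using assms(1) Suc unfolding nflag_def p(4) by force
  qed
qed

lemma nflag_mult:
  assumes "nflag d x r G" "x \<in> carrier_mat d d" "i \<le> r" "w \<in> G i"
  shows "x *\<^sub>v w \<in> G (i - 1)"
  using nflag_pow[OF assms, of 1] assms(2) by simp

lemma nflag_invariant:
  assumes "nflag d x r G" "x \<in> carrier_mat d d" "i \<le> r"
  shows "mat_invariant x (G i)"
  using nflag_mult[OF assms] nflag_mono[OF assms(1) _ assms(3), of "i - 1"]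
  unfolding mat_invariant_def by auto

text \<open>The \<open>i\<close>-th power of \<open>z\<close> kills \<open>G i\<close>, and its
  kernel is the block with both indices \<open>i\<close>.\<close>

lemma nflag_block:
  assumes "nflag (2 * N) (zmat N) r G" "i \<le> r" "i \<le> N"
  shows "G i \<subseteq> block N i i"
proof
  fix w assume w: "w \<in> G i"
  have "(zmat N ^\<^sub>m i) *\<^sub>v w \<in> block N 0 0"
    using nflag_pow[OF assms(1) zmat_carrier assms(2) w, of i] assms(1)
    unfolding nflag_def block_00 by simp
  then show "w \<in> block N i i"
    using zpow_in_block[of w N i 0 0] lin_subspaceD(6)[OF nflag_lin_subspace[OF assms(1,2)] w] assms(3)
    by simp
qed

text \<open>The exponent \<open>l0\<close> only ensures that the powers reach \<open>W\<close> at
  all, which nilpotency provides in the applications. The least such exponent is at most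
  \<open>g\<close> by \<open>dim_cyclic_extension\<close>.\<close>

lemma codim_pow_mem:
  assumes x: "x \<in> carrier_mat d d"
    and E: "subspace_of_dim d (i + g) E" "mat_invariant x E"
    and W: "subspace_of_dim d i W" "mat_invariant x W" "W \<subseteq> E"
    and w: "w \<in> E" "(x ^\<^sub>m l0) *\<^sub>v w \<in> W"
  shows "(x ^\<^sub>m g) *\<^sub>v w \<in> W"
proof -
  define l where "l = (LEAST l. (x ^\<^sub>m l) *\<^sub>v w \<in> W)"
  have l: "(x ^\<^sub>m l) *\<^sub>v w \<in> W" unfolding l_def using w(2) by (rule LeastI)
  have "(x ^\<^sub>m (l - 1)) *\<^sub>v w \<notin> W" if "l > 0"
    using not_less_Least[of "l - 1" "\<lambda>l. (x ^\<^sub>m l) *\<^sub>v w \<in> W"] that unfolding l_def by simp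
  then have "l \<le> g" using dim_cyclic_extension[OF x E w(1) W l] by simp
  have wc: "w \<in> carrier_vec d" using lin_subspaceD(6)[OF subspace_of_dim_lin_subspace[OF E(1)] w(1)] .
  have "(x ^\<^sub>m g) *\<^sub>v w = (x ^\<^sub>m (g - l)) *\<^sub>v ((x ^\<^sub>m l) *\<^sub>v w)"
    using pow_mult_vec(5)[OF x wc, of "g - l" l] \<open>l \<le> g\<close> by simp
  then show ?thesis using mat_invariant_pow[OF x subspace_of_dim_lin_subspace[OF W(1)] W(2) l] by simp
qed

lemma block_subset_of_codim:
  assumes W: "subspace_of_dim (2 * N) i W" "mat_invariant (zmat N) W" "W \<subseteq> block N a b"
    and ab: "a \<le> N" "b \<le> N" "a + b = i + g"
  shows "block N (a - g) (b - g) \<subseteq> W"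
proof
  fix v assume v: "v \<in> block N (a - g) (b - g)"
  obtain w where w: "w \<in> block N a b" "(zmat N ^\<^sub>m g) *\<^sub>v w = v"
    using block_zpow_surj[OF v ab(1,2)] .
  \<comment> \<open>\<open>a + b\<close> is merely an exponent large enough to kill the
    block.\<close>
  have "(zmat N ^\<^sub>m (a + b)) *\<^sub>v w \<in> block N 0 0" using zpow_block[OF w(1) ab(1,2), of "a + b"] by simp
  then have "(zmat N ^\<^sub>m (a + b)) *\<^sub>v w \<in> W"
    using lin_subspaceD(2)[OF subspace_of_dim_lin_subspace[OF W(1)]] by (simp add: block_00)
  then show "v \<in> W"
    using codim_pow_mem[OF zmat_carrier, of N i g "block N a b" W w "a + b"] W ab(3) w
      subspace_of_dim_block[OF ab(1,2)] mat_invariant_block[OF ab(1,2)] by simp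
qed

section \<open>Diagrams with half-cups\<close>

text \<open>A half-cup is an arc leaving past the right edge, so every vertex to its right lies
  below it: none of them may carry a ray, and a cup may not run over the half-cup.\<close>

definition half_crossingless :: "nat \<Rightarrow> (nat \<times> nat) set \<Rightarrow> nat set \<Rightarrow> bool" where
  "half_crossingless r C H \<longleftrightarrow> crossingless r C \<and> H \<subseteq> {1..r} - endpoints C \<and>
     (\<forall>h\<in>H. \<forall>v\<in>{1..r}. h < v \<longrightarrow> v \<in> endpoints C \<union> H)"

text \<open>The conditions of \<open>exotic_component\<close> without membership in
  \<open>Yvar\<close>, on a function, so that one \<open>G\<close> serves all truncations of a
  diagram.\<close>

definition fits :: "nat \<Rightarrow> nat \<Rightarrow> half_diagram \<Rightarrow> (nat \<Rightarrow> complex vec set) \<Rightarrow> bool" where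
  "fits N r D G \<longleftrightarrow>
     (\<forall>(i, j)\<in>fst D. G j = zpreim N ((j - i + 1) div 2) (G (i - 1))) \<and>
     (\<forall>i\<in>ray_vertices r D.
        G i = add_line (G (i - 1)) (evec N ((i + card {v \<in> ray_vertices r D. v \<le> i}) div 2)))"

lemma exotic_component_iff:
  "F \<in> exotic_component N r D \<longleftrightarrow> F \<in> Yvar N r \<and> fits N r D ((!) F)"
  unfolding exotic_component_def fits_def zpreim_def add_line_def by blast

lemma endpoints_iff: "v \<in> endpoints C \<longleftrightarrow> (\<exists>u. (v, u) \<in> C \<or> (u, v) \<in> C)"
  unfolding endpoints_def by force

lemma endpointsI: "(i, j) \<in> C \<Longrightarrow> i \<in> endpoints C" "(i, j) \<in> C \<Longrightarrow> j \<in> endpoints C"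
  unfolding endpoints_iff by auto

lemma crossinglessD:
  assumes "crossingless r C"
  shows "(i, j) \<in> C \<Longrightarrow> 1 \<le> i \<and> i < j \<and> j \<le> r"
    and "(i, j) \<in> C \<Longrightarrow> (i', j') \<in> C \<Longrightarrow> (i, j) \<noteq> (i', j') \<Longrightarrow> i \<noteq> i' \<and> i \<noteq> j' \<and> j \<noteq> i' \<and> j \<noteq> j'"
    and "(i, j) \<in> C \<Longrightarrow> (i', j') \<in> C \<Longrightarrow> \<not> (i < i' \<and> i' < j \<and> j < j')"
    and "(i, j) \<in> C \<Longrightarrow> v \<in> {1..r} \<Longrightarrow> i < v \<Longrightarrow> v < j \<Longrightarrow> v \<in> endpoints C"
    and "finite C" "endpoints C \<subseteq> {1..r}"
proof -
  have a1: "\<forall>(i, j)\<in>C. 1 \<le> i \<and> i < j \<and> j \<le> r"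
    and a2: "\<forall>c\<in>C. \<forall>c'\<in>C. c \<noteq> c' \<longrightarrow> {fst c, snd c} \<inter> {fst c', snd c'} = {}"
    and a3: "\<forall>(i, j)\<in>C. \<forall>(i', j')\<in>C. \<not> (i < i' \<and> i' < j \<and> j < j')"
    and a4: "\<forall>(i, j)\<in>C. \<forall>v\<in>{1..r} - endpoints C. \<not> (i < v \<and> v < j)"
    using assms unfolding crossingless_def by simp_all
  show 1: "(i, j) \<in> C \<Longrightarrow> 1 \<le> i \<and> i < j \<and> j \<le> r" for i j
    using bspec[OF a1, of "(i, j)"] by simp
  have "{fst c, snd c} \<inter> {fst c', snd c'} = {}" if "c \<in> C" "c' \<in> C" "c \<noteq> c'" for c c'
    using a2 that by blast
  from this[of "(i, j)" "(i', j')"]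
  show "(i, j) \<in> C \<Longrightarrow> (i', j') \<in> C \<Longrightarrow> (i, j) \<noteq> (i', j') \<Longrightarrow> i \<noteq> i' \<and> i \<noteq> j' \<and> j \<noteq> i' \<and> j \<noteq> j'"
    by auto
  show "(i, j) \<in> C \<Longrightarrow> (i', j') \<in> C \<Longrightarrow> \<not> (i < i' \<and> i' < j \<and> j < j')"
    using a3 by auto
  show "(i, j) \<in> C \<Longrightarrow> v \<in> {1..r} \<Longrightarrow> i < v \<Longrightarrow> v < j \<Longrightarrow> v \<in> endpoints C"
    using bspec[OF a4, of "(i, j)"] by auto
  have "C \<subseteq> {1..r} \<times> {1..r}"
  proof
    fix p assume "p \<in> C"
    then show "p \<in> {1..r} \<times> {1..r}" using 1[of "fst p" "snd p"] by (cases p) auto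
  qed
  then show "finite C" by (rule finite_subset) simp
  show "endpoints C \<subseteq> {1..r}"
  proof
    fix v assume "v \<in> endpoints C"
    then obtain u where "(v, u) \<in> C \<or> (u, v) \<in> C" unfolding endpoints_iff by blast
    then show "v \<in> {1..r}" using 1[of v u] 1[of u v] by auto
  qed
qed

lemma crossinglessI:
  assumes "\<And>i j. (i, j) \<in> C \<Longrightarrow> 1 \<le> i \<and> i < j \<and> j \<le> r"
    and "\<And>i j i' j'. (i, j) \<in> C \<Longrightarrow> (i', j') \<in> C \<Longrightarrow> (i, j) \<noteq> (i', j') \<Longrightarrow>
      i \<noteq> i' \<and> i \<noteq> j' \<and> j \<noteq> i' \<and> j \<noteq> j'"
    and "\<And>i j i' j'. (i, j) \<in> C \<Longrightarrow> (i', j') \<in> C \<Longrightarrow> i < i' \<Longrightarrow> i' < j \<Longrightarrow> j < j' \<Longrightarrow> False"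
    and "\<And>i j v. (i, j) \<in> C \<Longrightarrow> v \<in> {1..r} \<Longrightarrow> i < v \<Longrightarrow> v < j \<Longrightarrow> v \<in> endpoints C"
  shows "crossingless r C"
proof -
  have "\<forall>c\<in>C. \<forall>c'\<in>C. c \<noteq> c' \<longrightarrow> {fst c, snd c} \<inter> {fst c', snd c'} = {}"
  proof (intro ballI impI)
    fix c c' assume "c \<in> C" "c' \<in> C" "c \<noteq> c'"
    then show "{fst c, snd c} \<inter> {fst c', snd c'} = {}"
      using assms(2)[of "fst c" "snd c" "fst c'" "snd c'"] by auto
  qed
  moreover have "\<forall>(i, j)\<in>C. 1 \<le> i \<and> i < j \<and> j \<le> r" using assms(1) by auto
  moreover have "\<forall>(i, j)\<in>C. \<forall>(i', j')\<in>C. \<not> (i < i' \<and> i' < j \<and> j < j')"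
    by (clarify, rule assms(3))
  moreover have "\<forall>(i, j)\<in>C. \<forall>v\<in>{1..r} - endpoints C. \<not> (i < v \<and> v < j)"
    using assms(4) by (clarify, auto)
  ultimately show ?thesis unfolding crossingless_def by (intro conjI)
qed

lemma crossingless_inj_on:
  assumes "crossingless r C"
  shows "inj_on fst C" "inj_on snd C"
  using crossinglessD(2)[OF assms] unfolding inj_on_def by (metis prod.collapse)+

text \<open>Stated for subfamilies of cups because pieces of a diagram are counted later.\<close>

lemma card_endpoints:
  assumes "crossingless r C" "B \<subseteq> C"
  shows "card (endpoints B) = 2 * card B"
proof -
  note D = crossinglessD[OF assms(1)]
  have "finite B" using assms(2) D(5) finite_subset by blast
  have inj: "inj_on fst B" "inj_on snd B"
    using crossingless_inj_on[OF assms(1)] assms(2) inj_on_subset by blast+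
  have "fst ` B \<inter> snd ` B = {}"
  proof -
    have False if "(i, j) \<in> B" "(i', i) \<in> B" for i j i'
      using D(1)[of i j] D(1)[of i' i] D(2)[of i j i' i] that assms(2) by auto
    then show ?thesis by auto
  qed
  then show ?thesis
    unfolding endpoints_def using \<open>finite B\<close> inj by (simp add: card_Un_disjoint card_image)
qed

text \<open>Each cup uses two vertices, each half-cup and each ray one. This converts the index in
  the ray condition into an expression in the number of cups.\<close>

lemma half_crossingless_count:
  assumes "half_crossingless r C H"
  shows "2 * card C + card H + card (ray_vertices r (C, H)) = r" "finite H" "finite C"
proof -
  have c: "crossingless r C" "H \<subseteq> {1..r} - endpoints C" using assms unfolding half_crossingless_def by auto
  note D = crossinglessD[OF c(1)]
  show H: "finite H" using c(2) finite_subset by blast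
  show "finite C" using D(5) .
  have e: "finite (endpoints C)" using D(6) finite_subset by blast
  have "endpoints C \<union> H \<subseteq> {1..r}" using c D(6) by auto
  then have "card (ray_vertices r (C, H)) = r - card (endpoints C \<union> H)" "card (endpoints C \<union> H) \<le> r"
    unfolding ray_vertices_def using e H card_mono[of "{1..r}" "endpoints C \<union> H"]
    by (auto simp: card_Diff_subset)
  moreover have "card (endpoints C \<union> H) = 2 * card C + card H"
    using card_endpoints[OF c(1), of C] e H c(2) by (subst card_Un_disjoint) auto
  ultimately show "2 * card C + card H + card (ray_vertices r (C, H)) = r" by simp
qed

section \<open>Truncating diagrams where the vertical line after a vertex meets no cup\<close>

definition uncrossed :: "nat \<Rightarrow> (nat \<times> nat) set \<Rightarrow> bool" where
  "uncrossed s C \<longleftrightarrow> (\<forall>(i, j)\<in>C. \<not> (i \<le> s \<and> s < j))"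

lemma uncrossedD: "uncrossed s C \<Longrightarrow> (i, j) \<in> C \<Longrightarrow> \<not> (i \<le> s \<and> s < j)"
  unfolding uncrossed_def by auto

text \<open>No cup is cut, so each remaining vertex keeps its type. Rays are numbered from the left,
  so the ray conditions keep their indices as well.\<close>

lemma half_crossingless_restrict:
  fixes C :: "(nat \<times> nat) set"
  assumes hc: "half_crossingless r C H" and s: "s \<le> r"
    and cut: "uncrossed s C"
  defines "C' \<equiv> {(i, j) \<in> C. j \<le> s}" and "H' \<equiv> {h \<in> H. h \<le> s}"
  shows "endpoints C' = {v \<in> endpoints C. v \<le> s}"
    and "half_crossingless s C' H'"
    and "ray_vertices s (C', H') = {v \<in> ray_vertices r (C, H). v \<le> s}"
    and "fits N r (C, H) G \<Longrightarrow> fits N s (C', H') G"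
proof -
  have c: "crossingless r C" "H \<subseteq> {1..r} - endpoints C"
    and hv: "\<And>h v. h \<in> H \<Longrightarrow> v \<in> {1..r} \<Longrightarrow> h < v \<Longrightarrow> v \<in> endpoints C \<union> H"
    using hc unfolding half_crossingless_def by auto
  note D = crossinglessD[OF c(1)]
  have sub: "C' \<subseteq> C" unfolding C'_def by auto
  show e: "endpoints C' = {v \<in> endpoints C. v \<le> s}"
  proof (intro equalityI subsetI)
    fix v assume "v \<in> endpoints C'"
    then obtain i j where ij: "(i, j) \<in> C" "j \<le> s" "v = i \<or> v = j" unfolding endpoints_iff C'_def by auto
    then show "v \<in> {v \<in> endpoints C. v \<le> s}" using D(1)[OF ij(1)] endpointsI[OF ij(1)] by auto
  next
    fix v assume "v \<in> {v \<in> endpoints C. v \<le> s}"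
    then obtain i j where ij: "(i, j) \<in> C" "v \<le> s" "v = i \<or> v = j" unfolding endpoints_iff by auto
    then have "(i, j) \<in> C'" using uncrossedD[OF cut ij(1)] unfolding C'_def by auto
    then show "v \<in> endpoints C'" using endpointsI ij(3) by blast
  qed
  have "crossingless s C'"
  proof (rule crossinglessI)
    show "\<And>i j. (i, j) \<in> C' \<Longrightarrow> 1 \<le> i \<and> i < j \<and> j \<le> s" using D(1) unfolding C'_def by auto
    show "\<And>i j i' j'. (i, j) \<in> C' \<Longrightarrow> (i', j') \<in> C' \<Longrightarrow> (i, j) \<noteq> (i', j') \<Longrightarrow>
      i \<noteq> i' \<and> i \<noteq> j' \<and> j \<noteq> i' \<and> j \<noteq> j'"
      by (rule D(2)) (use sub in auto)
    show "\<And>i j i' j'. (i, j) \<in> C' \<Longrightarrow> (i', j') \<in> C' \<Longrightarrow> i < i' \<Longrightarrow> i' < j \<Longrightarrow> j < j' \<Longrightarrow> False"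
    proof -
      fix i j i' j' assume "(i, j) \<in> C'" "(i', j') \<in> C'" "i < i'" "i' < j" "j < j'"
      then show False using D(3)[of i j i' j'] sub by auto
    qed
    show "\<And>i j v. (i, j) \<in> C' \<Longrightarrow> v \<in> {1..s} \<Longrightarrow> i < v \<Longrightarrow> v < j \<Longrightarrow> v \<in> endpoints C'"
    proof -
      fix i j v assume ij: "(i, j) \<in> C'" and v: "v \<in> {1..s}" "i < v" "v < j"
      have "v \<in> endpoints C" using D(4)[of i j v] ij sub v s by auto
      then show "v \<in> endpoints C'" using v(1) e by auto
    qed
  qed
  moreover have "H' \<subseteq> {1..s} - endpoints C'" using c(2) unfolding H'_def e by auto
  moreover have "\<forall>h\<in>H'. \<forall>v\<in>{1..s}. h < v \<longrightarrow> v \<in> endpoints C' \<union> H'"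
  proof (intro ballI impI)
    fix h v assume "h \<in> H'" "v \<in> {1..s}" "h < v"
    then show "v \<in> endpoints C' \<union> H'" using hv[of h v] s unfolding H'_def e by auto
  qed
  ultimately show "half_crossingless s C' H'" unfolding half_crossingless_def by blast
  show rv: "ray_vertices s (C', H') = {v \<in> ray_vertices r (C, H). v \<le> s}"
    unfolding ray_vertices_def fst_conv snd_conv e using s by (auto simp: H'_def)
  assume f: "fits N r (C, H) G"
  show "fits N s (C', H') G"
    unfolding fits_def
  proof (intro conjI ballI)
    fix p assume p: "p \<in> fst (C', H')"
    show "case p of (i, j) \<Rightarrow> G j = zpreim N ((j - i + 1) div 2) (G (i - 1))"
    proof -
      have "p \<in> C" using p sub by auto
      then show ?thesis by (rule bspec[OF conjunct1[OF f[unfolded fits_def fst_conv]]])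
    qed
  next
    fix i assume i: "i \<in> ray_vertices s (C', H')"
    then have "{v \<in> ray_vertices s (C', H'). v \<le> i} = {v \<in> ray_vertices r (C, H). v \<le> i}"
      unfolding rv by auto
    moreover have "i \<in> ray_vertices r (C, H)" using i unfolding rv by simp
    ultimately show "G i = add_line (G (i - 1)) (evec N ((i + card {v \<in> ray_vertices s (C', H'). v \<le> i}) div 2))"
      using bspec[OF conjunct2[OF f[unfolded fits_def]], of i] by simp
  qed
qed

text \<open>A cup with one end in the segment has both ends there, since neither boundary is
  crossed; hence the segment is exactly the endpoint set of its own cups.\<close>

lemma card_cups_inside:
  assumes c: "crossingless r C" and seg: "{s<..t} \<subseteq> endpoints C" "t \<le> r" "s \<le> t"
    and cut: "uncrossed s C" "uncrossed t C"
  shows "t - s = 2 * card {(i, j) \<in> C. s < j \<and> j \<le> t}"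
    "card {(i, j) \<in> C. j \<le> t} = card {(i, j) \<in> C. j \<le> s} + (t - s) div 2"
proof -
  note D = crossinglessD[OF c]
  let ?B = "{(i, j) \<in> C. s < j \<and> j \<le> t}"
  have "endpoints ?B = {s<..t}"
  proof (intro equalityI subsetI)
    fix v assume "v \<in> endpoints ?B"
    then obtain i j where ij: "(i, j) \<in> C" "s < j" "j \<le> t" "v = i \<or> v = j" unfolding endpoints_iff by auto
    then show "v \<in> {s<..t}" using D(1)[OF ij(1)] uncrossedD[OF cut(1) ij(1)] by auto
  next
    fix v assume v: "v \<in> {s<..t}"
    then have "v \<in> endpoints C" using seg(1) by auto
    then obtain i j where ij: "(i, j) \<in> C" "v = i \<or> v = j" unfolding endpoints_iff by auto
    then have "s < j" "j \<le> t" using v D(1)[OF ij(1)] uncrossedD[OF cut(2) ij(1)] by auto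
    then show "v \<in> endpoints ?B" using ij unfolding endpoints_iff by auto
  qed
  then show 1: "t - s = 2 * card ?B" using card_endpoints[OF c, of ?B] by auto
  have "{(i, j) \<in> C. j \<le> t} = {(i, j) \<in> C. j \<le> s} \<union> ?B" using seg(3) by auto
  moreover have "finite {(i, j) \<in> C. j \<le> s}" "finite ?B" by (auto intro: finite_subset[OF _ D(5)])
  moreover have "{(i, j) \<in> C. j \<le> s} \<inter> ?B = {}" by auto
  ultimately have "card {(i, j) \<in> C. j \<le> t} = card {(i, j) \<in> C. j \<le> s} + card ?B"
    by (simp add: card_Un_disjoint)
  then show "card {(i, j) \<in> C. j \<le> t} = card {(i, j) \<in> C. j \<le> s} + (t - s) div 2" using 1 by simp
qed

lemma zpreim_add:
  "zpreim N (s + t) W = zpreim N t (zpreim N s W)"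
  unfolding zpreim_def using zpow(1)[of _ N t] zpow(5)[of _ N s t] by auto

lemma zpreim_mono: "W \<subseteq> W' \<Longrightarrow> zpreim N s W \<subseteq> zpreim N s W'"
  unfolding zpreim_def by auto

text \<open>A cup across the line left of \<open>i\<close> would have to end below the last cup,
  which is a crossing, or beyond \<open>r\<close>. So the vertices from \<open>i\<close> to
  \<open>r\<close> are matched among themselves.\<close>

lemma last_cup:
  assumes c: "crossingless r C" and i: "(i, r) \<in> C"
  shows "{i - 1<..r} \<subseteq> endpoints C"
    and "uncrossed (i - 1) C" and "uncrossed r C"
    and "even (r - (i - 1))"
proof -
  note D = crossinglessD[OF c]
  show 1: "{i - 1<..r} \<subseteq> endpoints C"
  proof
    fix v assume v: "v \<in> {i - 1<..r}"
    then consider "v = i" | "v = r" | "i < v" "v < r" using D(1)[OF i] by force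
    then show "v \<in> endpoints C" using i D(4)[OF i, of v] by cases (auto simp: endpoints_iff)
  qed
  have "\<not> (a \<le> i - 1 \<and> i - 1 < b)" if ab: "(a, b) \<in> C" for a b
  proof
    assume "a \<le> i - 1 \<and> i - 1 < b"
    then have "a < i" "i \<le> b" using D(1)[OF i] by auto
    moreover from this have "b \<noteq> i" "b \<noteq> r" using D(2)[OF ab i] by auto
    ultimately show False using D(3)[OF ab i] D(1)[OF ab] by auto
  qed
  then show 2: "uncrossed (i - 1) C" unfolding uncrossed_def by blast
  show 3: "uncrossed r C" unfolding uncrossed_def using D(1) by (clarify) (metis leD)
  have "r - (i - 1) = 2 * card {(a, b) \<in> C. i - 1 < b \<and> b \<le> r}"
    using D(1)[OF i] by (intro card_cups_inside(1)[OF c 1 _ _ 2 3]) auto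
  then show "even (r - (i - 1))" by simp
qed

lemma zpreim_0: "nflag (2 * N) x r G \<Longrightarrow> i \<le> r \<Longrightarrow> zpreim N 0 (G i) = G i"
  unfolding zpreim_def using zpow(2) lin_subspaceD(6)[OF nflag_lin_subspace] by auto

text \<open>The last cup of the segment determines \<open>G r\<close> from the member before its
  left end; iterating composes the preimages. Needed for the vertices between the last half-cup and
  the end of the diagram.\<close>

lemma fits_cupped_segment:
  assumes "half_crossingless r C H" "fits N r (C, H) G" "nflag (2 * N) x r G"
    and "s \<le> r" "{s<..r} \<subseteq> endpoints C" "uncrossed s C"
  shows "G r = zpreim N ((r - s) div 2) (G s) \<and> even (r - s)"
  using assms
proof (induction r arbitrary: C H rule: less_induct)
  case (less r)
  show ?case
  proof (cases "r = s")
    case True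
    then show ?thesis using zpreim_0[OF less.prems(3)] by simp
  next
    case False
    then have sr: "s < r" using less.prems(4) by simp
    have c: "crossingless r C" using less.prems(1) unfolding half_crossingless_def by simp
    note D = crossinglessD[OF c]
    have "r \<in> endpoints C" using sr less.prems(5) by auto
    then obtain u where "(r, u) \<in> C \<or> (u, r) \<in> C" unfolding endpoints_iff by blast
    then obtain i where i: "(i, r) \<in> C" using D(1)[of r u] by auto
    note L = last_cup[OF c i]
    have si: "s < i" "i < r" using uncrossedD[OF less.prems(6) i] sr D(1)[OF i] by auto
    let ?C = "{(a, b) \<in> C. b \<le> i - 1}" and ?H = "{h \<in> H. h \<le> i - 1}"
    have le: "i - 1 \<le> r" using si by simp
    note R = half_crossingless_restrict[OF less.prems(1) le L(2)]
    have "G (i - 1) = zpreim N ((i - 1 - s) div 2) (G s) \<and> even (i - 1 - s)"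
    proof (rule less.IH[of "i - 1" ?C ?H])
      show "i - 1 < r" using si by simp
      show "half_crossingless (i - 1) ?C ?H" using R(2) .
      show "fits N (i - 1) (?C, ?H) G" using R(4)[OF less.prems(2)] .
      show "nflag (2 * N) x (i - 1) G" using nflag_le[OF less.prems(3) le] .
      show "s \<le> i - 1" using si by simp
      show "{s<..i - 1} \<subseteq> endpoints ?C"
        unfolding R(1) using less.prems(5) le by (auto dest: subsetD)
      show "uncrossed s ?C" using less.prems(6) unfolding uncrossed_def by auto
    qed
    moreover have "G r = zpreim N ((r - i + 1) div 2) (G (i - 1))"
      using less.prems(2) i unfolding fits_def by auto
    \<comment> \<open>The halvings add up because both pieces have even length.\<close>
    moreover have "(r - i + 1) div 2 + (i - 1 - s) div 2 = (r - s) div 2" "even (r - s)"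
      if ev: "even (i - 1 - s)"
    proof -
      obtain a where a: "r - (i - 1) = 2 * a" using L(4) by (rule evenE)
      obtain b where b: "i - 1 - s = 2 * b" using ev by (rule evenE)
      have "r = i - 1 + 2 * a" "i - 1 = s + 2 * b" using a b le si by linarith+
      moreover have "r - i + 1 = r - (i - 1)" using si by linarith
      ultimately have "r - i + 1 = 2 * a" "r - s = 2 * (a + b)" using a by simp_all
      with b show "(r - i + 1) div 2 + (i - 1 - s) div 2 = (r - s) div 2" "even (r - s)" by simp_all
    qed
    ultimately show ?thesis by (metis zpreim_add add.commute)
  qed
qed

text \<open>The induction strips the last vertex, or everything from the left end of the last cup
  on. The bound has dimension \<open>r + card H\<close>, so \<open>G r\<close> has codimension
  \<open>card H\<close> in it.\<close>

lemma fits_upper_bound: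
  assumes "half_crossingless r C H" "fits N r (C, H) G" "nflag (2 * N) (zmat N) r G" "r \<le> N"
  shows "G r \<subseteq> block N (r - card C) (card C + card H)"
  using assms
proof (induction r arbitrary: C H rule: less_induct)
  case (less r)
  have c: "crossingless r C" and cH: "H \<subseteq> {1..r} - endpoints C"
    and hv: "\<And>h v. h \<in> H \<Longrightarrow> v \<in> {1..r} \<Longrightarrow> h < v \<Longrightarrow> v \<in> endpoints C \<union> H"
    using less.prems(1) unfolding half_crossingless_def by auto
  note D = crossinglessD[OF c]
  note cnt = half_crossingless_count[OF less.prems(1)]
  show ?case
  proof (cases "r = 0")
    case True
    then show ?thesis using less.prems(3) lin_subspaceD(2)[OF lin_subspace_block] unfolding nflag_def by auto
  next
    case False
    then have r: "r \<in> {1..r}" "r - 1 < r" by auto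
    have cut: "uncrossed (r - 1) C" if "r \<notin> endpoints C"
    proof -
      have "\<not> (a \<le> r - 1 \<and> r - 1 < b)" if "(a, b) \<in> C" for a b
      proof
        assume "a \<le> r - 1 \<and> r - 1 < b"
        then have "b = r" using D(1)[OF that] by auto
        then show False using that \<open>r \<notin> endpoints C\<close> endpointsI by blast
      qed
      then show ?thesis unfolding uncrossed_def by blast
    qed
    have small: "{(a, b) \<in> C. b \<le> r - 1} = C" if "r \<notin> endpoints C"
    proof -
      have "b \<le> r - 1" if "(a, b) \<in> C" for a b
        using D(1)[OF that] endpointsI(2)[OF that] \<open>r \<notin> endpoints C\<close> by (cases "b = r") auto
      then show ?thesis by auto
    qed
    consider (ray) "r \<in> ray_vertices r (C, H)" | (half) "r \<in> H" | (cup) "r \<in> endpoints C"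
      using r unfolding ray_vertices_def by auto
    then show ?thesis
    proof cases
      case ray
      then have nr: "r \<notin> endpoints C" "r \<notin> H" unfolding ray_vertices_def by auto
      \<comment> \<open>A ray at the last vertex would lie to the right of any half-cup.\<close>
      have "h \<notin> H" for h
      proof
        assume h: "h \<in> H"
        then have "h \<le> r" "h \<noteq> r" using cH nr by auto
        then show False using hv[OF h r(1)] nr by auto
      qed
      then have H: "H = {}" by auto
      note C = small[OF nr(1)]
      have le: "r - 1 \<le> r" by simp
      note R = half_crossingless_restrict[OF less.prems(1) le cut[OF nr(1)], unfolded C H, simplified]
      have IH: "G (r - 1) \<subseteq> block N (r - 1 - card C) (card C)"
        using less.IH[OF r(2), of C "{}"] R nflag_le[OF less.prems(3) le] less.prems(2,4) H by simp
      have all: "{v \<in> ray_vertices r (C, H). v \<le> r} = ray_vertices r (C, H)"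
        unfolding ray_vertices_def by auto
      \<comment> \<open>Without half-cups there are \<open>r - 2 * card C\<close> rays, so the ray
        vector is \<open>evec N (r - card C)\<close>, the first one missing from the previous
        block.\<close>
      have idx: "(r + card {v \<in> ray_vertices r (C, H). v \<le> r}) div 2 = r - card C"
        unfolding all using cnt(1) H by simp
      have "G r = add_line (G (r - 1)) (evec N (r - card C))"
        using less.prems(2) ray idx unfolding fits_def by auto
      also have "\<dots> \<subseteq> block N (r - card C) (card C)"
        using order_trans[OF IH block_mono[of "r - 1 - card C" "r - card C" "card C" "card C" N]]
          less.prems(4)
        by (intro add_line_subset[OF lin_subspace_block] evec_block) auto
      finally show ?thesis using H by simp
    next
      case half
      then have nr: "r \<notin> endpoints C" using cH by auto
      note C = small[OF nr]
      have H: "{h \<in> H. h \<le> r - 1} = H - {r}"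
      proof -
        have "h \<le> r - 1 \<longleftrightarrow> h \<noteq> r" if "h \<in> H" for h
        proof -
          have "h \<le> r" using that cH by auto
          then show ?thesis using r(2) by linarith
        qed
        then show ?thesis by auto
      qed
      have le: "r - 1 \<le> r" by simp
      note R = half_crossingless_restrict[OF less.prems(1) le cut[OF nr], unfolded C H]
      have cH1: "card H = Suc (card (H - {r}))" using card_Suc_Diff1[OF cnt(2) half] by simp
      have IH: "G (r - 1) \<subseteq> block N (r - 1 - card C) (card C + card (H - {r}))"
        using less.IH[OF r(2) R(2)] R(4)[OF less.prems(2)] nflag_le[OF less.prems(3) le] less.prems(4) by simp
      \<comment> \<open>A half-cup imposes no condition; the flag condition alone enlarges both
        indices by one.\<close>
      have "G r \<subseteq> zpreim N 1 (G (r - 1))"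
        unfolding zpreim_def using nflag_pow[OF less.prems(3) zmat_carrier, of r _ 1]
          lin_subspaceD(6)[OF nflag_lin_subspace[OF less.prems(3)], of r] by auto
      also have "\<dots> \<subseteq> zpreim N 1 (block N (r - 1 - card C) (card C + card (H - {r})))"
        using zpreim_mono[OF IH] .
      also have "\<dots> = block N (r - 1 - card C + 1) (card C + card (H - {r}) + 1)"
        using cnt(1) cH1 less.prems(4) by (intro zpreim_block) auto
      also have "\<dots> = block N (r - card C) (card C + card H)"
        using cnt(1) cH1 by (intro arg_cong2[of _ _ _ _ "block N"]) linarith+
      finally show ?thesis .
    next
      case cup
      then obtain u where "(r, u) \<in> C \<or> (u, r) \<in> C" unfolding endpoints_iff by blast
      then obtain i where i: "(i, r) \<in> C" using D(1)[of r u] by auto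
      note L = last_cup[OF c i]
      have ir: "1 \<le> i" "i < r" using D(1)[OF i] by auto
      let ?C = "{(a, b) \<in> C. b \<le> i - 1}"
      let ?t = "(r - (i - 1)) div 2"
      have le: "i - 1 \<le> r" using ir by simp
      \<comment> \<open>The vertices from \<open>i\<close> to \<open>r\<close> are all endpoints, so
        every half-cup lies before the last cup.\<close>
      have Hs: "{h \<in> H. h \<le> i - 1} = H"
      proof -
        have "h \<le> i - 1" if "h \<in> H" for h
        proof (rule ccontr)
          assume "\<not> h \<le> i - 1"
          then have "h \<in> {i - 1<..r}" using that cH by auto
          then show False using L(1) that cH by auto
        qed
        then show ?thesis by auto
      qed
      note R = half_crossingless_restrict[OF less.prems(1) le L(2), unfolded Hs]
      have IH: "G (i - 1) \<subseteq> block N (i - 1 - card ?C) (card ?C + card H)"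
        using less.IH[OF _ R(2)] R(4)[OF less.prems(2)] nflag_le[OF less.prems(3) le] less.prems(4) ir by simp
      have "{(a, b) \<in> C. b \<le> r} = C" using D(1) by auto
      then have cc: "card C = card ?C + ?t"
        using card_cups_inside(2)[OF c L(1) _ le L(2) L(3)] by simp
      have t: "2 * ?t = r - (i - 1)" using L(4) by simp
      have "r - i + 1 = r - (i - 1)" using ir by linarith
      have cnt': "2 * card ?C + card H \<le> i - 1" using half_crossingless_count(1)[OF R(2)] by linarith
      have "G r = zpreim N ?t (G (i - 1))" using less.prems(2) i \<open>r - i + 1 = r - (i - 1)\<close> unfolding fits_def by auto
      also have "\<dots> \<subseteq> zpreim N ?t (block N (i - 1 - card ?C) (card ?C + card H))" using zpreim_mono[OF IH] .
      also have "\<dots> = block N (i - 1 - card ?C + ?t) (card ?C + card H + ?t)"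
        using cnt' t less.prems(4) ir by (intro zpreim_block) linarith+
      also have "\<dots> = block N (r - card C) (card C + card H)"
        using cnt' t cc ir by (intro arg_cong2[of _ _ _ _ "block N"]) linarith+
      finally show ?thesis .
    qed
  qed
qed

text \<open>The coefficient of \<open>e\<close> in \<open>v\<close> is nonzero because
  \<open>v\<close> lies outside \<open>X\<close>, so \<open>e\<close> itself can be recovered inside
  \<open>W\<close>.\<close>

lemma add_line_subset_of_mem:
  assumes W: "lin_subspace d W" and X: "X \<subseteq> W" and e: "e \<in> carrier_vec d"
    and v: "v \<in> W" "v \<in> add_line X e" "v \<notin> X"
  shows "add_line X e \<subseteq> W"
proof -
  obtain u c where uc: "u \<in> X" "v = u + c \<cdot>\<^sub>v e" using v(2) unfolding add_line_def by auto
  have u: "u \<in> W" "u \<in> carrier_vec d" using uc(1) X lin_subspaceD(6)[OF W] by auto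
  have "c \<noteq> 0"
  proof
    assume "c = 0"
    then have "v = u" unfolding uc(2) using u e by (intro eq_vecI) auto
    then show False using uc(1) v(3) by simp
  qed
  have "inverse c \<cdot>\<^sub>v (v - u) = e"
    unfolding uc(2) using u e \<open>c \<noteq> 0\<close> by (intro eq_vecI) auto
  then have "e \<in> W" using lin_subspaceD(4)[OF W lin_subspaceD(5)[OF W v(1) u(1)]] by metis
  then show ?thesis using add_line_subset[OF W X] by simp
qed

text \<open>By descending induction on \<open>g\<close>: if \<open>W\<close> contains the image of the block under
  \<open>z\<^sup>g\<close>, then it also contains the image under \<open>z\<^bsup>g-1\<^esup>\<close>, because modulo the former
  \<open>z\<^bsup>g-1\<^esup>u\<close> and \<open>z\<^bsup>g-1\<^esup>w\<close> are the two missing basis vectors.\<close>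

lemma block_subset_of_two_generators:
  assumes W: "lin_subspace (2 * N) W" "mat_invariant (zmat N) W" and ab: "a \<le> N" "b \<le> N" "a > b" "b > 0"
    and w: "w \<in> W" "w \<in> block N a b" "w \<notin> block N (a - 1) b"
    and u: "u \<in> W" "u \<in> block N (a - 1) b" "u \<notin> block N (a - 1) (b - 1)"
  shows "block N a b \<subseteq> W"
proof -
  define g where "g = (LEAST g. block N (a - g) (b - g) \<subseteq> W)"
  have "block N (a - a) (b - a) \<subseteq> W"
    using ab lin_subspaceD(2)[OF W(1)] by (simp add: block_00)
  then have g: "block N (a - g) (b - g) \<subseteq> W" "g \<le> a"
    unfolding g_def by (rule LeastI, rule Least_le)
  have "g = 0"
  proof (rule ccontr)
    assume "g \<noteq> 0"
    then have g1: "a - (g - 1) = Suc (a - g)" "g - 1 < g" "g - 1 \<le> a - 1" using g(2) by linarith+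
    let ?z = "\<lambda>v. (zmat N ^\<^sub>m (g - 1)) *\<^sub>v v"
    have zW: "?z v \<in> W" if "v \<in> W" for v using mat_invariant_pow[OF zmat_carrier W that] .
    have 1: "block N (a - g) (b - (g - 1)) \<subseteq> W"
    proof (cases "g \<le> b")
      case True
      then have g2: "b - (g - 1) = Suc (b - g)" "b - g < N" using ab \<open>g \<noteq> 0\<close> by linarith+
      have "?z u \<in> block N (a - 1 - (g - 1)) (b - (g - 1))" using zpow_block[OF u(2)] ab by auto
      moreover have "a - 1 - (g - 1) = a - g" using \<open>g \<noteq> 0\<close> by simp
      ultimately have zu: "?z u \<in> add_line (block N (a - g) (b - g)) (fvec N (Suc (b - g)))"
        unfolding g2(1) block_add_fvec[OF g2(2)] by simp
      have "?z u \<notin> block N (a - g) (b - g)"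
      proof
        assume "?z u \<in> block N (a - g) (b - g)"
        then have "u \<in> block N (a - g + (g - 1)) (b - g + (g - 1))"
          by (rule zpow_in_block[OF block_carrier[OF u(2)]]) (use ab True g(2) in linarith)+
        moreover have "a - g + (g - 1) = a - 1" "b - g + (g - 1) = b - 1" using True g(2) \<open>g \<noteq> 0\<close> by linarith+
        ultimately show False using u(3) by simp
      qed
      then show ?thesis
        unfolding g2(1) block_add_fvec[OF g2(2)]
        using add_line_subset_of_mem[OF W(1) g(1) fvec_carrier zW[OF u(1)] zu] by simp
    \<comment> \<open>For \<open>g > b\<close> the second string is exhausted at both exponents, so
      there is nothing to adjoin.\<close>
    next
      case False
      then have "b - (g - 1) = b - g" by simp
      then show ?thesis using g(1) by simp
    qed
    have aN: "a - g < N" using ab \<open>g \<noteq> 0\<close> by linarith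
    have zw: "?z w \<in> add_line (block N (a - g) (b - (g - 1))) (evec N (Suc (a - g)))"
      using zpow_block[OF w(2) ab(1,2), of "g - 1"] unfolding g1(1) block_add_evec[OF aN] .
    have "?z w \<notin> block N (a - g) (b - (g - 1))"
    proof
      assume "?z w \<in> block N (a - g) (b - (g - 1))"
      then have "w \<in> block N (a - g + (g - 1)) (b - (g - 1) + (g - 1))"
        by (rule zpow_in_block[OF block_carrier[OF w(2)]]) (use ab g1(3) g(2) in linarith)+
      moreover have "a - g + (g - 1) = a - 1" using g(2) \<open>g \<noteq> 0\<close> by linarith
      \<comment> \<open>For \<open>g - 1 > b\<close> the second index recovered here exceeds
        \<open>b\<close>; intersecting with the block known to contain \<open>w\<close> repairs
        this.\<close>
      ultimately have "w \<in> block N (min (a - 1) a) (min (b - (g - 1) + (g - 1)) b)"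
        by (intro subsetD[OF block_Int] IntI) (use w(2) ab in auto)
      then show False using w(3) block_mono[of "min (a - 1) a" "a - 1" "min (b - (g - 1) + (g - 1)) b" b N] by auto
    qed
    then have "block N (a - (g - 1)) (b - (g - 1)) \<subseteq> W"
      unfolding g1(1) block_add_evec[OF aN]
      using add_line_subset_of_mem[OF W(1) 1 evec_carrier zW[OF w(1)] zw] by simp
    then have "g \<le> g - 1" unfolding g_def by (rule Least_le)
    then show False using g1(2) by simp
  qed
  then show ?thesis using g(1) by simp
qed

section \<open>Appending a vertex to a diagram\<close>

lemma ray_vertices_endpoints:
  "ray_vertices r (C, H) = {1..r} - (endpoints C \<union> H)"
  unfolding ray_vertices_def by simp

lemma crossingless_Suc: 
  assumes "crossingless r C"
  shows "crossingless (Suc r) C"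
proof (rule crossinglessI)
  note D = crossinglessD[OF assms]
  show "\<And>i j. (i, j) \<in> C \<Longrightarrow> 1 \<le> i \<and> i < j \<and> j \<le> Suc r" using D(1) by (meson le_SucI)
  show "\<And>i j i' j'. (i, j) \<in> C \<Longrightarrow> (i', j') \<in> C \<Longrightarrow> (i, j) \<noteq> (i', j') \<Longrightarrow>
      i \<noteq> i' \<and> i \<noteq> j' \<and> j \<noteq> i' \<and> j \<noteq> j'" by (rule D(2))
  show "\<And>i j i' j'. (i, j) \<in> C \<Longrightarrow> (i', j') \<in> C \<Longrightarrow> i < i' \<Longrightarrow> i' < j \<Longrightarrow> j < j' \<Longrightarrow> False"
    by (meson D(3))
  fix i j v assume ij: "(i, j) \<in> C" and v: "v \<in> {1..Suc r}" "i < v" "v < j"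
  then have "v \<in> {1..r}" using D(1)[OF ij] by auto
  then show "v \<in> endpoints C" using D(4)[OF ij] v by blast
qed

lemma half_crossingless_add_half_cup:
  assumes "half_crossingless r C H"
  shows "half_crossingless (Suc r) C (insert (Suc r) H)"
    "ray_vertices (Suc r) (C, insert (Suc r) H) = ray_vertices r (C, H)"
    "Suc r \<notin> H"
proof -
  have c: "crossingless r C" and H: "H \<subseteq> {1..r} - endpoints C"
    and hv: "\<And>h v. h \<in> H \<Longrightarrow> v \<in> {1..r} \<Longrightarrow> h < v \<Longrightarrow> v \<in> endpoints C \<union> H"
    using assms unfolding half_crossingless_def by auto
  have n: "Suc r \<notin> endpoints C" using crossinglessD(6)[OF c] by auto
  have Hs: "insert (Suc r) H \<subseteq> {1..Suc r} - endpoints C" using H n by auto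
  have "v \<in> endpoints C \<union> insert (Suc r) H" if "h \<in> insert (Suc r) H" "v \<in> {1..Suc r}" "h < v" for h v
  proof (cases "v = Suc r")
    case False
    then have "v \<in> {1..r}" "h \<in> H" using that by auto
    then show ?thesis using hv that(3) by auto
  qed simp
  then show "half_crossingless (Suc r) C (insert (Suc r) H)"
    unfolding half_crossingless_def using crossingless_Suc[OF c] Hs by blast
  show "ray_vertices (Suc r) (C, insert (Suc r) H) = ray_vertices r (C, H)"
    unfolding ray_vertices_endpoints by (auto simp: le_Suc_eq)
  show "Suc r \<notin> H" using H by auto
qed

text \<open>Half-cups are excluded because the new ray would lie to their right.\<close>

lemma half_crossingless_add_ray:
  assumes "half_crossingless r C {}"
  shows "half_crossingless (Suc r) C {}"
    "ray_vertices (Suc r) (C, {}) = insert (Suc r) (ray_vertices r (C, {}))"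
    "Suc r \<notin> ray_vertices r (C, {})"
proof -
  have c: "crossingless r C" using assms unfolding half_crossingless_def by auto
  have n: "Suc r \<notin> endpoints C" using crossinglessD(6)[OF c] by auto
  show "half_crossingless (Suc r) C {}" unfolding half_crossingless_def using crossingless_Suc[OF c] by simp
  show "ray_vertices (Suc r) (C, {}) = insert (Suc r) (ray_vertices r (C, {}))"
    unfolding ray_vertices_endpoints using n by (auto simp: le_Suc_eq)
  show "Suc r \<notin> ray_vertices r (C, {})" unfolding ray_vertices_endpoints by simp
qed

text \<open>No ray and no further half-cup may follow, so the remaining vertices carry cups; a cup
  over \<open>i\<close> would force \<open>i\<close> to be an endpoint.\<close>

lemma half_crossingless_after_last_half_cup:
  assumes "half_crossingless r C H" "i \<in> H" "\<forall>h\<in>H. h \<le> i"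
  shows "{i<..r} \<subseteq> endpoints C" "uncrossed i C" "uncrossed (i - 1) C" "i \<in> {1..r}" "i \<notin> endpoints C"
proof -
  have c: "crossingless r C" and H: "H \<subseteq> {1..r} - endpoints C"
    and hv: "\<And>h v. h \<in> H \<Longrightarrow> v \<in> {1..r} \<Longrightarrow> h < v \<Longrightarrow> v \<in> endpoints C \<union> H"
    using assms(1) unfolding half_crossingless_def by auto
  show i: "i \<in> {1..r}" "i \<notin> endpoints C" using H assms(2) by auto
  show "{i<..r} \<subseteq> endpoints C"
  proof
    fix v assume v: "v \<in> {i<..r}"
    then have "v \<in> endpoints C \<union> H" using hv[OF assms(2), of v] by auto
    then show "v \<in> endpoints C" using assms(3) v by auto
  qed
  have "\<not> (a \<le> i \<and> i < b)" "\<not> (a \<le> i - 1 \<and> i - 1 < b)" if ab: "(a, b) \<in> C" for a b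
  proof -
    have ne: "a \<noteq> i" "b \<noteq> i" using ab i(2) endpointsI by auto
    have "\<not> (a < i \<and> i < b)" using crossinglessD(4)[OF c ab i(1)] i(2) by auto
    then show "\<not> (a \<le> i \<and> i < b)" "\<not> (a \<le> i - 1 \<and> i - 1 < b)" using ne i(1) by auto
  qed
  then show "uncrossed i C" "uncrossed (i - 1) C" unfolding uncrossed_def by blast+
qed

text \<open>An arc from the rightmost half-cup to the new vertex covers only vertices that are
  matched among themselves. Starting at any other half-cup would leave a half-cup below the
  arc.\<close>

lemma half_crossingless_close_cup:
  assumes hc: "half_crossingless r C H" and i: "i \<in> H" "\<forall>h\<in>H. h \<le> i"
  shows "half_crossingless (Suc r) (insert (i, Suc r) C) (H - {i})"
    "ray_vertices (Suc r) (insert (i, Suc r) C, H - {i}) = ray_vertices r (C, H)"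
    "(i, Suc r) \<notin> C"
proof -
  have c: "crossingless r C" and H: "H \<subseteq> {1..r} - endpoints C"
    and hv: "\<And>h v. h \<in> H \<Longrightarrow> v \<in> {1..r} \<Longrightarrow> h < v \<Longrightarrow> v \<in> endpoints C \<union> H"
    using hc unfolding half_crossingless_def by auto
  note D = crossinglessD[OF c]
  note L = half_crossingless_after_last_half_cup[OF assms]
  let ?C = "insert (i, Suc r) C"
  have e: "endpoints ?C = insert i (insert (Suc r) (endpoints C))" unfolding endpoints_def by auto
  have ne: "a \<noteq> i \<and> b \<noteq> i \<and> a \<noteq> Suc r \<and> b \<noteq> Suc r" if "(a, b) \<in> C" for a b
    using endpointsI[OF that] L(5) D(1)[OF that] by auto
  have "crossingless (Suc r) ?C"
  proof (rule crossinglessI)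
    fix a b assume "(a, b) \<in> ?C"
    then show "1 \<le> a \<and> a < b \<and> b \<le> Suc r" using D(1)[of a b] L(4) by auto
  next
    fix a b a' b' assume "(a, b) \<in> ?C" "(a', b') \<in> ?C" "(a, b) \<noteq> (a', b')"
    then show "a \<noteq> a' \<and> a \<noteq> b' \<and> b \<noteq> a' \<and> b \<noteq> b'" using D(2)[of a b a' b'] ne[of a b] ne[of a' b'] by auto
  next
    fix a b a' b' assume ab: "(a, b) \<in> ?C" "(a', b') \<in> ?C" and l: "a < a'" "a' < b" "b < b'"
    have "b \<noteq> Suc r"
    proof
      assume "b = Suc r"
      then show False using l(3) ab(2) D(1)[of a' b'] by auto
    qed
    then have 1: "(a, b) \<in> C" using ab by auto
    show False
    proof (cases "(a', b') = (i, Suc r)")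
      case True
      then show False using uncrossedD[OF L(2) 1] l by auto
    next
      case False
      then show False using D(3)[OF 1, of a' b'] ab(2) l by auto
    qed
  next
    fix a b v assume ab: "(a, b) \<in> ?C" and v: "v \<in> {1..Suc r}" "a < v" "v < b"
    show "v \<in> endpoints ?C"
    proof (cases "(a, b) = (i, Suc r)")
      case True
      then have "v \<in> {i<..r}" using v by auto
      then show ?thesis using L(1) e by auto
    next
      case False
      then have "(a, b) \<in> C" using ab by auto
      then show ?thesis using D(4)[of a b v] D(1)[of a b] v e by auto
    qed
  qed
  moreover have "H - {i} \<subseteq> {1..Suc r} - endpoints ?C" unfolding e using H by auto
  moreover have "v \<in> endpoints ?C \<union> (H - {i})" if "h \<in> H - {i}" "v \<in> {1..Suc r}" "h < v" for h v
    using hv[of h v] that unfolding e by (cases "v = Suc r") auto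
  ultimately show "half_crossingless (Suc r) ?C (H - {i})" unfolding half_crossingless_def by blast
  show "ray_vertices (Suc r) (?C, H - {i}) = ray_vertices r (C, H)"
    unfolding ray_vertices_endpoints e using i(1) by (auto simp: le_Suc_eq)
  show "(i, Suc r) \<notin> C" using D(1)[of i "Suc r"] by auto
qed

lemma ray_vertices_le: "v \<in> ray_vertices r D \<Longrightarrow> v \<le> r"
  unfolding ray_vertices_def by auto

text \<open>The vector \<open>w\<close> has height exactly \<open>a\<close>: the kernel of the power
  \<open>a - 1\<close> is the block with both indices \<open>a - 1\<close>, whose intersection with
  \<open>block N a b\<close> lies in the smaller block that \<open>w\<close> avoids.\<close>

lemma zpow_notin_zero:
  assumes "w \<in> block N a b" "a \<le> N" "b \<le> a" "0 < a" "a = b \<and> w \<notin> block N (a - 1) (b - 1) \<or> b < a \<and> w \<notin> block N (a - 1) b"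
  shows "(zmat N ^\<^sub>m (a - 1)) *\<^sub>v w \<noteq> 0\<^sub>v (2 * N)" "(zmat N ^\<^sub>m a) *\<^sub>v w = 0\<^sub>v (2 * N)"
proof -
  show "(zmat N ^\<^sub>m a) *\<^sub>v w = 0\<^sub>v (2 * N)"
    using zpow_block[OF assms(1,2), of a] assms by (simp add: block_00)
  show "(zmat N ^\<^sub>m (a - 1)) *\<^sub>v w \<noteq> 0\<^sub>v (2 * N)"
  proof
    assume "(zmat N ^\<^sub>m (a - 1)) *\<^sub>v w = 0\<^sub>v (2 * N)"
    then have "(zmat N ^\<^sub>m (a - 1)) *\<^sub>v w \<in> block N 0 0" by (simp add: block_00)
    then have w: "w \<in> block N (a - 1) (a - 1)"
      using zpow_in_block[OF block_carrier[OF assms(1)], of "a - 1" 0 0] assms(2) by simp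
    then have "w \<in> block N (min (a - 1) a) (min (a - 1) b)"
      by (intro subsetD[OF block_Int] IntI) (use assms in auto)
    then have "w \<in> block N (a - 1) (min (a - 1) b)" by (simp add: min_def)
    then show False using w assms(5) block_mono[of "a - 1" "a - 1" "min (a - 1) b" b N] by auto
  qed
qed

text \<open>The last vertex \<open>r\<close> becomes a half-cup, a ray or the right end of a cup that starts at the
  last half-cup of the diagram on \<open>r - 1\<close> vertices, according to the position of
  \<open>F\<^bsub>r-1\<^esub>\<close>.  In the third case \<open>F\<^sub>r\<close> is spanned by \<open>F\<^bsub>r-1\<^esub>\<close> and the image of
  the block under \<open>z\<^sup>h\<close>, so it is determined by \<open>F\<^bsub>r-1\<^esub>\<close>.\<close>

lemma ex_component:
  assumes "nflag (2 * N) (zmat N) r G" "r \<le> N" "a \<le> N" "b \<le> a" "h \<le> b" "a + b = r + h"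
    and "G r \<subseteq> block N a b" "a = b \<or> \<not> G r \<subseteq> block N (a - 1) b"
  shows "\<exists>C H. half_crossingless r C H \<and> card H = h \<and> card C + h = b \<and> fits N r (C, H) G"
  using assms
proof (induction r arbitrary: a b h)
  case 0
  then have z: "a = 0" "b = 0" "h = 0" by linarith+
  have "crossingless 0 {}" by (rule crossinglessI) auto
  then have "half_crossingless 0 {} {}" unfolding half_crossingless_def by auto
  moreover have "fits N 0 ({}, {}) G" unfolding fits_def ray_vertices_def by auto
  ultimately show ?case using z by (intro exI[of _ "{}"]) auto
next
  case (Suc r)
  note fl = Suc.prems(1)
  have bN: "b \<le> N" and r1: "r \<le> Suc r" "r \<le> N" using Suc.prems by auto
  have flr: "nflag (2 * N) (zmat N) r G" using nflag_le[OF fl r1(1)] .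
  have sub: "G r \<subseteq> G (Suc r)" using nflag_mono[OF fl r1(1)] by simp
  note dimr = nflag_dim[OF fl r1(1)] and dimS = nflag_dim[OF fl order_refl]
  note invr = nflag_invariant[OF fl zmat_carrier r1(1)] and invS = nflag_invariant[OF fl zmat_carrier order_refl]
  have a0: "0 < a" using Suc.prems by linarith
  have zS: "zmat N *\<^sub>v w \<in> G r" if "w \<in> G (Suc r)" for w using nflag_mult[OF fl zmat_carrier _ that] by simp
  note sr = order_trans[OF sub Suc.prems(7)]
  have dimle: "r \<le> a' + b'" if "G r \<subseteq> block N a' b'" "a' \<le> N" "b' \<le> N" for a' b'
    using subspace_of_dim_mono[OF dimr subspace_of_dim_block that(1)] that by simp
  consider (half) "h \<ge> 1" "G r \<subseteq> block N (a - 1) (b - 1)"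
    | (ray) "h = 0" "b < a" "G r \<subseteq> block N (a - 1) b"
    | (cup) "\<not> (h \<ge> 1 \<and> G r \<subseteq> block N (a - 1) (b - 1))" "\<not> (h = 0 \<and> b < a \<and> G r \<subseteq> block N (a - 1) b)"
    by blast
  then show ?case
  proof cases
    case half
    \<comment> \<open>Minimality survives: a vector of \<open>G (Suc r)\<close> with nonzero
      \<open>e\<close> coordinate number \<open>a\<close> is sent by \<open>z\<close> into
      \<open>G r\<close>, with nonzero coordinate number \<open>a - 1\<close>.\<close>
    have "a - 1 = b - 1 \<or> \<not> G r \<subseteq> block N (a - 1 - 1) (b - 1)"
    proof (cases "a = b")
      case False
      then obtain w where w: "w \<in> G (Suc r)" "w \<notin> block N (a - 1) b" using Suc.prems(8) by auto
      have wc: "w \<in> carrier_vec (2 * N)" using w(1) Suc.prems(7) block_carrier by auto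
      have "zmat N *\<^sub>v w \<notin> block N (a - 1 - 1) (b - 1)"
      proof
        assume "zmat N *\<^sub>v w \<in> block N (a - 1 - 1) (b - 1)"
        then have "(zmat N ^\<^sub>m 1) *\<^sub>v w \<in> block N (a - 1 - 1) (b - 1)" using zmat_carrier by simp
        then have "w \<in> block N (a - 1 - 1 + 1) (b - 1 + 1)"
          using zpow_in_block[OF wc, of 1 "a - 1 - 1" "b - 1"] Suc.prems half(1) by simp
        moreover have "a - 1 - 1 + 1 = a - 1" "b - 1 + 1 = b" using False Suc.prems half(1) by linarith+
        ultimately show False using w(2) by simp
      qed
      then show ?thesis using zS[OF w(1)] by auto
    qed simp
    moreover have "a - 1 \<le> N" "b - 1 \<le> a - 1" "h - 1 \<le> b - 1" "a - 1 + (b - 1) = r + (h - 1)"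
      using Suc.prems half(1) by linarith+
    ultimately obtain C H where CH: "half_crossingless r C H" "card H = h - 1" "card C + (h - 1) = b - 1"
      "fits N r (C, H) G"
      using Suc.IH[OF flr r1(2) _ _ _ _ half(2)] by blast
    note A = half_crossingless_add_half_cup[OF CH(1)]
    have "fits N (Suc r) (C, insert (Suc r) H) G" using CH(4) unfolding fits_def A(2) by simp
    moreover have "card (insert (Suc r) H) = h"
      using CH(2) A(3) half_crossingless_count(2)[OF CH(1)] half(1) by simp
    moreover have "card C + h = b" using CH(3) half(1) Suc.prems(5) by linarith
    ultimately show ?thesis using A(1) by blast
  next
    case ray
    \<comment> \<open>Here minimality is a dimension count: with first index \<open>a - 2\<close>
      the block has dimension \<open>r - 1\<close>.\<close>
    have "a - 1 = b \<or> \<not> G r \<subseteq> block N (a - 1 - 1) b"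
      using dimle[of "a - 1 - 1" b] Suc.prems ray by linarith
    moreover have "a - 1 \<le> N" "b \<le> a - 1" "0 \<le> b" "a - 1 + b = r + 0"
      using Suc.prems ray by linarith+
    ultimately have "\<exists>C H. half_crossingless r C H \<and> card H = 0 \<and> card C + 0 = b \<and> fits N r (C, H) G"
      using Suc.IH[OF flr r1(2) _ _ _ _ ray(3)] by blast
    then obtain C H where CH: "half_crossingless r C H" "card H = 0" "card C = b" "fits N r (C, H) G"
      by auto
    have H: "H = {}" using CH(2) half_crossingless_count(2)[OF CH(1)] by simp
    note A = half_crossingless_add_ray[OF CH(1)[unfolded H]]
    \<comment> \<open>For \<open>h = 0\<close> the dimensions agree, so two consecutive members are
      full blocks and differ by \<open>evec N a\<close>.\<close>
    have Gr: "G r = block N (a - 1) b"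
      using subspace_of_dim_eqI[OF dimr _ ray(3)] subspace_of_dim_block[of "a - 1" N b] Suc.prems ray by simp
    have "G (Suc r) = block N a b"
      using subspace_of_dim_eqI[OF dimS _ Suc.prems(7)] subspace_of_dim_block[of a N b] Suc.prems ray by simp
    then have GS: "G (Suc r) = add_line (G r) (evec N a)"
      unfolding Gr using block_add_evec[of "a - 1" N b] a0 Suc.prems(3) by simp
    have idx: "(Suc r + card {v \<in> ray_vertices (Suc r) (C, {}). v \<le> Suc r}) div 2 = a"
    proof -
      have "{v \<in> ray_vertices (Suc r) (C, {}). v \<le> Suc r} = ray_vertices (Suc r) (C, {})"
        using ray_vertices_le by blast
      then show ?thesis using half_crossingless_count(1)[OF A(1)] CH(3) Suc.prems(6) ray(1) by simp
    qed
    have "fits N (Suc r) (C, {}) G"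
      unfolding fits_def
    proof (intro conjI ballI)
      fix p assume "p \<in> fst (C, {} :: nat set)"
      then show "case p of (i, j) \<Rightarrow> G j = zpreim N ((j - i + 1) div 2) (G (i - 1))"
        by (intro bspec[OF conjunct1[OF CH(4)[unfolded fits_def fst_conv]]]) simp
    next
      fix v assume v: "v \<in> ray_vertices (Suc r) (C, {})"
      show "G v = add_line (G (v - 1)) (evec N ((v + card {y \<in> ray_vertices (Suc r) (C, {}). y \<le> v}) div 2))"
      proof (cases "v = Suc r")
        case True
        then show ?thesis using idx GS by simp
      next
        case False
        then have v': "v \<in> ray_vertices r (C, {})" using v A(2) by simp
        then have "{y \<in> ray_vertices (Suc r) (C, {}). y \<le> v} = {y \<in> ray_vertices r (C, {}). y \<le> v}"
          unfolding A(2) using ray_vertices_le[OF v'] by auto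
        then show ?thesis using bspec[OF conjunct2[OF CH(4)[unfolded fits_def H]] v'] by simp
      qed
    qed
    then show ?thesis using A(1) CH(3) ray(1) by (intro exI[of _ C] exI[of _ "{}"]) simp
  next
    case cup
    \<comment> \<open>In the remaining case \<open>G r\<close> contains a vector of the maximal
      height \<open>a\<close>.\<close>
    have gen: "a = b \<and> \<not> G r \<subseteq> block N (a - 1) (b - 1) \<or> b < a \<and> \<not> G r \<subseteq> block N (a - 1) b"
    proof (cases "a = b")
      case True
      \<comment> \<open>For \<open>h = 0\<close> the smaller block has dimension
        \<open>r - 1\<close>.\<close>
      have "\<not> G r \<subseteq> block N (a - 1) (b - 1)" if "h = 0"
        using dimle[of "a - 1" "b - 1"] that True Suc.prems by linarith
      then show ?thesis using cup(1) True by linarith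
    next
      case False
      then have ba: "b < a" using Suc.prems by simp
      have "\<not> G r \<subseteq> block N (a - 1) b"
      proof
        assume s: "G r \<subseteq> block N (a - 1) b"
        then have h: "h \<ge> 1" using cup(2) ba by simp
        then obtain u where u: "u \<in> G r" "u \<notin> block N (a - 1) (b - 1)" using cup(1) by auto
        obtain w where w: "w \<in> G (Suc r)" "w \<notin> block N (a - 1) b" using Suc.prems(8) False by auto
        \<comment> \<open>\<open>w\<close> has a nonzero top \<open>e\<close> coordinate and
          \<open>u\<close> a nonzero top \<open>f\<close> coordinate, so together they generate the
          block; its dimension \<open>Suc r + h\<close> is too large, as
          \<open>h \<ge> 1\<close>.\<close>
        have "block N a b \<subseteq> G (Suc r)"
          using block_subset_of_two_generators[OF nflag_lin_subspace[OF fl order_refl] invS Suc.prems(3) bN ba _ w(1) _ w(2)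
              _ _ u(2)] u(1) w(1) sub s Suc.prems h by auto
        then have "a + b \<le> Suc r"
          using subspace_of_dim_mono[OF subspace_of_dim_block[OF Suc.prems(3) bN] dimS] by simp
        then show False using Suc.prems(6) h by simp
      qed
      then show ?thesis using ba by simp
    qed
    then obtain w where w: "w \<in> G r"
      "a = b \<and> w \<notin> block N (a - 1) (b - 1) \<or> b < a \<and> w \<notin> block N (a - 1) b" by blast
    have wb: "w \<in> block N a b" using w(1) sr by auto
    note zw = zpow_notin_zero[OF wb Suc.prems(3,4) a0 w(2)]
    have z0: "mat_invariant (zmat N) {0\<^sub>v (2 * N)}"
      using mat_invariant_block[of 0 N 0] by (simp add: block_00)
    \<comment> \<open>The chain below \<open>w\<close> has \<open>a\<close> independent members in
      \<open>G r\<close>. With \<open>a + b = Suc r + h\<close> this leaves room for one more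
      half-cup.\<close>
    have "0 + a \<le> r"
      by (rule dim_cyclic_extension[OF zmat_carrier dimr invr w(1) subspace_of_dim_0 z0])
        (use zw lin_subspaceD(2)[OF nflag_lin_subspace[OF fl r1(1)]] in auto)
    then have hb: "h + 1 \<le> b" using Suc.prems(6) by linarith
    have "a = b \<or> \<not> G r \<subseteq> block N (a - 1) b" using gen by blast
    \<comment> \<open>The block is kept while a vertex is removed, so the codimension, and with it
      the number of half-cups, goes up by one.\<close>
    then obtain C H where CH: "half_crossingless r C H" "card H = h + 1" "card C + (h + 1) = b" "fits N r (C, H) G"
      using Suc.IH[OF flr r1(2) Suc.prems(3,4) hb _ sr] Suc.prems(6) by auto
    note finH = half_crossingless_count(2)[OF CH(1)]
    define i where "i = Max H"
    have "H \<noteq> {}" using CH(2) by auto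
    then have i: "i \<in> H" "\<forall>h\<in>H. h \<le> i" unfolding i_def using finH by auto
    note L = half_crossingless_after_last_half_cup[OF CH(1) i]
    note A = half_crossingless_close_cup[OF CH(1) i]
    have ir: "1 \<le> i" "i \<le> r" using L(4) by auto
    have seg: "G r = zpreim N ((r - i) div 2) (G i)" "even (r - i)"
      using fits_cupped_segment[OF CH(1,4) flr ir(2) L(1,2)] by auto
    \<comment> \<open>Half the number of vertices from \<open>i\<close> to \<open>Suc r\<close>,
      which is the power of \<open>z\<close> in the condition of the new cup.\<close>
    define t where "t = Suc ((r - i) div 2)"
    have t: "r = i + 2 * (t - 1)" "t \<ge> 1" unfolding t_def using seg(2) ir by auto
    have cross: "crossingless r C" using CH(1) unfolding half_crossingless_def by simp
    let ?C = "{(x, y) \<in> C. y \<le> i - 1}"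
    have le: "i - 1 \<le> r" using ir by simp
    note R = half_crossingless_restrict[OF CH(1) le L(3)]
    let ?H = "{h \<in> H. h \<le> i - 1}"
    have cH: "card ?H = h"
    proof -
      have "?H = H - {i}" using i(2) ir by (force simp: le_less)
      then show ?thesis using CH(2) i(1) finH by simp
    qed
    have cC: "card C = card ?C + (t - 1)"
    proof -
      have "{(x, y) \<in> C. y \<le> r} = C" using crossinglessD(1)[OF cross] by auto
      moreover have "uncrossed r C" unfolding uncrossed_def using crossinglessD(1)[OF cross] by (clarify) (metis leD)
      moreover have "{(x, y) \<in> C. y \<le> i} = ?C"
      proof -
        have "y \<le> i \<longleftrightarrow> y \<le> i - 1" if "(x, y) \<in> C" for x y
          using endpointsI(2)[OF that] L(5) ir by (cases "y = i") auto
        then show ?thesis by auto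
      qed
      ultimately show ?thesis
        using card_cups_inside(2)[OF cross L(1) order_refl ir(2) L(2)] t(1) unfolding t_def by simp
    qed
    have cnt: "2 * card ?C + h \<le> i - 1" using half_crossingless_count(1)[OF R(2)] cH by linarith
    \<comment> \<open>\<open>G (i - 1)\<close> has codimension \<open>h\<close> in the bound given
      by the truncated diagram, and the indices of that bound are \<open>a - t\<close> and
      \<open>b - t\<close>.\<close>
    have low: "block N (a - h - t) (b - h - t) \<subseteq> G (i - 1)"
    proof -
      have fi: "nflag (2 * N) (zmat N) (i - 1) G" using nflag_le[OF flr le] .
      have iN: "i - 1 \<le> N" using ir Suc.prems(2) by simp
      have up: "G (i - 1) \<subseteq> block N (i - 1 - card ?C) (card ?C + h)"
        using fits_upper_bound[OF R(2) R(4)[OF CH(4)] fi iN] cH by simp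
      have "block N (i - 1 - card ?C - h) (card ?C + h - h) \<subseteq> G (i - 1)"
        using iN cnt
        by (intro block_subset_of_codim[OF nflag_dim[OF fi order_refl]
              nflag_invariant[OF fi zmat_carrier order_refl] up]) linarith+
      moreover have "a - h - t = i - 1 - card ?C - h" "b - h - t = card ?C + h - h"
        using CH(3) cC t Suc.prems(6) cnt hb ir by linarith+
      ultimately show ?thesis by simp
    qed
    \<comment> \<open>Otherwise \<open>w\<close> would contribute \<open>h\<close> further
      dimensions to this block inside \<open>G r\<close>, which makes
      \<open>a + b - h = Suc r\<close> in total.\<close>
    have "\<not> block N (a - h) (b - h) \<subseteq> G r"
    proof
      assume s: "block N (a - h) (b - h) \<subseteq> G r"
      have hN: "a - h \<le> N" "b - h \<le> N" using Suc.prems(3) bN by linarith+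
      have "(a - h) + (b - h) + h \<le> r"
      proof (rule dim_cyclic_extension[OF zmat_carrier dimr invr w(1) subspace_of_dim_block[OF hN]
            mat_invariant_block[OF hN] s])
        show "(zmat N ^\<^sub>m h) *\<^sub>v w \<in> block N (a - h) (b - h)" using zpow_block[OF wb Suc.prems(3) bN] .
        assume h: "0 < h"
        show "(zmat N ^\<^sub>m (h - 1)) *\<^sub>v w \<notin> block N (a - h) (b - h)"
        proof
          assume "(zmat N ^\<^sub>m (h - 1)) *\<^sub>v w \<in> block N (a - h) (b - h)"
          \<comment> \<open>The power \<open>a - h\<close> kills the block, as
            \<open>b \<le> a\<close>, whereas the power \<open>a - 1\<close> does not kill
            \<open>w\<close>.\<close>
          then have "(zmat N ^\<^sub>m (a - h)) *\<^sub>v ((zmat N ^\<^sub>m (h - 1)) *\<^sub>v w)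
              \<in> block N (a - h - (a - h)) (b - h - (a - h))" using zpow_block hN by blast
          moreover have "a - h + (h - 1) = a - 1" "b - h - (a - h) = 0" using h hb Suc.prems(4) by linarith+
          ultimately have "(zmat N ^\<^sub>m (a - 1)) *\<^sub>v w \<in> block N 0 0"
            using zpow(5)[OF block_carrier[OF wb], of "a - h" "h - 1"] by simp
          then show False using zw(1) by (simp add: block_00)
        qed
      qed
      then show False using Suc.prems(4,6) hb by linarith
    qed
    then obtain x where x: "x \<in> block N (a - h) (b - h)" "x \<notin> G r" by blast
    \<comment> \<open>By codimension \<open>h\<close> the same block does lie in the next member, so
      \<open>x\<close> spans the new step.\<close>
    have "block N (a - h) (b - h) \<subseteq> G (Suc r)"
      using block_subset_of_codim[OF dimS invS Suc.prems(7,3) bN Suc.prems(6)] .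
    then have GS: "G (Suc r) = add_line (G r) x"
      using subspace_of_dim_step[OF dimr dimS sub _ x(2)] x(1) by auto
    have iN: "i - 1 + t \<le> N" using t ir Suc.prems(2) by linarith
    have dimi: "subspace_of_dim (2 * N) (i - 1 + 2 * t) (zpreim N t (G (i - 1)))"
      using subspace_of_dim_zpreim[OF nflag_dim[OF flr le] nflag_block[OF flr le] iN] iN by simp
    have "i - 1 + 2 * t = Suc r" using t ir by linarith
    note dimi = dimi[unfolded this]
    have "G (Suc r) \<subseteq> zpreim N t (G (i - 1))"
      unfolding GS
    proof (rule add_line_subset[OF subspace_of_dim_lin_subspace[OF dimi]])
      show "G r \<subseteq> zpreim N t (G (i - 1))"
      proof
        fix y assume y: "y \<in> G r"
        then have yc: "y \<in> carrier_vec (2 * N)" "(zmat N ^\<^sub>m (t - 1)) *\<^sub>v y \<in> G i"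
          using seg(1) unfolding zpreim_def t_def by auto
        have "zmat N *\<^sub>v ((zmat N ^\<^sub>m (t - 1)) *\<^sub>v y) \<in> G (i - 1)"
          using nflag_mult[OF flr zmat_carrier ir(2) yc(2)] .
        then show "y \<in> zpreim N t (G (i - 1))"
          using zpow(4)[OF yc(1), of "t - 1"] t(2) yc(1) unfolding zpreim_def by simp
      qed
      have "(zmat N ^\<^sub>m t) *\<^sub>v x \<in> block N (a - h - t) (b - h - t)"
        using zpow_block[OF x(1)] Suc.prems(3) bN by simp
      then show "x \<in> zpreim N t (G (i - 1))" using low block_carrier[OF x(1)] unfolding zpreim_def by auto
    qed
    \<comment> \<open>Both spaces have dimension \<open>Suc r\<close>: the preimage gains
      \<open>2 * t\<close> over \<open>i - 1\<close>.\<close>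
    then have GS': "G (Suc r) = zpreim N t (G (i - 1))" using subspace_of_dim_eqI[OF dimS dimi] by simp
    have td: "(Suc r - i + 1) div 2 = t" using t ir by simp
    have "fits N (Suc r) (insert (i, Suc r) C, H - {i}) G"
      unfolding fits_def A(2)
    proof (intro conjI ballI)
      fix p assume p: "p \<in> fst (insert (i, Suc r) C, H - {i})"
      show "case p of (i, j) \<Rightarrow> G j = zpreim N ((j - i + 1) div 2) (G (i - 1))"
      proof (cases "p = (i, Suc r)")
        case True
        then show ?thesis using GS' td by simp
      next
        case False
        then have "p \<in> C" using p by simp
        then show ?thesis by (rule bspec[OF conjunct1[OF CH(4)[unfolded fits_def fst_conv]]])
      qed
    next
      fix v assume "v \<in> ray_vertices r (C, H)"
      then show "G v = add_line (G (v - 1)) (evec N ((v + card {y \<in> ray_vertices r (C, H). y \<le> v}) div 2))"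
        by (rule bspec[OF conjunct2[OF CH(4)[unfolded fits_def]]])
    qed
    moreover have "card (H - {i}) = h" using CH(2) i(1) finH by simp
    moreover have "card (insert (i, Suc r) C) + h = b"
      using A(3) half_crossingless_count(3)[OF CH(1)] CH(3) by simp
    ultimately show ?thesis using A(1) by blast
  qed
qed

section \<open>Cutting cup diagrams\<close>

text \<open>Distinct half-cups come from cups with distinct right ends among the last
  \<open>m\<close> vertices, which bounds their number by \<open>m\<close>.\<close>

lemma half_crossingless_cut_diagram:
  assumes a: "a \<in> cup_diagrams n k m" and m: "m \<le> n"
    and CH: "cut_diagram (n - m) a = (C, H)"
  shows "half_crossingless (n - m) C H" "card C + card H = k" "card H \<le> m"
proof -
  let ?q = "n - m"
  have c: "crossingless n a" and ca: "card a = k" and last: "\<And>v. v \<in> {n - m + 1..n} \<Longrightarrow> v \<notin> fst ` a"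
    using a unfolding cup_diagrams_def by auto
  note D = crossinglessD[OF c]
  have C: "C = {(i, j) \<in> a. j \<le> ?q}" and H: "H = {i. i \<le> ?q \<and> (\<exists>j>?q. (i, j) \<in> a)}"
    using CH unfolding cut_diagram_def by auto
  have iC: "(i, j) \<in> C \<longleftrightarrow> (i, j) \<in> a \<and> j \<le> ?q" for i j unfolding C by simp
  have eC: "v \<in> endpoints C \<union> H" if v: "v \<in> endpoints a" "v \<le> ?q" for v
  proof -
    obtain i j where ij: "(i, j) \<in> a" "v = i \<or> v = j" using v(1) unfolding endpoints_iff by auto
    show ?thesis
    proof (cases "j \<le> ?q")
      case True
      then show ?thesis using ij iC[of i j] endpointsI[of i j C] by auto
    next
      case False
      then show ?thesis using ij v(2) unfolding H by auto
    qed
  qed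
  have HC: "v \<notin> endpoints C" if v: "v \<in> H" for v
  proof
    assume "v \<in> endpoints C"
    then obtain i j where ij: "(i, j) \<in> a" "j \<le> ?q" "v = i \<or> v = j" unfolding endpoints_iff iC by auto
    obtain j' where "(v, j') \<in> a" "?q < j'" using v unfolding H by auto
    then show False using D(2)[OF ij(1), of v j'] ij(2,3) by auto
  qed
  have "crossingless ?q C"
  proof (rule crossinglessI)
    show "\<And>i j. (i, j) \<in> C \<Longrightarrow> 1 \<le> i \<and> i < j \<and> j \<le> ?q" using D(1) unfolding iC by auto
  next
    fix i j i' j' assume "(i, j) \<in> C" "(i', j') \<in> C" "(i, j) \<noteq> (i', j')"
    then show "i \<noteq> i' \<and> i \<noteq> j' \<and> j \<noteq> i' \<and> j \<noteq> j'" using D(2)[of i j i' j'] unfolding iC by blast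
  next
    fix i j i' j' assume "(i, j) \<in> C" "(i', j') \<in> C" "i < i'" "i' < j" "j < j'"
    then show False using D(3)[of i j i' j'] unfolding iC by blast
  next
    fix i j v assume ij: "(i, j) \<in> C" and v: "v \<in> {1..?q}" "i < v" "v < j"
    have "v \<in> endpoints a" using D(4)[of i j v] ij v unfolding iC by auto
    then have "v \<in> endpoints C \<union> H" using eC v(1) by auto
    \<comment> \<open>A half-cup below a cup of \<open>C\<close> would come from an arc crossing
      that cup.\<close>
    moreover have "v \<notin> H"
    proof
      assume "v \<in> H"
      then obtain j' where "(v, j') \<in> a" "?q < j'" unfolding H by auto
      then show False using D(3)[of i j v j'] ij v unfolding iC by auto
    qed
    ultimately show "v \<in> endpoints C" by simp
  qed
  moreover have "H \<subseteq> {1..?q} - endpoints C"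
  proof
    fix v assume v: "v \<in> H"
    then obtain j' where "(v, j') \<in> a" "v \<le> ?q" unfolding H by auto
    then show "v \<in> {1..?q} - endpoints C" using D(1)[of v j'] HC[OF v] by auto
  qed
  moreover have "v \<in> endpoints C \<union> H" if h: "h \<in> H" and v: "v \<in> {1..?q}" "h < v" for h v
  proof -
    obtain j where j: "(h, j) \<in> a" "?q < j" using h unfolding H by auto
    then show ?thesis using eC D(4)[OF j(1), of v] v by auto
  qed
  ultimately show "half_crossingless ?q C H" unfolding half_crossingless_def by blast
  let ?D = "{(i, j) \<in> a. ?q < j}"
  \<comment> \<open>No left endpoint lies beyond the cut, so every cup is either kept or becomes a
    half-cup and none is lost.\<close>
  have le: "i \<le> ?q" if "(i, j) \<in> a" for i j
  proof (rule ccontr)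
    assume "\<not> i \<le> ?q"
    then have "i \<in> {n - m + 1..n}" using D(1)[OF that] by auto
    then show False using last[of i] that by force
  qed
  have Da: "?D \<subseteq> a" and Ca: "C \<subseteq> a" unfolding C by blast+
  note finD = finite_subset[OF Da D(5)] and finC = finite_subset[OF Ca D(5)]
  have img: "fst ` ?D = H"
  proof (intro equalityI subsetI)
    fix v assume "v \<in> fst ` ?D"
    then obtain j where "(v, j) \<in> a" "?q < j" by auto
    then show "v \<in> H" unfolding H using le[of v j] by blast
  next
    fix v assume "v \<in> H"
    then obtain j where "(v, j) \<in> ?D" unfolding H by auto
    then show "v \<in> fst ` ?D" by force
  qed
  have "inj_on fst ?D" using crossingless_inj_on(1)[OF c] Da by (rule inj_on_subset)
  from card_image[OF this] have cH: "card H = card ?D" unfolding img .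
  have un: "C \<union> ?D = a" and dj: "C \<inter> ?D = {}" unfolding C by auto
  show "card C + card H = k" using card_Un_disjoint[OF finC finD dj] unfolding un cH ca by simp
  have "inj_on snd ?D" using crossingless_inj_on(2)[OF c] Da by (rule inj_on_subset)
  moreover have "snd ` ?D \<subseteq> {?q<..n}"
  proof
    fix j assume "j \<in> snd ` ?D"
    then obtain i where "(i, j) \<in> a" "?q < j" by auto
    then show "j \<in> {?q<..n}" using D(1)[of i j] by simp
  qed
  ultimately have "card ?D \<le> card {?q<..n}" by (rule card_inj_on_le) simp
  then show "card H \<le> m" using cH m by simp
qed

text \<open>The half-cups are closed by nested arcs to the vertices \<open>q + 1\<close>, ...,
  \<open>q + card H\<close>; any further vertices up to \<open>n\<close> carry rays.\<close>

lemma ex_cut_diagram: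
  assumes hc: "half_crossingless q C H" and n: "q + card H \<le> n"
  shows "\<exists>a\<in>cup_diagrams n (card C + card H) (n - q). cut_diagram q a = (C, H)"
proof -
  have c: "crossingless q C" and H: "H \<subseteq> {1..q} - endpoints C"
    and hv: "\<And>h v. h \<in> H \<Longrightarrow> v \<in> {1..q} \<Longrightarrow> h < v \<Longrightarrow> v \<in> endpoints C \<union> H"
    using hc unfolding half_crossingless_def by auto
  note D = crossinglessD[OF c]
  note fin = half_crossingless_count(2,3)[OF hc]
  \<comment> \<open>The number of half-cups further right decides the right end, so the rightmost
    half-cup gets \<open>q + 1\<close> and the order is reversed, which makes the arcs
    nested.\<close>
  define f where "f x = Suc (q + card {y \<in> H. x < y})" for x
  have anti: "f x' < f x" if "x \<in> H" "x' \<in> H" "x < x'" for x x'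
  proof -
    have "{y \<in> H. x' < y} \<subset> {y \<in> H. x < y}" using that by auto
    then show ?thesis unfolding f_def using fin(1) by (simp add: psubset_card_mono)
  qed
  have inj: "inj_on f H"
  proof (rule inj_onI, rule ccontr)
    fix x x' assume "x \<in> H" "x' \<in> H" "f x = f x'" "x \<noteq> x'"
    then show False using anti[of x x'] anti[of x' x] by (cases x x' rule: linorder_cases) auto
  qed
  have fr: "q < f x \<and> f x \<le> q + card H" if "x \<in> H" for x
  proof -
    have "{y \<in> H. x < y} \<subset> H" using that by auto
    from psubset_card_mono[OF fin(1) this] show ?thesis unfolding f_def by simp
  qed
  have img: "f ` H = {q<..q + card H}"
  proof (rule card_subset_eq)
    show "f ` H \<subseteq> {q<..q + card H}" using fr by auto
    show "card (f ` H) = card {q<..q + card H}" using card_image[OF inj] by simp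
  qed simp
  define a where "a = C \<union> (\<lambda>x. (x, f x)) ` H"
  have ia: "(i, j) \<in> a \<longleftrightarrow> (i, j) \<in> C \<or> i \<in> H \<and> j = f i" for i j unfolding a_def by auto
  have ea: "endpoints a = endpoints C \<union> H \<union> {q<..q + card H}"
    unfolding img[symmetric] endpoints_def a_def by (auto simp: image_Un image_image)
  have Cq: "1 \<le> i \<and> i < j \<and> j \<le> q \<and> i \<notin> H \<and> j \<notin> H" if "(i, j) \<in> C" for i j
    using D(1)[OF that] endpointsI[OF that] H by auto
  have Hq: "1 \<le> x \<and> x \<le> q \<and> q < f x \<and> f x \<le> n" if "x \<in> H" for x
    using fr[OF that] that H n by auto
  have "crossingless n a"
  proof (rule crossinglessI)
    fix i j assume "(i, j) \<in> a"
    then show "1 \<le> i \<and> i < j \<and> j \<le> n" using Cq[of i j] Hq[of i] n unfolding ia by auto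
  next
    fix i j i' j' assume ij: "(i, j) \<in> a" "(i', j') \<in> a" "(i, j) \<noteq> (i', j')"
    then consider "(i, j) \<in> C" "(i', j') \<in> C" | "(i, j) \<in> C" "i' \<in> H" "j' = f i'"
      | "i \<in> H" "j = f i" "(i', j') \<in> C" | "i \<in> H" "j = f i" "i' \<in> H" "j' = f i'" unfolding ia by blast
    then show "i \<noteq> i' \<and> i \<noteq> j' \<and> j \<noteq> i' \<and> j \<noteq> j'"
    proof cases
      case 1
      then show ?thesis using D(2) ij(3) by blast
    next
      case 2
      then show ?thesis using Cq[of i j] Hq[of i'] by auto
    next
      case 3
      then show ?thesis using Cq[of i' j'] Hq[of i] by auto
    next
      case 4
      then have "i \<noteq> i'" using ij(3) by auto
      then have "f i \<noteq> f i'" using inj 4 by (auto dest: inj_onD)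
      then show ?thesis using 4 \<open>i \<noteq> i'\<close> Hq[of i] Hq[of i'] by auto
    qed
  next
    fix i j i' j' assume ij: "(i, j) \<in> a" "(i', j') \<in> a" and l: "i < i'" "i' < j" "j < j'"
    then consider "(i, j) \<in> C" "(i', j') \<in> C" | "(i, j) \<in> C" "i' \<in> H"
      | "i \<in> H" "j = f i" "(i', j') \<in> C" | "i \<in> H" "j = f i" "i' \<in> H" "j' = f i'" unfolding ia by blast
    then show False
    proof cases
      case 1
      then show ?thesis using D(3) l by blast
    next
      case 2
      \<comment> \<open>Every vertex below a cup is an endpoint, which a half-cup is not.\<close>
      then have "i' \<in> endpoints C" using D(4)[of i j i'] Hq[of i'] l by auto
      then show ?thesis using 2 H by auto
    next
      case 3
      then show ?thesis using Cq[of i' j'] Hq[of i] l by auto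
    next
      case 4
      then show ?thesis using anti[of i i'] l by auto
    qed
  next
    fix i j v assume ij: "(i, j) \<in> a" and v: "v \<in> {1..n}" "i < v" "v < j"
    show "v \<in> endpoints a"
    proof (cases "(i, j) \<in> C")
      case True
      then show ?thesis using D(4)[of i j v] Cq[of i j] v unfolding ea by auto
    next
      case False
      then have i: "i \<in> H" "j = f i" using ij unfolding ia by auto
      show ?thesis
      proof (cases "v \<le> q")
        case True
        then show ?thesis using hv[OF i(1), of v] v unfolding ea by auto
      next
        case False
        then show ?thesis using fr[OF i(1)] i(2) v(3) unfolding ea by auto
      qed
    qed
  qed
  moreover have "card a = card C + card H"
  proof -
    have "inj_on (\<lambda>x. (x, f x)) H" by (rule inj_onI) simp
    moreover have "C \<inter> (\<lambda>x. (x, f x)) ` H = {}" using Cq by auto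
    ultimately show ?thesis unfolding a_def using fin by (simp add: card_Un_disjoint card_image)
  qed
  moreover have "v \<notin> fst ` a" if "v \<in> {n - (n - q) + 1..n}" for v
  proof
    assume "v \<in> fst ` a"
    then obtain j where "(v, j) \<in> a" by auto
    then have "v \<le> q" using Cq[of v j] Hq[of v] unfolding ia by auto
    then show False using that n by auto
  qed
  ultimately have "a \<in> cup_diagrams n (card C + card H) (n - q)" unfolding cup_diagrams_def by blast
  moreover have "cut_diagram q a = (C, H)"
  proof -
    have "{(i, j) \<in> a. j \<le> q} = C"
    proof -
      have "(i, j) \<in> a \<and> j \<le> q \<longleftrightarrow> (i, j) \<in> C" for i j using Cq[of i j] Hq[of i] unfolding ia by auto
      then show ?thesis by auto
    qed
    moreover have "{i. i \<le> q \<and> (\<exists>j>q. (i, j) \<in> a)} = H"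
    proof -
      have "i \<le> q \<and> (\<exists>j>q. (i, j) \<in> a) \<longleftrightarrow> i \<in> H" for i
      proof
        assume "i \<le> q \<and> (\<exists>j>q. (i, j) \<in> a)"
        then obtain j where "q < j" "(i, j) \<in> a" by blast
        then show "i \<in> H" using Cq[of i j] unfolding ia by auto
      next
        assume "i \<in> H"
        then show "i \<le> q \<and> (\<exists>j>q. (i, j) \<in> a)" using Hq[of i] unfolding ia by auto
      qed
      then show ?thesis by auto
    qed
    ultimately show ?thesis unfolding cut_diagram_def by simp
  qed
  ultimately show ?thesis by blast
qed

section \<open>The embedded Delta-Springer variety as a union of components\<close>

lemma Yvar_iff: "F \<in> Yvar N r \<longleftrightarrow> length F = Suc r \<and> nflag (2 * N) (zmat N) r ((!) F)"
  unfolding Yvar_def nilp_flags_iff ..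

text \<open>The block has dimension \<open>n\<close>, so a member of dimension \<open>n - m\<close>
  has codimension \<open>m\<close> in it.\<close>

lemma Yvar_block_lower:
  assumes F: "F \<in> Yvar N (n - m)" and mkn: "m \<le> k" "k \<le> n div 2" "n < N"
    and sub: "F ! (n - m) \<subseteq> block N (n - k) k"
  shows "block N (n - k - m) (k - m) \<subseteq> F ! (n - m)"
proof -
  have fl: "nflag (2 * N) (zmat N) (n - m) ((!) F)" using F Yvar_iff by blast
  show ?thesis
    by (rule block_subset_of_codim[OF nflag_dim[OF fl order_refl]
          nflag_invariant[OF fl zmat_carrier order_refl] sub]) (use mkn in linarith)+
qed

lemma delta_springer_emb_eq:
  assumes "m \<le> k" "k \<le> n div 2" "n < N"
  shows "delta_springer_emb N n k m = {F \<in> Yvar N (n - m). F ! (n - m) \<subseteq> block N (n - k) k}"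
proof -
  have kN: "n - k \<le> N" "k \<le> N" using assms by linarith+
  have "(\<lambda>w. (zmat N ^\<^sub>m m) *\<^sub>v w) ` block N (n - k) k \<subseteq> F ! (n - m)"
    if "F \<in> Yvar N (n - m)" "F ! (n - m) \<subseteq> block N (n - k) k" for F
    using Yvar_block_lower[OF that(1) assms that(2)] zpow_block[OF _ kN] by blast
  then show ?thesis unfolding delta_springer_emb_def Espace_eq_block[OF kN] by blast
qed

theorem delta_springer_emb_components:
  assumes "m \<le> k" "k \<le> n div 2" "n < N"
  shows "delta_springer_emb N n k m =
    (\<Union>a\<in>cup_diagrams n k m. exotic_component N (n - m) (cut_diagram (n - m) a))"
  unfolding delta_springer_emb_eq[OF assms]
proof (intro equalityI subsetI)
  let ?q = "n - m"
  fix F assume F: "F \<in> {F \<in> Yvar N ?q. F ! ?q \<subseteq> block N (n - k) k}"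
  then have fl: "nflag (2 * N) (zmat N) ?q ((!) F)" using Yvar_iff by blast
  \<comment> \<open>The first index is lowered as far as the hypotheses of
    \<open>ex_component\<close> allow: \<open>k \<le> a\<close> keeps the first string the longer
    one, and \<open>n - k - m \<le> a\<close> keeps the codimension \<open>a + k - ?q\<close> free
    of truncation.\<close>
  define P where "P a \<longleftrightarrow> k \<le> a \<and> n - k - m \<le> a \<and> F ! ?q \<subseteq> block N a k" for a
  define a where "a = (LEAST a. P a)"
  have Pn: "P (n - k)" unfolding P_def using F assms by auto
  then have Pa: "P a" and an: "a \<le> n - k" unfolding a_def by (rule LeastI, rule Least_le)
  have a: "k \<le> a" "n - k - m \<le> a" "F ! ?q \<subseteq> block N a k" using Pa unfolding P_def by auto
  have aN: "a \<le> N" "k \<le> N" using an assms by linarith+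
  have "a = k \<or> \<not> F ! ?q \<subseteq> block N (a - 1) k"
  proof (rule ccontr)
    assume "\<not> (a = k \<or> \<not> F ! ?q \<subseteq> block N (a - 1) k)"
    then have s: "a \<noteq> k" "F ! ?q \<subseteq> block N (a - 1) k" by auto
    have "subspace_of_dim (2 * N) (a - 1 + k) (block N (a - 1) k)"
      by (rule subspace_of_dim_block) (use aN in auto)
    then have "?q \<le> a - 1 + k" using subspace_of_dim_mono[OF nflag_dim[OF fl order_refl] _ s(2)] by blast
    \<comment> \<open>The second bound in \<open>P\<close> is forced by dimension, so it cannot stop
      the descent.\<close>
    then have "n - k - m \<le> a - 1" using assms by linarith
    then have "P (a - 1)" unfolding P_def using s a(1) by auto
    then have "a \<le> a - 1" unfolding a_def by (rule Least_le)
    then show False using s(1) a(1) by linarith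
  qed
  moreover have "?q \<le> N" "a + k - ?q \<le> k" "a + k = ?q + (a + k - ?q)" using assms a an by linarith+
  ultimately obtain C H where CH: "half_crossingless ?q C H" "card H = a + k - ?q"
    "card C + (a + k - ?q) = k" "fits N ?q (C, H) ((!) F)"
    using ex_component[OF fl _ aN(1) a(1) _ _ a(3)] by blast
  \<comment> \<open>Since \<open>a \<le> n - k\<close>, there are at most \<open>m\<close>
    half-cups, and the \<open>m\<close> vertices beyond the cut suffice to close them.\<close>
  have "?q + card H \<le> n" using CH(2) an assms by linarith
  then obtain d where d: "d \<in> cup_diagrams n (card C + card H) (n - ?q)" "cut_diagram ?q d = (C, H)"
    using ex_cut_diagram[OF CH(1)] by blast
  have "card C + card H = k" "n - ?q = m" using CH(2,3) assms by linarith+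
  then have "d \<in> cup_diagrams n k m" using d(1) by simp
  moreover have "F \<in> exotic_component N ?q (cut_diagram ?q d)"
    unfolding exotic_component_iff d(2) using F CH(4) by simp
  ultimately show "F \<in> (\<Union>a\<in>cup_diagrams n k m. exotic_component N ?q (cut_diagram ?q a))" by blast
next
  let ?q = "n - m"
  fix F assume "F \<in> (\<Union>a\<in>cup_diagrams n k m. exotic_component N ?q (cut_diagram ?q a))"
  then obtain d where d: "d \<in> cup_diagrams n k m" "F \<in> exotic_component N ?q (cut_diagram ?q d)" by blast
  obtain C H where CH: "cut_diagram ?q d = (C, H)" by fastforce
  have mn: "m \<le> n" using assms by linarith
  note h = half_crossingless_cut_diagram[OF d(1) mn CH]
  have F: "F \<in> Yvar N ?q" "fits N ?q (C, H) ((!) F)" using d(2) unfolding exotic_component_iff CH by auto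
  then have fl: "nflag (2 * N) (zmat N) ?q ((!) F)" using Yvar_iff by blast
  have "?q \<le> N" using assms by simp
  then have "F ! ?q \<subseteq> block N (?q - card C) (card C + card H)" using fits_upper_bound[OF h(1) F(2) fl] by simp
  \<comment> \<open>The first index is \<open>n - k\<close> minus the difference between
    \<open>m\<close> and the number of half-cups.\<close>
  also have "\<dots> \<subseteq> block N (n - k) k" using h(2,3) assms by (intro block_mono) linarith+
  finally show "F \<in> {F \<in> Yvar N ?q. F ! ?q \<subseteq> block N (n - k) k}" using F(1) by simp
qed

text \<open>The vector \<open>evec N (n - m - k)\<close> is the top \<open>e\<close> vector of the
  block that every such flag must contain.\<close>

lemma delta_springer_emb_subset_exotic:
  assumes "m \<le> k" "k \<le> n div 2" "n < N"
  shows "delta_springer_emb N n k m \<subseteq> exotic_springer_emb N (n - m) (n - m - k)"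
proof
  fix F assume "F \<in> delta_springer_emb N n k m"
  then have F: "F \<in> Yvar N (n - m)" "F ! (n - m) \<subseteq> block N (n - k) k"
    unfolding delta_springer_emb_eq[OF assms] by auto
  have "n - k - m = n - m - k" by simp
  then have "evec N (n - m - k) \<in> block N (n - k - m) (k - m)"
    using assms by (intro evec_block) linarith+
  then show "F \<in> exotic_springer_emb N (n - m) (n - m - k)"
    using F(1) Yvar_block_lower[OF F(1) assms F(2)] unfolding exotic_springer_emb_def by blast
qed

section \<open>Linear maps of flag varieties\<close>

text \<open>Both inclusions come from the hull property: the image of a span is a subspace, and so
  is the preimage of one.\<close>

lemma cspan_image:
  assumes M: "M \<in> carrier_mat d' d" and S: "S \<subseteq> carrier_vec d"
  shows "cspan d' ((*\<^sub>v) M ` S) = (*\<^sub>v) M ` cspan d S"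
proof
  have MS: "(*\<^sub>v) M ` S \<subseteq> carrier_vec d'" using M S by auto
  note h = cspan_hull[OF S] and h' = cspan_hull[OF MS]
  have add: "M *\<^sub>v (u + v) = M *\<^sub>v u + M *\<^sub>v v" if "u \<in> carrier_vec d" "v \<in> carrier_vec d" for u v
    using mult_add_distrib_mat_vec[OF M that] .
  have smult: "M *\<^sub>v (c \<cdot>\<^sub>v u) = c \<cdot>\<^sub>v (M *\<^sub>v u)" if "u \<in> carrier_vec d" for c u
    using mult_mat_vec[OF M that] .
  have zero: "M *\<^sub>v 0\<^sub>v d = 0\<^sub>v d'" using M by (intro eq_vecI) (auto simp: scalar_prod_def)
  have "lin_subspace d' ((*\<^sub>v) M ` cspan d S)"
    unfolding lin_subspace_def
  proof (intro conjI ballI allI)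
    show "(*\<^sub>v) M ` cspan d S \<subseteq> carrier_vec d'" using M lin_subspaceD(1)[OF h(1)] by auto
    show "0\<^sub>v d' \<in> (*\<^sub>v) M ` cspan d S" using lin_subspaceD(2)[OF h(1)] zero by (metis imageI)
    fix x c assume "x \<in> (*\<^sub>v) M ` cspan d S"
    then obtain u where u: "u \<in> cspan d S" "x = M *\<^sub>v u" by auto
    note uc = lin_subspaceD(6)[OF h(1) u(1)]
    show "c \<cdot>\<^sub>v x \<in> (*\<^sub>v) M ` cspan d S"
      unfolding u(2) smult[OF uc, symmetric] using lin_subspaceD(4)[OF h(1) u(1)] by blast
    fix y assume "y \<in> (*\<^sub>v) M ` cspan d S"
    then obtain v where v: "v \<in> cspan d S" "y = M *\<^sub>v v" by auto
    show "x + y \<in> (*\<^sub>v) M ` cspan d S"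
      unfolding u(2) v(2) add[OF uc lin_subspaceD(6)[OF h(1) v(1)], symmetric]
      using lin_subspaceD(3)[OF h(1) u(1) v(1)] by blast
  qed
  then show "cspan d' ((*\<^sub>v) M ` S) \<subseteq> (*\<^sub>v) M ` cspan d S" using h(2) by (intro h'(3)) auto
  let ?P = "{w \<in> carrier_vec d. M *\<^sub>v w \<in> cspan d' ((*\<^sub>v) M ` S)}"
  have "lin_subspace d ?P"
    unfolding lin_subspace_def using lin_subspaceD[OF h'(1)] by (auto simp: add smult zero)
  then have "cspan d S \<subseteq> ?P" using h'(2) S by (intro h(3)) auto
  then show "(*\<^sub>v) M ` cspan d S \<subseteq> cspan d' ((*\<^sub>v) M ` S)" by auto
qed

lemma nth_flag_of_frame:
  assumes "A \<in> carrier_mat d r" "i \<le> r"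
  shows "flag_of_frame d A ! i = cspan d (set (take i (cols A)))"
  unfolding flag_of_frame_def using assms by (simp del: upt_Suc)

lemma length_flag_of_frame: "A \<in> carrier_mat d r \<Longrightarrow> length (flag_of_frame d A) = Suc r"
  unfolding flag_of_frame_def by simp

lemma flag_of_frame_last:
  assumes "A \<in> carrier_mat d r"
  shows "flag_of_frame d A ! r = mat_range A"
  using nth_flag_of_frame[OF assms order_refl] cspan_cols[OF assms] assms by simp

lemma flag_of_frame_in_flags:
  assumes "A \<in> frames d r"
  shows "flag_of_frame d A \<in> flags d r"
proof -
  interpret vec_space "TYPE(complex)" d .
  have inj: "inj_mat d r A" using assms frames_iff by blast
  have A: "A \<in> carrier_mat d r" using inj by (simp add: inj_mat_def)
  have cA: "set (cols A) \<subseteq> carrier_vec d" using A cols_dim[of A] by auto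
  have sub: "set (take i (cols A)) \<subseteq> set (cols A)" for i by (rule set_take_subset)
  have li: "lin_indpt (set (cols A))" using inj inj_mat_lin_indpt[OF A inj_mat_distinct[OF inj]] by simp
  have "subspace_of_dim d i (flag_of_frame d A ! i)" if i: "i \<le> r" for i
  proof -
    let ?B = "mat_of_cols d (take i (cols A))"
    have cB: "cols ?B = take i (cols A)" using sub cA by (intro cols_mat_of_cols) blast
    have B: "?B \<in> carrier_mat d i" using A i mat_of_cols_carrier(1)[of d "take i (cols A)"] by simp
    have "lin_indpt (set (cols ?B))"
      unfolding cB using subset_li_is_li[OF li sub] by simp
    moreover have "distinct (cols ?B)" unfolding cB using inj_mat_distinct[OF inj] by (rule distinct_take)
    ultimately have "inj_mat d i ?B" using inj_mat_lin_indpt[OF B] by simp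
    moreover have "flag_of_frame d A ! i = mat_range ?B"
      using nth_flag_of_frame[OF A i] cspan_cols[OF B] cB by simp
    ultimately show ?thesis using subspace_of_dim_iff by blast
  qed
  moreover have "flag_of_frame d A ! 0 = {0\<^sub>v d}"
    using nth_flag_of_frame[OF A, of 0] span_empty by simp
  moreover have "flag_of_frame d A ! (i - 1) \<subseteq> flag_of_frame d A ! i" if "i \<in> {1..r}" for i
  proof -
    have "set (take (i - 1) (cols A)) \<subseteq> set (take i (cols A))" by (rule set_take_subset_set_take) simp
    from span_is_monotone[OF this] show ?thesis
      using that nth_flag_of_frame[OF A, of i] nth_flag_of_frame[OF A, of "i - 1"] by auto
  qed
  ultimately show ?thesis unfolding flags_def using length_flag_of_frame[OF A] by auto
qed

text \<open>The last member of the flag is the column space, so its dimension is the rank.\<close>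

lemma frame_of_flag_of_frame:
  assumes "A \<in> carrier_mat d r" "flag_of_frame d A \<in> flags d r"
  shows "A \<in> frames d r"
proof -
  interpret vec_space "TYPE(complex)" d .
  have "subspace_of_dim d r (cspan d (set (cols A)))"
  proof (cases "r = 0")
    case True
    then have "cols A = []" using assms(1) by (metis carrier_matD(2) cols_length length_0_conv)
    then show ?thesis using subspace_of_dim_0 span_empty True by simp
  next
    case False
    then have "subspace_of_dim d r (flag_of_frame d A ! r)" using assms(2) unfolding flags_def by auto
    then show ?thesis using nth_flag_of_frame[OF assms(1) order_refl] assms(1) by simp
  qed
  then have "rank A = r" unfolding subspace_of_dim_def rank_def by simp
  then show ?thesis unfolding frames_def using assms(1) by simp
qed

definition map_flag :: "complex mat \<Rightarrow> flag \<Rightarrow> flag" where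
  "map_flag M F = map (\<lambda>W. (*\<^sub>v) M ` W) F"

text \<open>The map of flags lifts to left multiplication on frames, where topology and regular
  functions are defined.\<close>

lemma flag_of_frame_mult:
  assumes M: "M \<in> carrier_mat d' d" and A: "A \<in> carrier_mat d r"
  shows "flag_of_frame d' (M * A) = map_flag M (flag_of_frame d A)"
proof (rule nth_equalityI)
  have MA: "M * A \<in> carrier_mat d' r" using M A by auto
  show "length (flag_of_frame d' (M * A)) = length (map_flag M (flag_of_frame d A))"
    unfolding map_flag_def using length_flag_of_frame[OF MA] length_flag_of_frame[OF A] by simp
  have cols: "cols (M * A) = map ((*\<^sub>v) M) (cols A)"
    using M A by (intro nth_equalityI) (auto simp: col_mult2)
  fix i assume "i < length (flag_of_frame d' (M * A))"
  then have i: "i \<le> r" using length_flag_of_frame[OF MA] by simp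
  have sub: "set (take i (cols A)) \<subseteq> carrier_vec d" using A cols_dim[of A] set_take_subset[of i "cols A"] by auto
  have "flag_of_frame d' (M * A) ! i = cspan d' ((*\<^sub>v) M ` set (take i (cols A)))"
    unfolding nth_flag_of_frame[OF MA i] cols take_map by simp
  also have "\<dots> = (*\<^sub>v) M ` (flag_of_frame d A ! i)"
    unfolding cspan_image[OF M sub] nth_flag_of_frame[OF A i] ..
  also have "\<dots> = map_flag M (flag_of_frame d A) ! i"
    unfolding map_flag_def using length_flag_of_frame[OF A] i by simp
  finally show "flag_of_frame d' (M * A) ! i = map_flag M (flag_of_frame d A) ! i" .
qed

section \<open>Polynomial functions and the Zariski topology under linear maps\<close>

lemma mat_polys_sum:
  assumes "finite I" "\<And>i. i \<in> I \<Longrightarrow> f i \<in> mat_polys d r"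
  shows "(\<lambda>A. \<Sum>i\<in>I. f i A) \<in> mat_polys d r"
  using assms by (induction I rule: finite_induct) (auto intro: mat_polys.intros)

lemma mat_polys_prod:
  assumes "finite I" "\<And>i. i \<in> I \<Longrightarrow> f i \<in> mat_polys d r"
  shows "(\<lambda>A. \<Prod>i\<in>I. f i A) \<in> mat_polys d r"
  using assms by (induction I rule: finite_induct) (auto intro: mat_polys.intros)

text \<open>Entries of \<open>M * A\<close> are linear forms in the entries of \<open>A\<close>, so
  substitution stays polynomial. The equality is claimed only for matrices \<open>A\<close> of the
  right shape.\<close>

lemma mat_polys_mult_left:
  assumes M: "M \<in> carrier_mat d' d" and p: "p \<in> mat_polys d' r"
  shows "\<exists>p'\<in>mat_polys d r. \<forall>A\<in>carrier_mat d r. p' A = p (M * A)"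
  using p
proof (induction rule: mat_polys.induct)
  case (const c)
  show ?case by (rule bexI[OF _ mat_polys.const]) (rule ballI, rule refl)
next
  case (entry i j)
  have P: "(\<lambda>A. \<Sum>k<d. M $$ (i, k) * A $$ (k, j)) \<in> mat_polys d r"
    using entry by (intro mat_polys_sum) (auto intro: mat_polys.intros)
  have E: "(\<Sum>k<d. M $$ (i, k) * A $$ (k, j)) = (M * A) $$ (i, j)" if "A \<in> carrier_mat d r" for A
    using M that entry by (auto simp: scalar_prod_def lessThan_atLeast0 intro!: sum.cong)
  show ?case by (rule bexI[OF _ P]) (rule ballI, rule E)
next
  case (add p q)
  obtain p' where p': "p' \<in> mat_polys d r" "\<forall>A\<in>carrier_mat d r. p' A = p (M * A)"
    using add.IH(1) by (rule bexE)
  obtain q' where q': "q' \<in> mat_polys d r" "\<forall>A\<in>carrier_mat d r. q' A = q (M * A)"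
    using add.IH(2) by (rule bexE)
  show ?case using p'(2) q'(2) by (intro bexI[OF _ mat_polys.add[OF p'(1) q'(1)]]) simp
next
  case (mult p q)
  obtain p' where p': "p' \<in> mat_polys d r" "\<forall>A\<in>carrier_mat d r. p' A = p (M * A)"
    using mult.IH(1) by (rule bexE)
  obtain q' where q': "q' \<in> mat_polys d r" "\<forall>A\<in>carrier_mat d r. q' A = q (M * A)"
    using mult.IH(2) by (rule bexE)
  show ?case using p'(2) q'(2) by (intro bexI[OF _ mat_polys.mult[OF p'(1) q'(1)]]) simp
qed

lemma mat_polys_det:
  "\<exists>p\<in>mat_polys r r. \<forall>A\<in>carrier_mat r r. p A = det A"
proof
  let ?p = "\<lambda>A. \<Sum>\<pi>\<in>{\<pi>. \<pi> permutes {0..<r}}. signof \<pi> * (\<Prod>i\<in>{0..<r}. A $$ (i, \<pi> i)) :: complex"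
  show "?p \<in> mat_polys r r"
  proof (rule mat_polys_sum)
    fix \<pi> assume "\<pi> \<in> {\<pi>. \<pi> permutes {0..<r}}"
    then have "\<pi> i < r" if "i < r" for i using that permutes_in_image[of \<pi> "{0..<r}" i] by auto
    then show "(\<lambda>A. signof \<pi> * (\<Prod>i\<in>{0..<r}. A $$ (i, \<pi> i))) \<in> mat_polys r r"
      by (intro mat_polys.mult mat_polys.const mat_polys_prod) (auto intro: mat_polys.entry)
  qed (simp add: finite_permutations)
  show "\<forall>A\<in>carrier_mat r r. ?p A = det A" by (auto simp: det_def)
qed

lemma openin_zariski_basic:
  "p \<in> mat_polys d r \<Longrightarrow> openin (zariski_frames d r) {A \<in> frames d r. p A \<noteq> 0}"
  unfolding zariski_frames_def by (rule topology_generated_by_Basis) blast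

lemma openin_zariski_framesI:
  assumes "U \<subseteq> frames d r"
    and "\<And>A. A \<in> U \<Longrightarrow> \<exists>p\<in>mat_polys d r. p A \<noteq> 0 \<and> (\<forall>B\<in>frames d r. p B \<noteq> 0 \<longrightarrow> B \<in> U)"
  shows "openin (zariski_frames d r) U"
proof (subst openin_subopen, intro ballI)
  fix A assume A: "A \<in> U"
  then obtain p where p: "p \<in> mat_polys d r" "p A \<noteq> 0" "\<forall>B\<in>frames d r. p B \<noteq> 0 \<longrightarrow> B \<in> U"
    using assms(2) by blast
  then show "\<exists>T. openin (zariski_frames d r) T \<and> A \<in> T \<and> T \<subseteq> U"
    using openin_zariski_basic[OF p(1)] A assms(1) by (intro exI[of _ "{B \<in> frames d r. p B \<noteq> 0}"]) auto
qed

text \<open>Injectivity persists nearby: if \<open>S\<close> is a left inverse of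
  \<open>M * A\<close>, then \<open>det (S * (M * B))\<close> is polynomial in \<open>B\<close>,
  equals 1 at \<open>A\<close>, and being nonzero forces \<open>M * B\<close> to be
  injective.\<close>

lemma openin_frames_preimage:
  assumes M: "M \<in> carrier_mat d' d"
  shows "openin (zariski_frames d r) {A \<in> frames d r. M * A \<in> frames d' r}"
proof (rule openin_zariski_framesI)
  fix A assume "A \<in> {A \<in> frames d r. M * A \<in> frames d' r}"
  then have A: "A \<in> carrier_mat d r" "inj_mat d' r (M * A)" unfolding frames_iff inj_mat_def by auto
  obtain S where S: "S \<in> carrier_mat r d'" "S * (M * A) = 1\<^sub>m r" using inj_mat_left_inverse[OF A(2)] .
  have SM: "S * M \<in> carrier_mat r d" using S M by auto
  obtain q where q: "q \<in> mat_polys r r" "\<forall>A\<in>carrier_mat r r. q A = det A" using mat_polys_det by blast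
  obtain p where p: "p \<in> mat_polys d r" "\<forall>A\<in>carrier_mat d r. p A = q ((S * M) * A)"
    using mat_polys_mult_left[OF SM q(1)] by blast
  have pd: "p B = det (S * (M * B))" if "B \<in> carrier_mat d r" for B
    using p(2) q(2) that S M assoc_mult_mat[OF S(1) M that] by auto
  have "p A \<noteq> 0" using pd[OF A(1)] S(2) by simp
  moreover have "M * B \<in> frames d' r" if B: "B \<in> frames d r" "p B \<noteq> 0" for B
  proof -
    have cB: "B \<in> carrier_mat d r" using B(1) unfolding frames_iff inj_mat_def by simp
    have MB: "M * B \<in> carrier_mat d' r" using M cB by auto
    have SMB: "S * (M * B) \<in> carrier_mat r r" using S MB by auto
    have "det (S * (M * B)) \<noteq> 0" using B(2) pd[OF cB] by simp
    have "c = 0\<^sub>v r" if c: "c \<in> carrier_vec r" "(M * B) *\<^sub>v c = 0\<^sub>v d'" for c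
    proof (rule ccontr)
      assume "c \<noteq> 0\<^sub>v r"
      moreover have "(S * (M * B)) *\<^sub>v c = S *\<^sub>v 0\<^sub>v d'" using assoc_mult_mat_vec[OF S(1) MB c(1)] c(2) by simp
      moreover have "S *\<^sub>v 0\<^sub>v d' = 0\<^sub>v r" using S(1) by (intro eq_vecI) (auto simp: scalar_prod_def)
      ultimately show False
        using det_0_iff_vec_prod_zero_field[OF SMB] c(1) \<open>det (S * (M * B)) \<noteq> 0\<close> by auto
    qed
    then show ?thesis unfolding frames_iff inj_mat_def using MB by blast
  qed
  ultimately show "\<exists>p\<in>mat_polys d r. p A \<noteq> 0 \<and>
      (\<forall>B\<in>frames d r. p B \<noteq> 0 \<longrightarrow> B \<in> {A \<in> frames d r. M * A \<in> frames d' r})"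
    using p(1) by blast
qed blast

lemma openin_mult_preimage:
  assumes M: "M \<in> carrier_mat d' d" and U: "openin (zariski_frames d' r) U"
  shows "openin (zariski_frames d r) {A \<in> frames d r. M * A \<in> U}"
proof -
  have "generate_topology_on {{A \<in> frames d' r. p A \<noteq> 0} | p. p \<in> mat_polys d' r} U"
    using U unfolding zariski_frames_def openin_topology_generated_by_iff .
  then show ?thesis
  proof (induction rule: generate_topology_on.induct)
    case Empty
    then show ?case by simp
  next
    case (Int a b)
    have "{A \<in> frames d r. M * A \<in> a \<inter> b} = {A \<in> frames d r. M * A \<in> a} \<inter> {A \<in> frames d r. M * A \<in> b}" by blast
    then show ?case using openin_Int[OF Int.IH] by (simp only:)
  next
    case (UN K)
    have "{A \<in> frames d r. M * A \<in> \<Union>K} = (\<Union>k\<in>K. {A \<in> frames d r. M * A \<in> k})" by blast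
    moreover have "openin (zariski_frames d r) (\<Union>k\<in>K. {A \<in> frames d r. M * A \<in> k})"
      by (rule openin_Union) (use UN.IH in auto)
    ultimately show ?case by (simp only:)
  next
    case (Basis s)
    then obtain p where p: "p \<in> mat_polys d' r" "s = {A \<in> frames d' r. p A \<noteq> 0}" by blast
    obtain p' where p': "p' \<in> mat_polys d r" "\<forall>A\<in>carrier_mat d r. p' A = p (M * A)"
      using mat_polys_mult_left[OF M p(1)] by blast
    \<comment> \<open>\<open>M\<close> may destroy independence of columns, so the open set of
      frames that stay frames must be intersected in.\<close>
    have "{A \<in> frames d r. M * A \<in> s} = {A \<in> frames d r. M * A \<in> frames d' r} \<inter> {A \<in> frames d r. p' A \<noteq> 0}"
    proof -
      have "p' A = p (M * A)" if "A \<in> frames d r" for A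
        using p'(2) that by (simp add: frames_iff inj_mat_def)
      then show ?thesis unfolding p(2) by auto
    qed
    then show ?case
      using openin_Int[OF openin_frames_preimage[OF M] openin_zariski_basic[OF p'(1)]] by (simp only:)
  qed
qed

lemma topspace_zariski_flags: "topspace (zariski_flags d r) = flags d r"
proof
  show "topspace (zariski_flags d r) \<subseteq> flags d r"
    using openin_topspace[of "zariski_flags d r"] unfolding openin_zariski_flags by blast
  have "{A \<in> frames d r. flag_of_frame d A \<in> flags d r} = topspace (zariski_frames d r)"
    unfolding topspace_zariski_frames using flag_of_frame_in_flags by auto
  then have "openin (zariski_flags d r) (flags d r)" unfolding openin_zariski_flags by simp
  then show "flags d r \<subseteq> topspace (zariski_flags d r)" by (rule openin_subset)
qed

text \<open>Flags in \<open>V\<close> have the correct dimensions, so membership of the image in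
  \<open>V\<close> already makes \<open>M * A\<close> a frame; the question then moves to frames
  through the quotient topology.\<close>

lemma openin_map_flag_preimage:
  assumes M: "M \<in> carrier_mat d' d" and V: "openin (zariski_flags d' r) V"
  shows "openin (zariski_flags d r) {F \<in> flags d r. map_flag M F \<in> V}"
  unfolding openin_zariski_flags
proof
  have Vs: "V \<subseteq> flags d' r" and Vo: "openin (zariski_frames d' r) {B \<in> frames d' r. flag_of_frame d' B \<in> V}"
    using V unfolding openin_zariski_flags by auto
  have "{A \<in> frames d r. flag_of_frame d A \<in> {F \<in> flags d r. map_flag M F \<in> V}} =
    {A \<in> frames d r. M * A \<in> {B \<in> frames d' r. flag_of_frame d' B \<in> V}}"
  proof -
    have "flag_of_frame d A \<in> {F \<in> flags d r. map_flag M F \<in> V} \<longleftrightarrow>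
      M * A \<in> {B \<in> frames d' r. flag_of_frame d' B \<in> V}" if A: "A \<in> frames d r" for A
    proof -
      have cA: "A \<in> carrier_mat d r" using A by (simp add: frames_iff inj_mat_def)
      have MA: "M * A \<in> carrier_mat d' r" using M cA by auto
      show ?thesis
        using flag_of_frame_mult[OF M cA] flag_of_frame_in_flags[OF A] frame_of_flag_of_frame[OF MA] Vs by auto
    qed
    then show ?thesis by blast
  qed
  then show "openin (zariski_frames d r) {A \<in> frames d r. flag_of_frame d A \<in> {F \<in> flags d r. map_flag M F \<in> V}}"
    using openin_mult_preimage[OF M Vo] by simp
qed blast

text \<open>Only flags in \<open>X\<close> have to be mapped to flags, so the result covers the
  embedding as well as its left inverse on the image. Fractions pull back by substituting
  \<open>M * A\<close>.\<close>

lemma variety_morphism_map_flag: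
  assumes M: "M \<in> carrier_mat d' d" and X: "X \<subseteq> flags d r" and X': "X' \<subseteq> flags d' r"
    and \<phi>: "\<And>F. F \<in> X \<Longrightarrow> \<phi> F = map_flag M F" "\<And>F. F \<in> X \<Longrightarrow> map_flag M F \<in> X'"
  shows "variety_morphism d r X d' r X' \<phi>"
  unfolding variety_morphism_def
proof (intro conjI allI impI)
  have tX: "topspace (subtopology (zariski_flags d r) X) = X"
    and tX': "topspace (subtopology (zariski_flags d' r) X') = X'"
    using X X' by (auto simp: topspace_zariski_flags)
  show "continuous_map (subtopology (zariski_flags d r) X) (subtopology (zariski_flags d' r) X') \<phi>"
    unfolding continuous_map_def tX tX'
  proof (intro conjI allI impI)
    show "\<phi> \<in> X \<rightarrow> X'" using \<phi> by auto
    fix U assume "openin (subtopology (zariski_flags d' r) X') U"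
    then obtain V where V: "openin (zariski_flags d' r) V" "U = V \<inter> X'" unfolding openin_subtopology by blast
    have "{F \<in> X. \<phi> F \<in> U} = {F \<in> flags d r. map_flag M F \<in> V} \<inter> X"
      unfolding V(2) using \<phi> X by auto
    then show "openin (subtopology (zariski_flags d r) X) {F \<in> X. \<phi> F \<in> U}"
      unfolding openin_subtopology using openin_map_flag_preimage[OF M V(1)] by blast
  qed
  fix V f assume "openin (subtopology (zariski_flags d' r) X') V \<and> regular_on d' r V f"
  then have V: "V \<subseteq> X'" and f: "regular_on d' r V f" using openin_subset tX' by blast+
  have frame: "M * A \<in> frames d' r \<and> flag_of_frame d' (M * A) \<in> V \<and> A \<in> carrier_mat d r \<and>
      \<phi> (flag_of_frame d A) = flag_of_frame d' (M * A)"
    if A: "A \<in> frames d r" "flag_of_frame d A \<in> {F \<in> X. \<phi> F \<in> V}" for A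
  proof -
    have cA: "A \<in> carrier_mat d r" using A by (simp add: frames_iff inj_mat_def)
    have MA: "M * A \<in> carrier_mat d' r" using M cA by auto
    have "\<phi> (flag_of_frame d A) = flag_of_frame d' (M * A)" using \<phi>(1) A(2) flag_of_frame_mult[OF M cA] by auto
    then show ?thesis using A(2) frame_of_flag_of_frame[OF MA] V X' cA by auto
  qed
  show "regular_on d r {F \<in> X. \<phi> F \<in> V} (f \<circ> \<phi>)"
    unfolding regular_on_def
  proof (intro ballI impI)
    fix A assume A: "A \<in> frames d r" "flag_of_frame d A \<in> {F \<in> X. \<phi> F \<in> V}"
    note fA = frame[OF A]
    then obtain p q where pq: "p \<in> mat_polys d' r" "q \<in> mat_polys d' r" "q (M * A) \<noteq> 0"
      "\<And>B. B \<in> frames d' r \<Longrightarrow> flag_of_frame d' B \<in> V \<Longrightarrow> q B \<noteq> 0 \<Longrightarrow> f (flag_of_frame d' B) = p B / q B"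
      using f unfolding regular_on_def by metis
    obtain p' where p': "p' \<in> mat_polys d r" "\<forall>A\<in>carrier_mat d r. p' A = p (M * A)"
      using mat_polys_mult_left[OF M pq(1)] by blast
    obtain q' where q': "q' \<in> mat_polys d r" "\<forall>A\<in>carrier_mat d r. q' A = q (M * A)"
      using mat_polys_mult_left[OF M pq(2)] by blast
    have "(f \<circ> \<phi>) (flag_of_frame d B) = p' B / q' B"
      if B: "B \<in> frames d r" "flag_of_frame d B \<in> {F \<in> X. \<phi> F \<in> V}" "q' B \<noteq> 0" for B
      using frame[OF B(1,2)] pq(4)[of "M * B"] p'(2) q'(2) B(3) by auto
    moreover have "q' A \<noteq> 0" using q'(2) fA pq(3) by auto
    ultimately show "\<exists>p\<in>mat_polys d r. \<exists>q\<in>mat_polys d r. q A \<noteq> 0 \<and>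
        (\<forall>B\<in>frames d r. flag_of_frame d B \<in> {F \<in> X. \<phi> F \<in> V} \<and> q B \<noteq> 0 \<longrightarrow>
          (f \<circ> \<phi>) (flag_of_frame d B) = p B / q B)"
      using p'(1) q'(1) by blast
  qed
qed

text \<open>On frames the condition says \<open>K * A = 0\<close>, which is a system of polynomial
  equations; near a violation one fixed entry of \<open>K * A\<close> stays nonzero.\<close>

lemma closedin_flags_in_kernel:
  assumes X: "X \<subseteq> flags d r" and K: "K \<in> carrier_mat d d"
  shows "closedin (subtopology (zariski_flags d r) X) {F \<in> X. \<forall>w\<in>F ! r. K *\<^sub>v w = 0\<^sub>v d}"
proof -
  have tX: "topspace (subtopology (zariski_flags d r) X) = X" using X by (auto simp: topspace_zariski_flags)
  let ?U = "{F \<in> flags d r. \<not> (\<forall>w\<in>F ! r. K *\<^sub>v w = 0\<^sub>v d)}"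
  have "openin (zariski_frames d r) {A \<in> frames d r. flag_of_frame d A \<in> ?U}"
  proof (rule openin_zariski_framesI)
    fix A assume A: "A \<in> {A \<in> frames d r. flag_of_frame d A \<in> ?U}"
    then have cA: "A \<in> carrier_mat d r" by (simp add: frames_iff inj_mat_def)
    have KA: "K * A \<in> carrier_mat d r" using K cA by auto
    obtain w where w: "w \<in> flag_of_frame d A ! r" "K *\<^sub>v w \<noteq> 0\<^sub>v d" using A by auto
    then obtain c where c: "c \<in> carrier_vec r" "K *\<^sub>v (A *\<^sub>v c) \<noteq> 0\<^sub>v d"
      using cA unfolding flag_of_frame_last[OF cA] mat_range_def by auto
    have "\<exists>i j. i < d \<and> j < r \<and> (K * A) $$ (i, j) \<noteq> 0"
    proof (rule ccontr)
      assume "\<not> ?thesis"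
      then have "K * A = 0\<^sub>m d r" using KA by (intro eq_matI) auto
      then have "K *\<^sub>v (A *\<^sub>v c) = 0\<^sub>m d r *\<^sub>v c" using assoc_mult_mat_vec[OF K cA c(1)] by simp
      also have "\<dots> = 0\<^sub>v d" using c(1) by (intro eq_vecI) auto
      finally show False using c(2) by simp
    qed
    then obtain i j where ij: "i < d" "j < r" "(K * A) $$ (i, j) \<noteq> 0" by blast
    obtain p where p: "p \<in> mat_polys d r" "\<forall>B\<in>carrier_mat d r. p B = (K * B) $$ (i, j)"
      using mat_polys_mult_left[OF K mat_polys.entry[OF ij(1,2)]] by blast
    have "flag_of_frame d B \<in> ?U" if B: "B \<in> frames d r" "p B \<noteq> 0" for B
    proof -
      have cB: "B \<in> carrier_mat d r" using B by (simp add: frames_iff inj_mat_def)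
      have "B *\<^sub>v unit_vec r j \<in> flag_of_frame d B ! r"
        unfolding flag_of_frame_last[OF cB] mat_range_def using cB by auto
      moreover have "K *\<^sub>v (B *\<^sub>v unit_vec r j) \<noteq> 0\<^sub>v d"
      proof
        assume "K *\<^sub>v (B *\<^sub>v unit_vec r j) = 0\<^sub>v d"
        then have "(K * B) *\<^sub>v unit_vec r j = 0\<^sub>v d" using assoc_mult_mat_vec[OF K cB] by simp
        then have "col (K * B) j = 0\<^sub>v d" using mult_mat_unit_vec[of "K * B" d r j] K cB ij(2) by auto
        then have "(K * B) $$ (i, j) = 0" using ij K cB by (metis carrier_matD index_col index_mult_mat(2,3) index_zero_vec(1))
        then show False using p(2) cB B(2) by simp
      qed
      ultimately show ?thesis using flag_of_frame_in_flags[OF B(1)] by blast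
    qed
    then show "\<exists>p\<in>mat_polys d r. p A \<noteq> 0 \<and>
        (\<forall>B\<in>frames d r. p B \<noteq> 0 \<longrightarrow> B \<in> {A \<in> frames d r. flag_of_frame d A \<in> ?U})"
      using p ij(3) cA by (intro bexI[OF _ p(1)]) auto
  qed blast
  then have "openin (zariski_flags d r) ?U" unfolding openin_zariski_flags by blast
  moreover have "X - {F \<in> X. \<forall>w\<in>F ! r. K *\<^sub>v w = 0\<^sub>v d} = ?U \<inter> X" using X by blast
  ultimately have "openin (subtopology (zariski_flags d r) X) (X - {F \<in> X. \<forall>w\<in>F ! r. K *\<^sub>v w = 0\<^sub>v d})"
    unfolding openin_subtopology by blast
  then show ?thesis unfolding closedin_def tX by blast
qed

lemma nilp_flags_subset: "nilp_flags d r x \<subseteq> flags d r"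
  unfolding nilp_flags_def by blast

lemma closedin_delta_springer_emb:
  assumes "m \<le> k" "k \<le> n div 2" "n < N"
  shows "closedin (subtopology (zariski_flags (2 * N) (n - m)) (exotic_springer_emb N (n - m) (n - m - k)))
    (delta_springer_emb N n k m)"
proof -
  \<comment> \<open>The coordinate projection whose kernel is
    \<open>block N (n - k) k\<close>.\<close>
  let ?K = "mat (2 * N) (2 * N) (\<lambda>(i, j). if i = j \<and> \<not> (i < n - k \<or> N \<le> i \<and> i < N + k) then 1 else 0 :: complex)"
  let ?X = "exotic_springer_emb N (n - m) (n - m - k)"
  have XY: "?X \<subseteq> Yvar N (n - m)" unfolding exotic_springer_emb_def by blast
  have Kw: "?K *\<^sub>v w = 0\<^sub>v (2 * N) \<longleftrightarrow> w \<in> block N (n - k) k" if w: "w \<in> carrier_vec (2 * N)" for w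
  proof -
    have Ki: "(?K *\<^sub>v w) $ i = (if i < n - k \<or> N \<le> i \<and> i < N + k then 0 else w $ i)" if i: "i < 2 * N" for i
    proof -
      have "(?K *\<^sub>v w) $ i = (\<Sum>j<2 * N. ?K $$ (i, j) * w $ j)"
        using w i by (auto simp: scalar_prod_def lessThan_atLeast0 intro!: sum.cong)
      also have "\<dots> = (\<Sum>j<2 * N. if j = i then (if i < n - k \<or> N \<le> i \<and> i < N + k then 0 else w $ i) else 0)"
        using i by (intro sum.cong) auto
      also have "\<dots> = (if i < n - k \<or> N \<le> i \<and> i < N + k then 0 else w $ i)"
        using i by (subst sum.delta) auto
      finally show ?thesis .
    qed
    show ?thesis
    proof
      assume z: "?K *\<^sub>v w = 0\<^sub>v (2 * N)"
      show "w \<in> block N (n - k) k"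
      proof (rule blockI[OF w])
        fix i assume i: "i < 2 * N" "w $ i \<noteq> 0"
        then show "i < n - k \<or> N \<le> i \<and> i < N + k" using Ki[OF i(1)] unfolding z by (auto split: if_splits)
      qed
    next
      assume "w \<in> block N (n - k) k"
      then show "?K *\<^sub>v w = 0\<^sub>v (2 * N)"
        by (intro eq_vecI) (use Ki in \<open>auto simp: block_def simp del: index_mult_mat_vec\<close>)
    qed
  qed
  have "{F \<in> ?X. \<forall>w\<in>F ! (n - m). ?K *\<^sub>v w = 0\<^sub>v (2 * N)} = delta_springer_emb N n k m"
  proof -
    have "(\<forall>w\<in>F ! (n - m). ?K *\<^sub>v w = 0\<^sub>v (2 * N)) \<longleftrightarrow> F ! (n - m) \<subseteq> block N (n - k) k" if F: "F \<in> Yvar N (n - m)" for F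
    proof -
      have "nflag (2 * N) (zmat N) (n - m) ((!) F)" using F Yvar_iff by blast
      then have "F ! (n - m) \<subseteq> carrier_vec (2 * N)" using nflag_lin_subspace lin_subspaceD(1) by blast
      then have "?K *\<^sub>v w = 0\<^sub>v (2 * N) \<longleftrightarrow> w \<in> block N (n - k) k" if "w \<in> F ! (n - m)" for w
        using Kw that by blast
      then show ?thesis by blast
    qed
    then have "{F \<in> ?X. \<forall>w\<in>F ! (n - m). ?K *\<^sub>v w = 0\<^sub>v (2 * N)} =
        ?X \<inter> {F \<in> Yvar N (n - m). F ! (n - m) \<subseteq> block N (n - k) k}" using XY by blast
    also have "\<dots> = delta_springer_emb N n k m"
      using delta_springer_emb_eq[OF assms] delta_springer_emb_subset_exotic[OF assms] by blast
    finally show ?thesis .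
  qed
  moreover have "?X \<subseteq> flags (2 * N) (n - m)" using XY nilp_flags_subset unfolding Yvar_def by blast
  ultimately show ?thesis using closedin_flags_in_kernel[of ?X "2 * N" "n - m" ?K] by simp
qed

section \<open>Jordan types with two parts\<close>

text \<open>Parts equal to 0 are filtered out, so the degenerate cases are matched separately with
  an \<open>nmat\<close> one of whose strings is empty.\<close>

lemma jordan_matrix_two_blocks:
  "jordan_matrix (map (\<lambda>l. (l, 0)) (filter (\<lambda>l. l \<noteq> 0) [a, b])) = nmat a b"
proof -
  have nil: "jordan_matrix [] = nmat 0 0"
    by (rule eq_matI) (simp_all add: jordan_matrix_def nmat_def)
  have "jordan_matrix [(n, 0)] = jordan_block n (0 :: complex)" for n
    unfolding jordan_matrix_Cons nil by (rule eq_matI) (simp_all add: nmat_def)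
  moreover have "jordan_block n (0 :: complex) = nmat n 0" "jordan_block n (0 :: complex) = nmat 0 n" for n
    by (rule eq_matI; auto simp: nmat_def)+
  ultimately have one: "jordan_matrix [(n, 0)] = nmat n 0" "jordan_matrix [(n, 0)] = nmat 0 n" for n
    by simp_all
  have two: "jordan_matrix [(a, 0), (b, 0)] = nmat a b"
    unfolding jordan_matrix_Cons[of a] one(2)
    by (rule eq_matI) (auto simp: nmat_def)
  consider "a = 0" "b = 0" | "a = 0" "b \<noteq> 0" | "a \<noteq> 0" "b = 0" | "a \<noteq> 0" "b \<noteq> 0" by blast
  then show ?thesis
  proof cases
    case 1
    then show ?thesis using nil by simp
  next
    case 2
    then show ?thesis using one(2)[of b] by simp
  next
    case 3
    then show ?thesis using one(1)[of a] by simp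
  next
    case 4
    then show ?thesis using two by simp
  qed
qed

lemma two_block_conjugation:
  assumes x: "x \<in> carrier_mat (a + b) (a + b)" and t: "nilp_jordan_type x [a, b]"
  obtains P R where "P \<in> carrier_mat (a + b) (a + b)" "R \<in> carrier_mat (a + b) (a + b)"
    "\<And>w. w \<in> carrier_vec (a + b) \<Longrightarrow> P *\<^sub>v (R *\<^sub>v w) = w"
    "\<And>w. w \<in> carrier_vec (a + b) \<Longrightarrow> R *\<^sub>v (P *\<^sub>v w) = w"
    "\<And>w. w \<in> carrier_vec (a + b) \<Longrightarrow> x *\<^sub>v (P *\<^sub>v w) = P *\<^sub>v (nmat a b *\<^sub>v w)"
proof -
  have "similar_mat x (nmat a b)"
    using t unfolding nilp_jordan_type_def jordan_nf_def jordan_matrix_two_blocks by blast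
  then obtain P R where w: "similar_mat_wit x (nmat a b) P R" unfolding similar_mat_def by blast
  then have PR: "P \<in> carrier_mat (a + b) (a + b)" "R \<in> carrier_mat (a + b) (a + b)"
    "P * R = 1\<^sub>m (a + b)" "R * P = 1\<^sub>m (a + b)" "x = P * nmat a b * R"
    using x unfolding similar_mat_wit_def Let_def by auto
  have 1: "P *\<^sub>v (R *\<^sub>v w) = w" if "w \<in> carrier_vec (a + b)" for w
    using assoc_mult_mat_vec[OF PR(1,2) that] PR(3) that by simp
  have 2: "R *\<^sub>v (P *\<^sub>v w) = w" if "w \<in> carrier_vec (a + b)" for w
    using assoc_mult_mat_vec[OF PR(2,1) that] PR(4) that by simp
  have PJ: "P * nmat a b \<in> carrier_mat (a + b) (a + b)" using PR(1) by auto
  have "x *\<^sub>v (P *\<^sub>v w) = P *\<^sub>v (nmat a b *\<^sub>v w)" if w: "w \<in> carrier_vec (a + b)" for w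
  proof -
    have Pw: "P *\<^sub>v w \<in> carrier_vec (a + b)" using PR(1) w by auto
    have "x *\<^sub>v (P *\<^sub>v w) = (P * nmat a b) *\<^sub>v (R *\<^sub>v (P *\<^sub>v w))"
      unfolding PR(5) by (rule assoc_mult_mat_vec[OF PJ PR(2) Pw])
    also have "\<dots> = P *\<^sub>v (nmat a b *\<^sub>v w)"
      unfolding 2[OF w] by (rule assoc_mult_mat_vec[OF PR(1) nmat_carrier w])
    finally show ?thesis .
  qed
  then show thesis using that[OF PR(1,2) 1 2] by blast
qed

lemma pow_intertwine:
  fixes M :: "complex mat"
  assumes M: "M \<in> carrier_mat d' d" and x: "x \<in> carrier_mat d d" and y: "y \<in> carrier_mat d' d'"
    and eq: "\<And>w. w \<in> carrier_vec d \<Longrightarrow> M *\<^sub>v (x *\<^sub>v w) = y *\<^sub>v (M *\<^sub>v w)" and w: "w \<in> carrier_vec d"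
  shows "M *\<^sub>v ((x ^\<^sub>m s) *\<^sub>v w) = (y ^\<^sub>m s) *\<^sub>v (M *\<^sub>v w)"
proof (induction s)
  case 0
  have "M *\<^sub>v w \<in> carrier_vec d'" using M w by auto
  then show ?case using pow_mult_vec(2)[OF x w] pow_mult_vec(2)[OF y] by simp
next
  case (Suc s)
  have Mw: "M *\<^sub>v w \<in> carrier_vec d'" using M w by auto
  show ?case
    unfolding pow_mult_vec(4)[OF x w] pow_mult_vec(4)[OF y Mw] eq[OF pow_mult_vec(1)[OF x w]] Suc ..
qed

text \<open>For two Jordan blocks of the same size \<open>q\<close>, the kernel of the power
  \<open>j\<close> equals the image of the power \<open>q - j\<close>; in the model both are the
  block with both indices \<open>j\<close>. Equality of the sizes is essential.\<close>

lemma equal_block_kernel_image: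
  assumes y: "y \<in> carrier_mat (2 * q) (2 * q)" and t: "nilp_jordan_type y [q, q]"
    and w: "w \<in> carrier_vec (2 * q)" "(y ^\<^sub>m j) *\<^sub>v w = 0\<^sub>v (2 * q)" and j: "j \<le> q"
  obtains u where "u \<in> carrier_vec (2 * q)" "w = (y ^\<^sub>m (q - j)) *\<^sub>v u"
proof -
  have y': "y \<in> carrier_mat (q + q) (q + q)" using y by (simp add: mult_2)
  obtain Q R where QR: "Q \<in> carrier_mat (2 * q) (2 * q)" "R \<in> carrier_mat (2 * q) (2 * q)"
    "\<And>w. w \<in> carrier_vec (2 * q) \<Longrightarrow> Q *\<^sub>v (R *\<^sub>v w) = w"
    "\<And>w. w \<in> carrier_vec (2 * q) \<Longrightarrow> R *\<^sub>v (Q *\<^sub>v w) = w"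
    "\<And>w. w \<in> carrier_vec (2 * q) \<Longrightarrow> y *\<^sub>v (Q *\<^sub>v w) = Q *\<^sub>v (zmat q *\<^sub>v w)"
    by (rule two_block_conjugation[OF y' t]) (simp add: mult_2 zmat_eq_nmat)
  have int: "Q *\<^sub>v ((zmat q ^\<^sub>m s) *\<^sub>v w) = (y ^\<^sub>m s) *\<^sub>v (Q *\<^sub>v w)" if "w \<in> carrier_vec (2 * q)" for w s
    by (rule pow_intertwine[OF QR(1) zmat_carrier y QR(5)[symmetric] that])
  have Rw: "R *\<^sub>v w \<in> carrier_vec (2 * q)" using QR(2) w by auto
  have "Q *\<^sub>v ((zmat q ^\<^sub>m j) *\<^sub>v (R *\<^sub>v w)) = 0\<^sub>v (2 * q)" using int[OF Rw, of j] QR(3)[OF w(1)] w(2) by simp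
  then have "(zmat q ^\<^sub>m j) *\<^sub>v (R *\<^sub>v w) = R *\<^sub>v 0\<^sub>v (2 * q)" using QR(4)[OF zpow(1)[OF Rw]] by metis
  also have "\<dots> = 0\<^sub>v (2 * q)" using QR(2) by (intro eq_vecI) (auto simp: scalar_prod_def)
  finally have "(zmat q ^\<^sub>m j) *\<^sub>v (R *\<^sub>v w) \<in> block q 0 0" by (simp add: block_00)
  then have "R *\<^sub>v w \<in> block q (0 + j) (0 + j)" using j by (intro zpow_in_block[OF Rw]) auto
  then have "R *\<^sub>v w \<in> block q (q - (q - j)) (q - (q - j))" using j by simp
  then obtain u where u: "u \<in> block q q q" "(zmat q ^\<^sub>m (q - j)) *\<^sub>v u = R *\<^sub>v w"
    by (rule block_zpow_surj) auto
  note uc = block_carrier[OF u(1)]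
  have "w = (y ^\<^sub>m (q - j)) *\<^sub>v (Q *\<^sub>v u)" using int[OF uc, of "q - j"] u(2) QR(3)[OF w(1)] by simp
  moreover have "Q *\<^sub>v u \<in> carrier_vec (2 * q)" using QR(1) uc by auto
  ultimately show thesis using that by blast
qed

text \<open>By induction on \<open>i\<close>, the space \<open>F\<^sub>i\<close> is orthogonal to
  \<open>y\<^bsup>-(q-i)\<^esup>F\<^sub>i\<close>, which contains \<open>F\<^sub>i\<close>.\<close>

lemma nflag_isotropic:
  assumes \<omega>: "symplectic_form (2 * q) \<omega>"
    and y: "y \<in> carrier_mat (2 * q) (2 * q)" "nilp_jordan_type y [q, q]"
    and adj: "\<forall>u\<in>carrier_vec (2 * q). \<forall>w\<in>carrier_vec (2 * q). \<omega> (y *\<^sub>v u) w = \<omega> u (y *\<^sub>v w)"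
    and G: "nflag (2 * q) y q G" and i: "i \<le> q"
  shows "isotropic \<omega> (G i)"
proof -
  let ?V = "carrier_vec (2 * q) :: complex vec set"
  have lin: "\<omega> (u + v) w = \<omega> u w + \<omega> v w" "\<omega> (c \<cdot>\<^sub>v u) w = c * \<omega> u w"
    "\<omega> w (u + v) = \<omega> w u + \<omega> w v" "\<omega> w (c \<cdot>\<^sub>v u) = c * \<omega> w u"
    if "u \<in> ?V" "v \<in> ?V" "w \<in> ?V" for u v w c
    using \<omega> that unfolding symplectic_form_def by auto
  have alt: "\<omega> u u = 0" if "u \<in> ?V" for u using \<omega> that unfolding symplectic_form_def by auto
  have anti: "\<omega> u v = - \<omega> v u" if "u \<in> ?V" "v \<in> ?V" for u v
  proof -
    have "\<omega> (u + v) (u + v) = 0" using alt that by simp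
    moreover have "\<omega> (u + v) (u + v) = \<omega> u (u + v) + \<omega> v (u + v)" using lin(1)[OF that] that by simp
    moreover have "\<omega> w (u + v) = \<omega> w u + \<omega> w v" if "w \<in> ?V" for w
      using lin(3)[OF \<open>u \<in> ?V\<close> \<open>v \<in> ?V\<close> that] .
    ultimately have "\<omega> u u + \<omega> u v + (\<omega> v u + \<omega> v v) = 0" using that by simp
    then show ?thesis using alt[OF that(1)] alt[OF that(2)] by (simp add: eq_neg_iff_add_eq_0)
  qed
  have adj_pow: "\<omega> ((y ^\<^sub>m s) *\<^sub>v u) w = \<omega> u ((y ^\<^sub>m s) *\<^sub>v w)" if "u \<in> ?V" "w \<in> ?V" for u w s
    using that(2)
  proof (induction s arbitrary: w)
    case 0
    then show ?case using pow_mult_vec(2)[OF y(1)] that(1) by simp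
  next
    case (Suc s)
    have yw: "y *\<^sub>v w \<in> ?V" using y(1) Suc.prems by auto
    have "\<omega> ((y ^\<^sub>m Suc s) *\<^sub>v u) w = \<omega> ((y ^\<^sub>m s) *\<^sub>v u) (y *\<^sub>v w)"
      unfolding pow_mult_vec(4)[OF y(1) that(1)] using adj pow_mult_vec(1)[OF y(1) that(1)] Suc.prems by blast
    then show ?case using Suc.IH[OF yw] pow_mult_vec(3)[OF y(1) Suc.prems] by simp
  qed
  have main: "\<omega> u w = 0" if "i \<le> q" "u \<in> G i" "w \<in> ?V" "(y ^\<^sub>m (q - i)) *\<^sub>v w \<in> G i" for i u w
    using that
  proof (induction i arbitrary: u w)
    case 0
    then have "u = 0\<^sub>v (2 * q)" using G unfolding nflag_def by simp
    then have "u = 0 \<cdot>\<^sub>v 0\<^sub>v (2 * q)" by (intro eq_vecI) auto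
    then show ?case using lin(2)[OF zero_carrier_vec zero_carrier_vec 0(3), of 0] by simp
  next
    case (Suc i)
    define s where "s = q - Suc i"
    have s: "q - i = Suc s" "q - Suc i = s" unfolding s_def using Suc.prems(1) by auto
    have iq: "i \<le> q" using Suc.prems(1) by simp
    have sub: "G i \<subseteq> G (Suc i)" using nflag_mono[OF G _ Suc.prems(1), of i] by simp
    obtain x where "x \<in> G (Suc i)" "x \<notin> G i" "G (Suc i) = add_line (G i) x"
      by (rule subspace_of_dim_ex_step[OF nflag_dim[OF G iq] nflag_dim[OF G Suc.prems(1)] sub])
    then have x: "x \<in> G (Suc i)" "G (Suc i) = add_line (G i) x" by blast+
    note lS = nflag_lin_subspace[OF G Suc.prems(1)] and li = nflag_lin_subspace[OF G iq]
    have xc: "x \<in> ?V" using lin_subspaceD(6)[OF lS x(1)] .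
    have "(y ^\<^sub>m Suc i) *\<^sub>v x = 0\<^sub>v (2 * q)"
      using nflag_pow[OF G y(1) Suc.prems(1) x(1), of "Suc i"] G unfolding nflag_def by simp
    \<comment> \<open>\<open>x\<close> is killed by the power \<open>Suc i\<close>, hence is itself
      a power with exponent \<open>s = q - Suc i\<close>.\<close>
    then obtain x' where x': "x' \<in> ?V" "x = (y ^\<^sub>m s) *\<^sub>v x'"
      using equal_block_kernel_image[OF y xc _ Suc.prems(1)] s(2) by metis
    have IH: "\<omega> f w = 0" if "f \<in> G i" "w \<in> ?V" "(y ^\<^sub>m Suc s) *\<^sub>v w \<in> G i" for f w
      using Suc.IH[OF iq that(1,2)] that(3) s(1) by simp
    have step: "(y ^\<^sub>m Suc s) *\<^sub>v w \<in> G i" if "w \<in> ?V" "(y ^\<^sub>m s) *\<^sub>v w \<in> G (Suc i)" for w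
      unfolding pow_mult_vec(4)[OF y(1) that(1)] using nflag_mult[OF G y(1) Suc.prems(1) that(2)] by simp
    have wS: "(y ^\<^sub>m s) *\<^sub>v w \<in> G (Suc i)" using Suc.prems(4) s(2) by simp
    obtain u0 c where u: "u0 \<in> G i" "u = u0 + c \<cdot>\<^sub>v x" using Suc.prems(2) unfolding x(2) add_line_def by auto
    obtain f e where f: "f \<in> G i" "(y ^\<^sub>m s) *\<^sub>v w = f + e \<cdot>\<^sub>v x" using wS unfolding x(2) add_line_def by auto
    have fc: "f \<in> ?V" "u0 \<in> ?V" using lin_subspaceD(6)[OF li] f(1) u(1) by auto
    have "\<omega> f x' = 0" using IH[OF f(1) x'(1)] step[OF x'(1)] x(1) x'(2) by simp
    then have 1: "\<omega> x' f = 0" using anti[OF x'(1) fc(1)] by simp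
    \<comment> \<open>Self-adjointness makes the form symmetric on this pair, and it is also skew,
      so the value vanishes.\<close>
    have "\<omega> x x' = \<omega> x' x" using adj_pow[OF x'(1) x'(1), of s] x'(2) by simp
    then have 2: "\<omega> x' x = 0" using anti[OF xc x'(1)] by simp
    have "\<omega> x w = \<omega> x' ((y ^\<^sub>m s) *\<^sub>v w)" unfolding x'(2) by (rule adj_pow[OF x'(1) Suc.prems(3)])
    also have "\<dots> = \<omega> x' f + e * \<omega> x' x"
      unfolding f(2) using lin(3)[OF fc(1) _ x'(1)] lin(4)[OF xc xc x'(1)] xc by simp
    finally have xw: "\<omega> x w = 0" using 1 2 by simp
    have u0w: "\<omega> u0 w = 0" using IH[OF u(1) Suc.prems(3) step[OF Suc.prems(3) wS]] .
    have "\<omega> u w = \<omega> u0 w + c * \<omega> x w"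
      unfolding u(2) using lin(1)[OF fc(2) _ Suc.prems(3)] lin(2)[OF xc xc Suc.prems(3)] xc by simp
    then show ?case using xw u0w by simp
  qed
  show ?thesis
    unfolding isotropic_def
  proof (intro ballI)
    fix u w assume uw: "u \<in> G i" "w \<in> G i"
    have "(y ^\<^sub>m (q - i)) *\<^sub>v w \<in> G i"
      using nflag_pow[OF G y(1) i uw(2), of "q - i"] nflag_mono[OF G _ i, of "i - (q - i)"] by auto
    then show "\<omega> u w = 0" using main[OF i uw(1)] lin_subspaceD(6)[OF nflag_lin_subspace[OF G i] uw(2)] by simp
  qed
qed

section \<open>The equivariant embedding\<close>

lemma nmat_unit_vec:
  assumes "j < a + b"
  shows "nmat a b *\<^sub>v unit_vec (a + b) j =
    (if j = 0 \<or> j = a then 0\<^sub>v (a + b) else unit_vec (a + b) (j - 1))"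
proof (rule eq_vecI)
  fix i assume "i < dim_vec (if j = 0 \<or> j = a then 0\<^sub>v (a + b) else unit_vec (a + b) (j - 1) :: complex vec)"
  then have i: "i < a + b" by (simp split: if_splits)
  show "(nmat a b *\<^sub>v unit_vec (a + b) j) $ i =
      (if j = 0 \<or> j = a then 0\<^sub>v (a + b) else unit_vec (a + b) (j - 1)) $ i"
    unfolding nmat_index[OF unit_vec_carrier i] using i assms by (auto simp: unit_vec_def)
qed (simp add: nmat_def)

text \<open>Divides \<open>u\<close> by the \<open>m\<close>-th power and keeps exact control of the
  height, which rises from \<open>p\<close> to \<open>p + m\<close>. For \<open>p > 0\<close> any
  preimage works.\<close>

lemma ex_generator_over:
  assumes u: "u \<in> carrier_vec (2 * q)" "(zmat q ^\<^sub>m p) *\<^sub>v u = 0\<^sub>v (2 * q)"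
    "p > 0 \<Longrightarrow> (zmat q ^\<^sub>m (p - 1)) *\<^sub>v u \<noteq> 0\<^sub>v (2 * q)" and a: "p + m \<le> q"
  obtains g where "g \<in> block q (p + m) (p + m)" "(zmat q ^\<^sub>m m) *\<^sub>v g = u"
    "p + m > 0 \<Longrightarrow> (zmat q ^\<^sub>m (p + m - 1)) *\<^sub>v g \<noteq> 0\<^sub>v (2 * q)"
proof (cases "p = 0")
  case True
  \<comment> \<open>For \<open>p = 0\<close> the vector \<open>u\<close> is zero, and a preimage of
    height exactly \<open>m\<close> has to be chosen: \<open>evec q m\<close>.\<close>
  have g: "evec q m \<in> block q m m" using a True by (intro evec_block) auto
  have "u = 0\<^sub>v (2 * q)" using u(1,2) True zpow(2) by simp
  then have "(zmat q ^\<^sub>m m) *\<^sub>v evec q m = u"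
    using zpow_block[OF g, of m] a True by (simp add: block_00)
  moreover have "(zmat q ^\<^sub>m (m - 1)) *\<^sub>v evec q m \<noteq> 0\<^sub>v (2 * q)" if "m > 0"
  proof
    assume "(zmat q ^\<^sub>m (m - 1)) *\<^sub>v evec q m = 0\<^sub>v (2 * q)"
    then have "((zmat q ^\<^sub>m (m - 1)) *\<^sub>v evec q m) $ 0 = 0" using that a True by simp
    moreover have "evec q m $ (m - 1) = 1" using evec_index[of m q "m - 1"] that a True by simp
    ultimately show False
      using zmat_pow_index[of "evec q m" q 0 "m - 1"] that a True by (auto split: if_splits)
  qed
  ultimately show thesis using that[of "evec q m"] g True by simp
next
  case False
  have "(zmat q ^\<^sub>m p) *\<^sub>v u \<in> block q 0 0" using u(2) by (simp add: block_00)
  then have "u \<in> block q (0 + p) (0 + p)" using a by (intro zpow_in_block[OF u(1)]) auto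
  then have "u \<in> block q (p + m - m) (p + m - m)" by simp
  then obtain g where g: "g \<in> block q (p + m) (p + m)" "(zmat q ^\<^sub>m m) *\<^sub>v g = u"
    by (rule block_zpow_surj) (use a in auto)
  have "(zmat q ^\<^sub>m (p + m - 1)) *\<^sub>v g = (zmat q ^\<^sub>m (p - 1)) *\<^sub>v u"
    using zpow(5)[OF block_carrier[OF g(1)], of "p - 1" m] g(2) False by simp
  then show thesis using that[OF g] u(3) False by simp
qed

text \<open>The chains of \<open>evec q b\<close> and \<open>fvec q b\<close> end in the independent
  vectors \<open>e_1\<close> and \<open>f_1\<close>, so at least one of them does not end on the
  line of \<open>t\<close>.\<close>

lemma ex_independent_generator:
  assumes "b \<le> q"
  obtains g where "g \<in> block q b b" "\<And>c. b > 0 \<Longrightarrow> (zmat q ^\<^sub>m (b - 1)) *\<^sub>v g \<noteq> c \<cdot>\<^sub>v t"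
proof (cases "b = 0")
  case True
  then show thesis using that[of "0\<^sub>v (2 * q)"] lin_subspaceD(2)[OF lin_subspace_block] by blast
next
  case False
  then have b: "0 < 2 * q" "q < 2 * q" "0 < b" using assms by auto
  have e: "((zmat q ^\<^sub>m (b - 1)) *\<^sub>v evec q b) $ 0 = 1" "((zmat q ^\<^sub>m (b - 1)) *\<^sub>v evec q b) $ q = 0"
    and f: "((zmat q ^\<^sub>m (b - 1)) *\<^sub>v fvec q b) $ q = 1"
    using zmat_pow_index[of "evec q b" q _ "b - 1"] zmat_pow_index[of "fvec q b" q _ "b - 1"] b assms
    by (auto simp: evec_index fvec_index)
  have "(zmat q ^\<^sub>m (b - 1)) *\<^sub>v fvec q b \<noteq> c' \<cdot>\<^sub>v t" if ec: "(zmat q ^\<^sub>m (b - 1)) *\<^sub>v evec q b = c \<cdot>\<^sub>v t" for c c'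
  proof
    assume fc: "(zmat q ^\<^sub>m (b - 1)) *\<^sub>v fvec q b = c' \<cdot>\<^sub>v t"
    have "dim_vec t = 2 * q" using arg_cong[OF ec, of dim_vec] carrier_vecD[OF zpow(1)[of "evec q b" q "b - 1"]] by simp
    then have "c * t $ 0 = 1" "c * t $ q = 0" "c' * t $ q = 1" using e f b unfolding ec fc by auto
    then show False by auto
  qed
  then show thesis
    using that[of "evec q b"] that[of "fvec q b"] evec_block[of b b q b] fvec_block[of b b q b] assms by blast
qed

text \<open>The columns of \<open>M\<close> are the chains below \<open>g\<close> and
  \<open>h\<close>. A nonzero vector killed by \<open>M\<close> could be moved by
  \<open>nmat a b\<close> into the kernel of \<open>nmat a b\<close> while staying killed by
  \<open>M\<close>, so injectivity has to be checked only on that kernel.\<close>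

lemma ex_embedding:
  assumes u: "u \<in> carrier_vec (2 * q)" "(zmat q ^\<^sub>m p) *\<^sub>v u = 0\<^sub>v (2 * q)"
    "p > 0 \<Longrightarrow> (zmat q ^\<^sub>m (p - 1)) *\<^sub>v u \<noteq> 0\<^sub>v (2 * q)"
    and a: "a = p + m" "a \<le> q" "b \<le> a"
  obtains M c where "M \<in> carrier_mat (2 * q) (a + b)" "inj_mat (2 * q) (a + b) M"
    "\<And>w. w \<in> carrier_vec (a + b) \<Longrightarrow> M *\<^sub>v (nmat a b *\<^sub>v w) = zmat q *\<^sub>v (M *\<^sub>v w)"
    "c \<in> carrier_vec (a + b)" "u = (zmat q ^\<^sub>m m) *\<^sub>v (M *\<^sub>v c)"
proof -
  let ?n = "a + b"
  obtain g where g: "g \<in> block q a a" "(zmat q ^\<^sub>m m) *\<^sub>v g = u"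
    "a > 0 \<Longrightarrow> (zmat q ^\<^sub>m (a - 1)) *\<^sub>v g \<noteq> 0\<^sub>v (2 * q)"
    using ex_generator_over[OF u, of m] a by metis
  have bq: "b \<le> q" using a by simp
  obtain h where h: "h \<in> block q b b" "\<And>c. b > 0 \<Longrightarrow> (zmat q ^\<^sub>m (b - 1)) *\<^sub>v h \<noteq> c \<cdot>\<^sub>v ((zmat q ^\<^sub>m (a - 1)) *\<^sub>v g)"
    using ex_independent_generator[OF bq] by blast
  have gc: "g \<in> carrier_vec (2 * q)" and hcv: "h \<in> carrier_vec (2 * q)" using g(1) h(1) block_carrier by auto
  have g0: "(zmat q ^\<^sub>m a) *\<^sub>v g = 0\<^sub>v (2 * q)" using zpow_block[OF g(1) a(2) a(2), of a] by (simp add: block_00)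
  have h0: "(zmat q ^\<^sub>m b) *\<^sub>v h = 0\<^sub>v (2 * q)" using zpow_block[OF h(1) bq bq, of b] by (simp add: block_00)
  \<comment> \<open>Each chain is listed from its bottom upwards, so that the shift lowers the
    column index; exponent 0 occurs at columns \<open>a - 1\<close> and
    \<open>a + b - 1\<close>.\<close>
  define v where "v j = (if j < a then (zmat q ^\<^sub>m (a - 1 - j)) *\<^sub>v g else (zmat q ^\<^sub>m (a + b - 1 - j)) *\<^sub>v h)" for j
  have vc: "v j \<in> carrier_vec (2 * q)" for j unfolding v_def using zpow(1) gc hcv by auto
  define M where "M = mat (2 * q) ?n (\<lambda>(i, j). v j $ i)"
  have M: "M \<in> carrier_mat (2 * q) ?n" unfolding M_def by simp
  have Mu: "M *\<^sub>v unit_vec ?n j = v j" if "j < ?n" for j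
  proof -
    have "col M j = v j" unfolding M_def using that vc[of j] by (intro eq_vecI) auto
    then show ?thesis using mult_mat_unit_vec[OF M that] by simp
  qed
  have zv: "zmat q *\<^sub>v v j = (if j = 0 \<or> j = a then 0\<^sub>v (2 * q) else v (j - 1))" if j: "j < ?n" for j
  proof (cases "j < a")
    case True
    then have "zmat q *\<^sub>v v j = (zmat q ^\<^sub>m Suc (a - 1 - j)) *\<^sub>v g" unfolding v_def zpow(4)[OF gc] by simp
    also have "Suc (a - 1 - j) = a - j" using True by simp
    finally show ?thesis using True g0 unfolding v_def by (cases j) auto
  next
    case False
    then have "zmat q *\<^sub>v v j = (zmat q ^\<^sub>m Suc (a + b - 1 - j)) *\<^sub>v h" unfolding v_def zpow(4)[OF hcv] by simp
    also have "Suc (a + b - 1 - j) = a + b - j" using False j by simp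
    finally have *: "zmat q *\<^sub>v v j = (zmat q ^\<^sub>m (a + b - j)) *\<^sub>v h" .
    show ?thesis
    proof (cases "j = a")
      case True
      then show ?thesis using * h0 by simp
    next
      case ja: False
      then have "\<not> j - 1 < a" "j \<noteq> 0" "a + b - 1 - (j - 1) = a + b - j" using False j by linarith+
      then show ?thesis using * ja unfolding v_def by simp
    qed
  qed
  have zero: "M *\<^sub>v 0\<^sub>v ?n = 0\<^sub>v (2 * q)" using M by (intro eq_vecI) (auto simp: scalar_prod_def)
  have MJ: "M * nmat a b = zmat q * M"
  proof (rule eq_matI)
    fix i j assume "i < dim_row (zmat q * M)" "j < dim_col (zmat q * M)"
    then have ij: "i < 2 * q" "j < ?n" using M zmat_carrier[of q] by auto
    have "M *\<^sub>v (nmat a b *\<^sub>v unit_vec ?n j) = zmat q *\<^sub>v (M *\<^sub>v unit_vec ?n j)"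
      unfolding nmat_unit_vec[OF ij(2)] Mu[OF ij(2)] zv[OF ij(2)] using Mu[of "j - 1"] ij(2) zero by auto
    then have "(M * nmat a b) *\<^sub>v unit_vec ?n j = (zmat q * M) *\<^sub>v unit_vec ?n j"
      using assoc_mult_mat_vec[OF M nmat_carrier] assoc_mult_mat_vec[OF zmat_carrier M] by simp
    moreover have c: "M * nmat a b \<in> carrier_mat (2 * q) ?n" "zmat q * M \<in> carrier_mat (2 * q) ?n"
      using M zmat_carrier[of q] nmat_carrier[of a b] by auto
    ultimately have "col (M * nmat a b) j = col (zmat q * M) j"
      using mult_mat_unit_vec[OF c(1) ij(2)] mult_mat_unit_vec[OF c(2) ij(2)] by simp
    then show "(M * nmat a b) $$ (i, j) = (zmat q * M) $$ (i, j)"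
      using c ij by (metis carrier_matD index_col)
  qed (use M in \<open>auto simp: zmat_def nmat_def\<close>)
  have int: "M *\<^sub>v (nmat a b *\<^sub>v w) = zmat q *\<^sub>v (M *\<^sub>v w)" if "w \<in> carrier_vec ?n" for w
    using assoc_mult_mat_vec[OF M nmat_carrier that] assoc_mult_mat_vec[OF zmat_carrier M that] MJ by simp
  \<comment> \<open>The kernel of \<open>nmat a b\<close> is spanned by the first vector of each
    string; their images, the bottoms of the two chains, are independent by the choice of
    \<open>h\<close>.\<close>
  have socle: "d = 0\<^sub>v ?n" if d: "d \<in> carrier_vec ?n" "nmat a b *\<^sub>v d = 0\<^sub>v ?n" "M *\<^sub>v d = 0\<^sub>v (2 * q)" for d
  proof (cases "a = 0")
    case True
    then show ?thesis using d(1) a by auto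
  next
    case False
    have other: "d $ i = 0" if "i < ?n" "i \<noteq> 0" "i \<noteq> a" for i
    proof -
      have "(nmat a b *\<^sub>v d) $ (i - 1) = d $ i" using nmat_index[OF d(1), of "i - 1"] that by simp
      then show ?thesis using d(2) that by simp
    qed
    \<comment> \<open>For \<open>b = 0\<close> the index \<open>a\<close> lies outside the vector,
      so the second coefficient is set to 0.\<close>
    define s where "s = (if b = 0 then 0 else d $ a)"
    have "d = d $ 0 \<cdot>\<^sub>v unit_vec ?n 0 + s \<cdot>\<^sub>v (if b = 0 then 0\<^sub>v ?n else unit_vec ?n a)"
      using d(1) other False unfolding s_def by (intro eq_vecI) (auto simp: unit_vec_def)
    then have "M *\<^sub>v d = M *\<^sub>v (d $ 0 \<cdot>\<^sub>v unit_vec ?n 0 + s \<cdot>\<^sub>v (if b = 0 then 0\<^sub>v ?n else unit_vec ?n a))"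
      by (rule arg_cong)
    also have "\<dots> = d $ 0 \<cdot>\<^sub>v (M *\<^sub>v unit_vec ?n 0) + s \<cdot>\<^sub>v (M *\<^sub>v (if b = 0 then 0\<^sub>v ?n else unit_vec ?n a))"
      by (subst mult_add_distrib_mat_vec[OF M]) (auto simp: mult_mat_vec[OF M])
    finally have eq: "d $ 0 \<cdot>\<^sub>v v 0 + s \<cdot>\<^sub>v (if b = 0 then 0\<^sub>v (2 * q) else v a) = 0\<^sub>v (2 * q)"
      using d(3) Mu[of 0] Mu[of a] zero False by (auto split: if_splits)
    have v0: "v 0 = (zmat q ^\<^sub>m (a - 1)) *\<^sub>v g" and va: "v a = (zmat q ^\<^sub>m (b - 1)) *\<^sub>v h"
      unfolding v_def using False by auto
    have eqi: "d $ 0 * v 0 $ i + s * (if b = 0 then 0\<^sub>v (2 * q) else v a) $ i = 0" if "i < 2 * q" for i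
      using arg_cong[OF eq, of "\<lambda>w. w $ i"] that vc[of 0] vc[of a] by (auto split: if_splits)
    have s0: "s = 0"
    proof (rule ccontr)
      assume s: "s \<noteq> 0"
      then have b: "b > 0" unfolding s_def by (auto split: if_splits)
      have vi: "v a $ i = - (d $ 0 / s) * v 0 $ i" if "i < 2 * q" for i
        using eqi[OF that] b s by (simp add: field_simps eq_neg_iff_add_eq_0)
      have "v a = (- (d $ 0 / s)) \<cdot>\<^sub>v v 0"
      proof (rule eq_vecI)
        fix i assume "i < dim_vec ((- (d $ 0 / s)) \<cdot>\<^sub>v v 0)"
        then have i: "i < 2 * q" "i < dim_vec (v 0)" using vc[of 0] by auto
        show "v a $ i = ((- (d $ 0 / s)) \<cdot>\<^sub>v v 0) $ i"
          unfolding index_smult_vec(1)[OF i(2)] by (rule vi[OF i(1)])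
      qed (simp add: carrier_vecD[OF vc])
      then show False unfolding v0 va by (rule notE[OF h(2)[OF b]])
    qed
    have "d $ 0 = 0"
    proof (rule ccontr)
      assume d0: "d $ 0 \<noteq> 0"
      have vi: "v 0 $ i = 0" if "i < 2 * q" for i using eqi[OF that] s0 d0 by simp
      have "v 0 = 0\<^sub>v (2 * q)"
        by (rule eq_vecI) (simp_all add: vi carrier_vecD[OF vc])
      then show False using g(3) False unfolding v0 by simp
    qed
    moreover have "d $ a = 0" if "a < ?n" using s0 that unfolding s_def by (auto split: if_splits)
    ultimately have di: "d $ i = 0" if "i < ?n" for i
      using other[OF that] that by (cases "i = 0"; cases "i = a") auto
    show ?thesis by (rule eq_vecI) (simp_all add: di carrier_vecD[OF d(1)])
  qed
  have "inj_mat (2 * q) ?n M"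
    unfolding inj_mat_def
  proof (intro conjI ballI impI M)
    fix c assume c: "c \<in> carrier_vec ?n" "M *\<^sub>v c = 0\<^sub>v (2 * q)"
    show "c = 0\<^sub>v ?n"
    proof (rule ccontr)
      assume nz: "c \<noteq> 0\<^sub>v ?n"
      note p = pow_mult_vec[OF nmat_carrier c(1)]
      \<comment> \<open>The last nonzero power, with exponent \<open>t - 1\<close>, is the vector to
        which \<open>socle\<close> applies.\<close>
      define t where "t = (LEAST t. (nmat a b ^\<^sub>m t) *\<^sub>v c = 0\<^sub>v ?n)"
      have "(nmat a b ^\<^sub>m ?n) *\<^sub>v c = 0\<^sub>v ?n"
        using carrier_vecD[OF p(1)[of ?n]] nmat_pow_index[OF c(1), of _ ?n] by (intro eq_vecI) auto
      then have t: "(nmat a b ^\<^sub>m t) *\<^sub>v c = 0\<^sub>v ?n" unfolding t_def by (rule LeastI)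
      have t0: "t > 0" using t nz p(2) by (cases t) auto
      have "(nmat a b ^\<^sub>m (t - 1)) *\<^sub>v c \<noteq> 0\<^sub>v ?n"
        using not_less_Least[of "t - 1" "\<lambda>t. (nmat a b ^\<^sub>m t) *\<^sub>v c = 0\<^sub>v ?n"] t0 unfolding t_def by simp
      moreover have "nmat a b *\<^sub>v ((nmat a b ^\<^sub>m (t - 1)) *\<^sub>v c) = 0\<^sub>v ?n" using p(4)[of "t - 1"] t t0 by simp
      moreover have "M *\<^sub>v ((nmat a b ^\<^sub>m (t - 1)) *\<^sub>v c) = 0\<^sub>v (2 * q)"
        using pow_intertwine[OF M nmat_carrier zmat_carrier int c(1), of "t - 1"] c(2)
          pow_mult_linear(4)[OF zmat_carrier zero_carrier_vec zero_carrier_vec] by simp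
      ultimately show False using socle[OF p(1)] by blast
    qed
  qed
  moreover have "\<exists>c\<in>carrier_vec ?n. u = (zmat q ^\<^sub>m m) *\<^sub>v (M *\<^sub>v c)"
  proof (cases "a = 0")
    case True
    then have "u = 0\<^sub>v (2 * q)" using u(1,2) a(1) zpow(2) by simp
    moreover have "(zmat q ^\<^sub>m m) *\<^sub>v 0\<^sub>v (2 * q) = 0\<^sub>v (2 * q)"
      by (rule pow_mult_linear(4)[OF zmat_carrier zero_carrier_vec zero_carrier_vec])
    ultimately show ?thesis using zero by (intro bexI[of _ "0\<^sub>v ?n"]) auto
  next
    case False
    then have "M *\<^sub>v unit_vec ?n (a - 1) = g" using Mu[of "a - 1"] zpow(2)[OF gc] unfolding v_def by simp
    then show ?thesis using g(2) by (intro bexI[of _ "unit_vec ?n (a - 1)"]) auto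
  qed
  ultimately show thesis using that[OF M _ int] by blast
qed

section \<open>The isomorphism onto a closed subvariety\<close>

text \<open>Injectivity is required only on \<open>W\<close>, since a left inverse of an embedding
  may have a kernel elsewhere.\<close>

lemma subspace_of_dim_image:
  assumes M: "M \<in> carrier_mat d' d" and W: "subspace_of_dim d i W"
    and inj: "\<And>w. w \<in> W \<Longrightarrow> M *\<^sub>v w = 0\<^sub>v d' \<Longrightarrow> w = 0\<^sub>v d"
  shows "subspace_of_dim d' i ((*\<^sub>v) M ` W)"
proof -
  obtain A where A: "inj_mat d i A" "W = mat_range A" using W subspace_of_dim_iff by blast
  have cA: "A \<in> carrier_mat d i" using A(1) by (rule inj_mat_carrier)
  have MA: "M * A \<in> carrier_mat d' i" using M cA by auto
  have eq: "(M * A) *\<^sub>v c = M *\<^sub>v (A *\<^sub>v c)" if "c \<in> carrier_vec i" for c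
    by (rule assoc_mult_mat_vec[OF M cA that])
  have "inj_mat d' i (M * A)"
    unfolding inj_mat_def
  proof (intro conjI ballI impI MA)
    fix c assume c: "c \<in> carrier_vec i" "(M * A) *\<^sub>v c = 0\<^sub>v d'"
    have "A *\<^sub>v c \<in> W" unfolding A(2) mat_range_def using c(1) cA by auto
    then have "A *\<^sub>v c = 0\<^sub>v d" using inj c eq[OF c(1)] by simp
    then show "c = 0\<^sub>v i" using A(1) c(1) unfolding inj_mat_def by blast
  qed
  moreover have "(*\<^sub>v) M ` W = mat_range (M * A)"
  proof -
    have "mat_range B = (*\<^sub>v) B ` carrier_vec i" if "B \<in> carrier_mat b i" for B b
      unfolding mat_range_def using that by blast
    note this[OF cA] this[OF MA]
    then show ?thesis unfolding A(2) by (simp only: image_image) (rule image_cong[OF refl], simp only: eq)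
  qed
  ultimately show ?thesis using subspace_of_dim_iff by blast
qed

text \<open>All members lie in the last one, so injectivity and the intertwining relation are asked
  for only there.\<close>

lemma nflag_map_flag:
  assumes M: "M \<in> carrier_mat d' d" and F: "nflag d x r ((!) F)" "length F = Suc r"
    and inj: "\<And>w. w \<in> F ! r \<Longrightarrow> M *\<^sub>v w = 0\<^sub>v d' \<Longrightarrow> w = 0\<^sub>v d"
    and int: "\<And>w. w \<in> F ! r \<Longrightarrow> M *\<^sub>v (x *\<^sub>v w) = y *\<^sub>v (M *\<^sub>v w)"
  shows "map_flag M F \<in> nilp_flags d' r y"
proof -
  have nth: "map_flag M F ! i = (*\<^sub>v) M ` (F ! i)" if "i \<le> r" for i
    unfolding map_flag_def using F(2) that by simp
  have sub: "F ! i \<subseteq> F ! r" if "i \<le> r" for i using nflag_mono[OF F(1) that] by simp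
  have "map_flag M F ! 0 = {0\<^sub>v d'}"
  proof -
    have "M *\<^sub>v 0\<^sub>v d = 0\<^sub>v d'" using M by (intro eq_vecI) (auto simp: scalar_prod_def)
    then show ?thesis using nth[of 0] F(1) unfolding nflag_def by simp
  qed
  moreover have "subspace_of_dim d' i (map_flag M F ! i)" if "i \<in> {1..r}" for i
  proof -
    have i: "i \<le> r" using that by simp
    show ?thesis
      unfolding nth[OF i] by (rule subspace_of_dim_image[OF M nflag_dim[OF F(1) i]]) (use inj sub[OF i] in blast)
  qed
  moreover have "map_flag M F ! (i - 1) \<subseteq> map_flag M F ! i" if "i \<in> {1..r}" for i
  proof -
    have "i \<le> r" "i - 1 \<le> r" "i - 1 \<le> i" using that by auto
    then show ?thesis using nth nflag_mono[OF F(1)] by (simp only: image_mono)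
  qed
  moreover have "y *\<^sub>v w \<in> map_flag M F ! (i - 1)" if i: "i \<in> {1..r}" and w: "w \<in> map_flag M F ! i" for i w
  proof -
    have ir: "i \<le> r" "i - 1 \<le> r" using i by auto
    obtain v where v: "v \<in> F ! i" "w = M *\<^sub>v v" using w unfolding nth[OF ir(1)] by blast
    have "x *\<^sub>v v \<in> F ! (i - 1)" using F(1) i v(1) unfolding nflag_def by blast
    moreover have "y *\<^sub>v w = M *\<^sub>v (x *\<^sub>v v)" unfolding v(2) using int[of v] v(1) sub[OF ir(1)] by auto
    ultimately show ?thesis unfolding nth[OF ir(2)] by blast
  qed
  moreover have "length (map_flag M F) = Suc r" unfolding map_flag_def using F(2) by simp
  ultimately show ?thesis unfolding nilp_flags_iff nflag_def by blast
qed

lemma map_flag_inverse: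
  assumes "nflag d x r ((!) F)" "length F = Suc r" "\<And>w. w \<in> F ! r \<Longrightarrow> L *\<^sub>v (M *\<^sub>v w) = w"
  shows "map_flag L (map_flag M F) = F"
proof -
  have "(*\<^sub>v) L ` (*\<^sub>v) M ` W = W" if "W \<in> set F" for W
  proof -
    obtain i where i: "i \<le> r" "W = F ! i" using \<open>W \<in> set F\<close> assms(2) by (auto simp: in_set_conv_nth less_Suc_eq_le)
    have "L *\<^sub>v (M *\<^sub>v w) = w" if "w \<in> W" for w
      using assms(3) that nflag_mono[OF assms(1) i(1) order_refl] unfolding i(2) by blast
    then show ?thesis by (simp add: image_image)
  qed
  then show ?thesis unfolding map_flag_def by (simp add: map_idI)
qed

lemma subspace_of_dim_full: "subspace_of_dim d d (carrier_vec d)"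
proof -
  have "inj_mat d d (1\<^sub>m d)" unfolding inj_mat_def by auto
  moreover have "mat_range (1\<^sub>m d) = carrier_vec d"
  proof
    show "mat_range (1\<^sub>m d) \<subseteq> carrier_vec d" unfolding mat_range_def by auto
    show "carrier_vec d \<subseteq> mat_range (1\<^sub>m d)"
    proof
      fix w :: "complex vec" assume "w \<in> carrier_vec d"
      then show "w \<in> mat_range (1\<^sub>m d)" unfolding mat_range_def by (intro CollectI exI[of _ w]) simp
    qed
  qed
  ultimately show ?thesis unfolding subspace_of_dim_iff by metis
qed

text \<open>The codimension argument with the whole space in place of the block:
  \<open>F ! (n - m)\<close> has codimension \<open>m\<close> in it.\<close>

lemma delta_springer_eq_nilp_flags:
  assumes x: "x \<in> carrier_mat n n" and nil: "\<And>w. w \<in> carrier_vec n \<Longrightarrow> (x ^\<^sub>m l) *\<^sub>v w = 0\<^sub>v n"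
    and m: "m \<le> n"
  shows "delta_springer n m x = nilp_flags n (n - m) x"
proof -
  have "(x ^\<^sub>m m) *\<^sub>v w \<in> F ! (n - m)" if F: "F \<in> nilp_flags n (n - m) x" and w: "w \<in> carrier_vec n" for F w
  proof -
    have fl: "nflag n x (n - m) ((!) F)" using F nilp_flags_iff by blast
    have dim: "subspace_of_dim n (n - m + m) (carrier_vec n)" using subspace_of_dim_full m by simp
    have inv: "mat_invariant x (carrier_vec n)" unfolding mat_invariant_def using x by auto
    note lW = nflag_lin_subspace[OF fl order_refl]
    show ?thesis
      using codim_pow_mem[OF x dim inv nflag_dim[OF fl order_refl] nflag_invariant[OF fl x order_refl]
          lin_subspaceD(1)[OF lW] w] nil[OF w] lin_subspaceD(2)[OF lW] by metis
  qed
  then show ?thesis unfolding delta_springer_def by blast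
qed

text \<open>Both \<open>x\<close> and \<open>y\<close> are conjugated to their models and
  \<open>ex_embedding\<close> is applied in between. The description of \<open>v\<close> as an
  \<open>m\<close>-th power over the image is what later ties \<open>v\<close> to the image of the
  \<open>m\<close>-th power of \<open>x\<close>.\<close>

lemma ex_equivariant_embedding:
  assumes mk: "m \<le> k" "k \<le> n div 2"
    and x: "x \<in> carrier_mat n n" "nilp_jordan_type x [n - k, k]"
    and yv: "one_row_exotic_pair (n - m) (n - m - k) \<omega> y v"
  obtains M L c where "M \<in> carrier_mat (2 * (n - m)) n" "L \<in> carrier_mat n (2 * (n - m))"
    "\<And>w. w \<in> carrier_vec n \<Longrightarrow> L *\<^sub>v (M *\<^sub>v w) = w"
    "\<And>w. w \<in> carrier_vec n \<Longrightarrow> M *\<^sub>v (x *\<^sub>v w) = y *\<^sub>v (M *\<^sub>v w)"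
    "c \<in> carrier_vec n" "v = (y ^\<^sub>m m) *\<^sub>v (M *\<^sub>v c)"
    "\<And>w. w \<in> carrier_vec n \<Longrightarrow> (x ^\<^sub>m (n - m)) *\<^sub>v w = 0\<^sub>v n"
proof -
  define q where "q = n - m"
  define p where "p = q - k"
  have y: "y \<in> carrier_mat (2 * q) (2 * q)" "nilp_jordan_type y [q, q]" "v \<in> carrier_vec (2 * q)"
    "(y ^\<^sub>m p) *\<^sub>v v = 0\<^sub>v (2 * q)" "p > 0 \<Longrightarrow> (y ^\<^sub>m (p - 1)) *\<^sub>v v \<noteq> 0\<^sub>v (2 * q)"
    using yv unfolding one_row_exotic_pair_def q_def p_def by auto
  \<comment> \<open>The longer string has length \<open>n - k\<close>, the height \<open>p\<close>
    of \<open>v\<close> plus \<open>m\<close>, and \<open>m \<le> k\<close> keeps it within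
    \<open>q\<close>.\<close>
  have nk: "n - k + k = n" "n - k = p + m" "n - k \<le> q" "k \<le> n - k"
    using mk unfolding q_def p_def by linarith+
  have y': "y \<in> carrier_mat (q + q) (q + q)" using y(1) by (simp add: mult_2)
  obtain Q R where QR: "Q \<in> carrier_mat (2 * q) (2 * q)" "R \<in> carrier_mat (2 * q) (2 * q)"
    "\<And>w. w \<in> carrier_vec (2 * q) \<Longrightarrow> Q *\<^sub>v (R *\<^sub>v w) = w"
    "\<And>w. w \<in> carrier_vec (2 * q) \<Longrightarrow> R *\<^sub>v (Q *\<^sub>v w) = w"
    "\<And>w. w \<in> carrier_vec (2 * q) \<Longrightarrow> y *\<^sub>v (Q *\<^sub>v w) = Q *\<^sub>v (zmat q *\<^sub>v w)"
    by (rule two_block_conjugation[OF y' y(2)]) (simp add: mult_2 zmat_eq_nmat)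
  have Qpow: "Q *\<^sub>v ((zmat q ^\<^sub>m s) *\<^sub>v w) = (y ^\<^sub>m s) *\<^sub>v (Q *\<^sub>v w)" if "w \<in> carrier_vec (2 * q)" for w s
    by (rule pow_intertwine[OF QR(1) zmat_carrier y(1) QR(5)[symmetric] that])
  have x': "x \<in> carrier_mat (n - k + k) (n - k + k)" using x(1) nk(1) by simp
  obtain P S where PS: "P \<in> carrier_mat n n" "S \<in> carrier_mat n n"
    "\<And>w. w \<in> carrier_vec n \<Longrightarrow> P *\<^sub>v (S *\<^sub>v w) = w"
    "\<And>w. w \<in> carrier_vec n \<Longrightarrow> S *\<^sub>v (P *\<^sub>v w) = w"
    "\<And>w. w \<in> carrier_vec n \<Longrightarrow> x *\<^sub>v (P *\<^sub>v w) = P *\<^sub>v (nmat (n - k) k *\<^sub>v w)"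
    by (rule two_block_conjugation[OF x' x(2)]) (simp add: nk(1))
  have zero: "A *\<^sub>v 0\<^sub>v b = 0\<^sub>v a" if "A \<in> carrier_mat a b" for A :: "complex mat" and a b
    using that by (intro eq_vecI) (auto simp: scalar_prod_def)
  define u where "u = R *\<^sub>v v"
  have u: "u \<in> carrier_vec (2 * q)" "Q *\<^sub>v u = v" unfolding u_def using QR(2,3) y(3) by auto
  have "R *\<^sub>v (Q *\<^sub>v ((zmat q ^\<^sub>m p) *\<^sub>v u)) = R *\<^sub>v 0\<^sub>v (2 * q)" using Qpow[OF u(1), of p] u(2) y(4) by simp
  then have up: "(zmat q ^\<^sub>m p) *\<^sub>v u = 0\<^sub>v (2 * q)"
    using QR(4)[OF zpow(1)[OF u(1)], of p] zero[OF QR(2)] by simp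
  have up': "(zmat q ^\<^sub>m (p - 1)) *\<^sub>v u \<noteq> 0\<^sub>v (2 * q)" if "p > 0"
    using Qpow[OF u(1), of "p - 1"] u(2) y(5)[OF that] zero[OF QR(1)] by metis
  obtain T e where T: "T \<in> carrier_mat (2 * q) n" "inj_mat (2 * q) n T"
    "\<And>w. w \<in> carrier_vec n \<Longrightarrow> T *\<^sub>v (nmat (n - k) k *\<^sub>v w) = zmat q *\<^sub>v (T *\<^sub>v w)"
    "e \<in> carrier_vec n" "u = (zmat q ^\<^sub>m m) *\<^sub>v (T *\<^sub>v e)"
    by (rule ex_embedding[OF u(1) up up' nk(2,3,4)]) (simp_all add: nk(1))
  \<comment> \<open>\<open>S\<close> straightens \<open>x\<close>, \<open>T\<close> embeds the
    models, and \<open>Q\<close> turns the model \<open>zmat q\<close> into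
    \<open>y\<close>.\<close>
  define M where "M = Q * (T * S)"
  have TS: "T * S \<in> carrier_mat (2 * q) n" using T(1) PS(2) by auto
  have M: "M \<in> carrier_mat (2 * q) n" unfolding M_def using QR(1) TS by auto
  have Mw: "M *\<^sub>v w = Q *\<^sub>v (T *\<^sub>v (S *\<^sub>v w))" if "w \<in> carrier_vec n" for w
    unfolding M_def using assoc_mult_mat_vec[OF QR(1) TS that] assoc_mult_mat_vec[OF T(1) PS(2) that] by simp
  have Tc: "T *\<^sub>v w \<in> carrier_vec (2 * q)" and Sc: "S *\<^sub>v w \<in> carrier_vec n" and Pc: "P *\<^sub>v w \<in> carrier_vec n"
    if "w \<in> carrier_vec n" for w using T(1) PS(1,2) that by auto
  have "inj_mat (2 * q) n M"
    unfolding inj_mat_def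
  proof (intro conjI ballI impI M)
    fix w assume w: "w \<in> carrier_vec n" "M *\<^sub>v w = 0\<^sub>v (2 * q)"
    then have "T *\<^sub>v (S *\<^sub>v w) = R *\<^sub>v 0\<^sub>v (2 * q)" using Mw[OF w(1)] QR(4)[OF Tc[OF Sc[OF w(1)]]] by simp
    then have "S *\<^sub>v w = 0\<^sub>v n" using T(2) Sc[OF w(1)] zero[OF QR(2)] unfolding inj_mat_def by simp
    then show "w = 0\<^sub>v n" using PS(3)[OF w(1)] zero[OF PS(1)] by simp
  qed
  then obtain L where L: "L \<in> carrier_mat n (2 * q)" "L * M = 1\<^sub>m n" by (rule inj_mat_left_inverse)
  have LM: "L *\<^sub>v (M *\<^sub>v w) = w" if "w \<in> carrier_vec n" for w
    using assoc_mult_mat_vec[OF L(1) M that] L(2) that by simp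
  have int: "M *\<^sub>v (x *\<^sub>v w) = y *\<^sub>v (M *\<^sub>v w)" if w: "w \<in> carrier_vec n" for w
  proof -
    have nc: "nmat (n - k) k *\<^sub>v (S *\<^sub>v w) \<in> carrier_vec n"
      using nmat_carrier[of "n - k" k] Sc[OF w] nk(1) by (metis mult_mat_vec_carrier)
    have "x *\<^sub>v w = P *\<^sub>v (nmat (n - k) k *\<^sub>v (S *\<^sub>v w))" using PS(5)[OF Sc[OF w]] PS(3)[OF w] by simp
    then have "M *\<^sub>v (x *\<^sub>v w) = Q *\<^sub>v (T *\<^sub>v (nmat (n - k) k *\<^sub>v (S *\<^sub>v w)))"
      using Mw[OF Pc[OF nc]] PS(4)[OF nc] by simp
    also have "\<dots> = y *\<^sub>v (M *\<^sub>v w)"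
      using T(3)[OF Sc[OF w]] QR(5)[OF Tc[OF Sc[OF w]]] Mw[OF w] by simp
    finally show ?thesis .
  qed
  have vc: "v = (y ^\<^sub>m m) *\<^sub>v (M *\<^sub>v (P *\<^sub>v e))"
    using Mw[OF Pc[OF T(4)]] PS(4)[OF T(4)] Qpow[OF Tc[OF T(4)], of m] T(5) u(2) by simp
  \<comment> \<open>Both blocks of \<open>y\<close> have size \<open>q\<close>, so its
    \<open>q\<close>-th power vanishes, and injectivity of \<open>M\<close> carries this back to
    \<open>x\<close>.\<close>
  have nil: "(x ^\<^sub>m q) *\<^sub>v w = 0\<^sub>v n" if w: "w \<in> carrier_vec n" for w
  proof -
    note xw = pow_mult_vec(1)[OF x(1) w, of q]
    have "M *\<^sub>v ((x ^\<^sub>m q) *\<^sub>v w) = (y ^\<^sub>m q) *\<^sub>v (Q *\<^sub>v (T *\<^sub>v (S *\<^sub>v w)))"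
      using pow_intertwine[OF M x(1) y(1) int w] Mw[OF w] by simp
    also have "\<dots> = Q *\<^sub>v ((zmat q ^\<^sub>m q) *\<^sub>v (T *\<^sub>v (S *\<^sub>v w)))" using Qpow[OF Tc[OF Sc[OF w]]] by simp
    also have "(zmat q ^\<^sub>m q) *\<^sub>v (T *\<^sub>v (S *\<^sub>v w)) = 0\<^sub>v (2 * q)"
      using zpow_block[of "T *\<^sub>v (S *\<^sub>v w)" q q q q] Tc[OF Sc[OF w]] by (simp add: block_NN block_00)
    finally have "M *\<^sub>v ((x ^\<^sub>m q) *\<^sub>v w) = 0\<^sub>v (2 * q)" using zero[OF QR(1)] by simp
    then show ?thesis using LM[OF xw] zero[OF L(1)] by simp
  qed
  show thesis using that[of M L "P *\<^sub>v e"] M L(1) LM int Pc[OF T(4)] vc nil unfolding q_def by blast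
qed

theorem delta_springer_closed_embedding:
  assumes mk: "m \<le> k" "k \<le> n div 2"
    and x: "x \<in> carrier_mat n n" "nilp_jordan_type x [n - k, k]"
    and \<omega>: "symplectic_form (2 * (n - m)) \<omega>"
    and yv: "one_row_exotic_pair (n - m) (n - m - k) \<omega> y v"
  shows "\<exists>Z \<phi>.
    closedin (subtopology (zariski_flags (2 * (n - m)) (n - m)) (exotic_springer (n - m) \<omega> y v)) Z \<and>
    variety_isomorphism n (n - m) (delta_springer n m x) (2 * (n - m)) (n - m) Z \<phi>"
proof -
  define q where "q = n - m"
  obtain M L c where emb: "M \<in> carrier_mat (2 * q) n" "L \<in> carrier_mat n (2 * q)"
    "\<And>w. w \<in> carrier_vec n \<Longrightarrow> L *\<^sub>v (M *\<^sub>v w) = w"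
    "\<And>w. w \<in> carrier_vec n \<Longrightarrow> M *\<^sub>v (x *\<^sub>v w) = y *\<^sub>v (M *\<^sub>v w)"
    "c \<in> carrier_vec n" "v = (y ^\<^sub>m m) *\<^sub>v (M *\<^sub>v c)"
    "\<And>w. w \<in> carrier_vec n \<Longrightarrow> (x ^\<^sub>m q) *\<^sub>v w = 0\<^sub>v n"
    unfolding q_def by (rule ex_equivariant_embedding[OF mk x yv]) blast
  have y: "y \<in> carrier_mat (2 * q) (2 * q)" "nilp_jordan_type y [q, q]"
    and adj: "\<forall>u\<in>carrier_vec (2 * q). \<forall>w\<in>carrier_vec (2 * q). \<omega> (y *\<^sub>v u) w = \<omega> u (y *\<^sub>v w)"
    using yv unfolding one_row_exotic_pair_def q_def by auto
  let ?X = "delta_springer n m x" and ?E = "exotic_springer q \<omega> y v"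
  \<comment> \<open>Since \<open>L\<close> is a left inverse of \<open>M\<close>, the product
    \<open>M * L\<close> is a projection onto the image of \<open>M\<close>, and the kernel of
    \<open>?K\<close> is exactly that image.\<close>
  let ?K = "1\<^sub>m (2 * q) - M * L"
  let ?Z = "{G \<in> ?E. \<forall>w\<in>G ! q. ?K *\<^sub>v w = 0\<^sub>v (2 * q)}"
  have mn: "m \<le> n" using mk by linarith
  have X: "?X = nilp_flags n q x" unfolding q_def by (rule delta_springer_eq_nilp_flags[OF x(1) emb(7)[unfolded q_def] mn])
  have E: "?E = {G \<in> nilp_flags (2 * q) q y. v \<in> G ! q}"
  proof -
    have "isotropic \<omega> (G ! i)" if "G \<in> nilp_flags (2 * q) q y" "i \<in> {1..q}" for G i
      using nflag_isotropic[OF \<omega>[folded q_def] y adj, of "(!) G" i] that unfolding nilp_flags_iff by auto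
    then show ?thesis unfolding exotic_springer_def by blast
  qed
  have zero: "L *\<^sub>v 0\<^sub>v (2 * q) = 0\<^sub>v n" "M *\<^sub>v 0\<^sub>v n = 0\<^sub>v (2 * q)"
    using emb(1,2) by (auto intro!: eq_vecI simp: scalar_prod_def)
  have MLc: "M * L \<in> carrier_mat (2 * q) (2 * q)" and K: "?K \<in> carrier_mat (2 * q) (2 * q)" using emb(1,2) by auto
  have Kw: "?K *\<^sub>v w = w - M *\<^sub>v (L *\<^sub>v w)" if "w \<in> carrier_vec (2 * q)" for w
    using minus_mult_distrib_mat_vec[OF one_carrier_mat MLc that] assoc_mult_mat_vec[OF emb(1,2) that] that by simp
  have K0: "?K *\<^sub>v w = 0\<^sub>v (2 * q) \<longleftrightarrow> M *\<^sub>v (L *\<^sub>v w) = w" if w: "w \<in> carrier_vec (2 * q)" for w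
  proof -
    have c: "M *\<^sub>v (L *\<^sub>v w) \<in> carrier_vec (2 * q)" using emb(1,2) w by auto
    show ?thesis
    proof
      assume z: "?K *\<^sub>v w = 0\<^sub>v (2 * q)"
      show "M *\<^sub>v (L *\<^sub>v w) = w"
      proof (rule eq_vecI)
        fix i assume "i < dim_vec w"
        then have i: "i < 2 * q" using w by simp
        then have "i < dim_vec (M *\<^sub>v (L *\<^sub>v w))" using carrier_vecD[OF c] by simp
        then have "(w - M *\<^sub>v (L *\<^sub>v w)) $ i = w $ i - (M *\<^sub>v (L *\<^sub>v w)) $ i"
          by (rule index_minus_vec(1))
        moreover have "(w - M *\<^sub>v (L *\<^sub>v w)) $ i = 0" unfolding z[unfolded Kw[OF w]] using i by simp
        ultimately show "(M *\<^sub>v (L *\<^sub>v w)) $ i = w $ i" by (metis right_minus_eq)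
      qed (use carrier_vecD[OF c] carrier_vecD[OF w] in simp)
    next
      assume "M *\<^sub>v (L *\<^sub>v w) = w"
      then show "?K *\<^sub>v w = 0\<^sub>v (2 * q)" unfolding Kw[OF w] using w by simp
    qed
  qed
  have flagX: "nflag n x q ((!) F)" "length F = Suc q" "\<And>w. w \<in> F ! q \<Longrightarrow> w \<in> carrier_vec n"
    if "F \<in> ?X" for F
    using that nflag_lin_subspace[of n x q "(!) F" q] lin_subspaceD(1) unfolding X nilp_flags_iff by auto
  have flagE: "nflag (2 * q) y q ((!) G)" "length G = Suc q" "\<And>w. w \<in> G ! q \<Longrightarrow> w \<in> carrier_vec (2 * q)"
    if "G \<in> ?E" for G
    using that nflag_lin_subspace[of "2 * q" y q "(!) G" q] lin_subspaceD(1) unfolding E nilp_flags_iff by auto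
  have nthM: "map_flag M F ! q = (*\<^sub>v) M ` (F ! q)" if "F \<in> ?X" for F
    unfolding map_flag_def using flagX(2)[OF that] by simp
  have to_Z: "map_flag M F \<in> ?Z" if F: "F \<in> ?X" for F
  proof -
    note f = flagX[OF F]
    have "map_flag M F \<in> nilp_flags (2 * q) q y"
    proof (rule nflag_map_flag[OF emb(1) f(1,2)])
      fix w assume w: "w \<in> F ! q"
      show "M *\<^sub>v (x *\<^sub>v w) = y *\<^sub>v (M *\<^sub>v w)" using emb(4) f(3)[OF w] .
      assume "M *\<^sub>v w = 0\<^sub>v (2 * q)"
      then show "w = 0\<^sub>v n" using emb(3)[OF f(3)[OF w]] zero(1) by simp
    qed
    moreover have "v \<in> map_flag M F ! q"
    proof -
      \<comment> \<open>The condition on the image of the \<open>m\<close>-th power of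
        \<open>x\<close> places \<open>v\<close> in the top member of the image flag.\<close>
      have "(x ^\<^sub>m m) *\<^sub>v c \<in> F ! q" using F emb(5) unfolding delta_springer_def q_def by blast
      moreover have "v = M *\<^sub>v ((x ^\<^sub>m m) *\<^sub>v c)"
        unfolding emb(6) by (rule pow_intertwine[OF emb(1) x(1) y(1) emb(4) emb(5), symmetric])
      ultimately show ?thesis unfolding nthM[OF F] by blast
    qed
    moreover have "?K *\<^sub>v w = 0\<^sub>v (2 * q)" if "w \<in> map_flag M F ! q" for w
    proof -
      obtain u where u: "u \<in> F ! q" "w = M *\<^sub>v u" using \<open>w \<in> map_flag M F ! q\<close> unfolding nthM[OF F] by blast
      have "w \<in> carrier_vec (2 * q)" unfolding u(2) using emb(1) f(3)[OF u(1)] by auto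
      then show ?thesis using K0 emb(3)[OF f(3)[OF u(1)]] u(2) by simp
    qed
    ultimately show ?thesis unfolding E by blast
  qed
  have MLG: "M *\<^sub>v (L *\<^sub>v w) = w" if "G \<in> ?Z" "w \<in> G ! q" for G w
    using that K0 flagE(3)[of G w] by blast
  have to_X: "map_flag L G \<in> ?X" if G: "G \<in> ?Z" for G
    unfolding X
  proof (rule nflag_map_flag[OF emb(2)])
    have GE: "G \<in> ?E" using G by blast
    note g = flagE[OF GE]
    show "nflag (2 * q) y q ((!) G)" "length G = Suc q" using g by auto
    fix w assume w: "w \<in> G ! q"
    \<comment> \<open>Flags in \<open>?Z\<close> lie in the image of \<open>M\<close>, where
      \<open>M\<close> undoes \<open>L\<close>; this gives the injectivity of \<open>L\<close> that
      is needed.\<close>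
    show "w = 0\<^sub>v (2 * q)" if "L *\<^sub>v w = 0\<^sub>v n" using MLG[OF G w] that zero(2) by simp
    have Lw: "L *\<^sub>v w \<in> carrier_vec n" using emb(2) g(3)[OF w] by auto
    have xLw: "x *\<^sub>v (L *\<^sub>v w) \<in> carrier_vec n" using x(1) Lw by auto
    have "L *\<^sub>v (y *\<^sub>v w) = L *\<^sub>v (M *\<^sub>v (x *\<^sub>v (L *\<^sub>v w)))"
      using emb(4)[OF Lw] MLG[OF G w] by simp
    then show "L *\<^sub>v (y *\<^sub>v w) = x *\<^sub>v (L *\<^sub>v w)" using emb(3)[OF xLw] by simp
  qed
  have LMF: "map_flag L (map_flag M F) = F" if "F \<in> ?X" for F
    by (rule map_flag_inverse[OF flagX(1,2)[OF that]]) (use emb(3) flagX(3)[OF that] in blast)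
  have MLF: "map_flag M (map_flag L G) = G" if G: "G \<in> ?Z" for G
  proof -
    have GE: "G \<in> ?E" using G by blast
    show ?thesis by (rule map_flag_inverse[OF flagE(1,2)[OF GE]]) (use MLG[OF G] in blast)
  qed
  have inj: "inj_on (map_flag M) ?X" using LMF by (metis inj_onI)
  have bij: "bij_betw (map_flag M) ?X ?Z"
    unfolding bij_betw_def using inj to_Z to_X MLF by (metis (no_types, lifting) image_eqI image_subsetI subsetI subset_antisym)
  have XF: "?X \<subseteq> flags n q" unfolding X by (rule nilp_flags_subset)
  have EF: "?E \<subseteq> flags (2 * q) q" unfolding E using nilp_flags_subset by blast
  then have ZF: "?Z \<subseteq> flags (2 * q) q" by blast
  have inv: "inv_into ?X (map_flag M) G = map_flag L G" if G: "G \<in> ?Z" for G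
    using inv_into_f_f[OF inj to_X[OF G]] MLF[OF G] by simp
  have "variety_isomorphism n q ?X (2 * q) q ?Z (map_flag M)"
    unfolding variety_isomorphism_def
  proof (intro conjI bij)
    show "variety_morphism n q ?X (2 * q) q ?Z (map_flag M)"
      by (rule variety_morphism_map_flag[OF emb(1) XF ZF refl to_Z])
    show "variety_morphism (2 * q) q ?Z n q ?X (inv_into ?X (map_flag M))"
      by (rule variety_morphism_map_flag[OF emb(2) ZF XF inv to_X])
  qed
  moreover have "closedin (subtopology (zariski_flags (2 * q) q) ?E) ?Z"
    by (rule closedin_flags_in_kernel[OF EF K])
  ultimately show ?thesis unfolding q_def by blast
qed

theorem theorem2:
  fixes n k m N :: nat
  assumes "m \<le> k" and "k \<le> n div 2" and "n < N"
  shows "delta_springer_emb N n k m =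
           (\<Union>a\<in>cup_diagrams n k m. exotic_component N (n - m) (cut_diagram (n - m) a)) \<and>
         closedin (subtopology (zariski_flags (2 * N) (n - m)) (exotic_springer_emb N (n - m) (n - m - k)))
           (\<Union>a\<in>cup_diagrams n k m. exotic_component N (n - m) (cut_diagram (n - m) a)) \<and>
         (\<forall>x \<omega> y v.
            x \<in> carrier_mat n n \<and> nilp_jordan_type x [n - k, k] \<and>
            symplectic_form (2 * (n - m)) \<omega> \<and> one_row_exotic_pair (n - m) (n - m - k) \<omega> y v \<longrightarrow>
            (\<exists>Z \<phi>.
               closedin (subtopology (zariski_flags (2 * (n - m)) (n - m)) (exotic_springer (n - m) \<omega> y v)) Z \<and>
               variety_isomorphism n (n - m) (delta_springer n m x) (2 * (n - m)) (n - m) Z \<phi>))"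
proof (intro conjI allI impI)
  note delta = delta_springer_emb_components[OF assms]
  show "delta_springer_emb N n k m =
      (\<Union>a\<in>cup_diagrams n k m. exotic_component N (n - m) (cut_diagram (n - m) a))"
    by (rule delta)
  show "closedin (subtopology (zariski_flags (2 * N) (n - m)) (exotic_springer_emb N (n - m) (n - m - k)))
      (\<Union>a\<in>cup_diagrams n k m. exotic_component N (n - m) (cut_diagram (n - m) a))"
    using closedin_delta_springer_emb[OF assms] unfolding delta .
  fix x \<omega> y v
  assume "x \<in> carrier_mat n n \<and> nilp_jordan_type x [n - k, k] \<and>
    symplectic_form (2 * (n - m)) \<omega> \<and> one_row_exotic_pair (n - m) (n - m - k) \<omega> y v"
  then show "\<exists>Z \<phi>.
      closedin (subtopology (zariski_flags (2 * (n - m)) (n - m)) (exotic_springer (n - m) \<omega> y v)) Z \<and>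
      variety_isomorphism n (n - m) (delta_springer n m x) (2 * (n - m)) (n - m) Z \<phi>"
    using delta_springer_closed_embedding[OF assms(1,2)] by blast
qed

end
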